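(* Let $d\ge1$ and let $X^{(i)}(\boldsymbol{u})$, $\boldsymbol{u}\in\mathbb{R}^{d+1}$, $i\in\mathbb{N}_0$, be independent identically distributed homogeneous isotropic Gaussian random fields with zero mean, variance $s^2>0$ and covariance function $r(\|\boldsymbol{u}_1-\boldsymbol{u}_2\|)=EX^{(i)}(\boldsymbol{u}_1)X^{(i)}(\boldsymbol{u}_2)$. Let $b>1$ and $$\Lambda^{(i)}(\boldsymbol{\theta})=\frac{e^{X^{(i)}(b^i,\boldsymbol{\theta})}}{Ee^{X^{(i)}(b^i,\boldsymbol{\theta})}},\qquad \boldsymbol{\theta}\in\mathbb{S}^d,\ i\in\mathbb{N}_0 .$$ Suppose that $r(\cdot)$ is non-increasing and that for an integer $p\ge2$ $$b>\exp\left(\frac{p(p-1)s^2}{2d}\right)\qquad\text{and}\qquad\sum_{i=0}^\infty r(b^i)<\infty .$$ If $\mathfrak{B}$ is a fixed finite or countable system of Borel subsets of $\mathbb{S}^d$, then there exists a limiting (random) measure $\mu(\cdot)$ such that for all $B\in\mathfrak{B}$ it holds that $\mu_n(B)\to\mu(B)$ as $n\to\infty$, with probability 1 and in the space $L_p$. If, in addition, $$\sum_{i=0}^\infty\big(s^2-r(b^{-i})\big)<\infty,$$ then the limiting measure $\mu(\cdot)$ is non-degenerate.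
   Context: All random objects live on a fixed probability space; random fields are assumed jointly measurable in the spatial variable and $\omega$. $\mathbb{N}_0=\{0,1,\dots\}$; $\|\cdot\|$ is the Euclidean norm. $\mathbb{S}^d$ is the unit sphere centred at the origin in $\mathbb{R}^{d+1}$ with Borel $\sigma$-algebra $\mathcal{B}(\mathbb{S}^d)$ and surface (Lebesgue) measure $\sigma$. For $\eta\ge0$ and $\boldsymbol{\theta}\in\mathbb{S}^d$, $(\eta,\boldsymbol{\theta})$ denotes the point of $\mathbb{R}^{d+1}$ with radial coordinate $\eta$ and direction $\boldsymbol{\theta}$ (spherical coordinates), i.e. the point $\eta\boldsymbol{\theta}$. The cumulative random measures are $\mu_n(B)=\int_B\prod_{i=0}^n\Lambda^{(i)}(\boldsymbol{\theta})\,\sigma(d\boldsymbol{\theta})$, $B\in\mathcal{B}(\mathbb{S}^d)$, $n\in\mathbb{N}_0$. "Non-degenerate" means not almost surely the zero measure. *)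

theory Defs
  imports "HOL-Probability.Probability"
begin

text \<open>
  Surface measure on the unit sphere: the area of \<open>B\<close> is the dimension of the ambient space
  times the volume of the solid cone \<open>{t *\<^sub>R \<theta> | 0 < t \<le> 1, \<theta> \<in> B}\<close>.
\<close>

definition sphere_measure :: "'a::euclidean_space measure" where
  "sphere_measure =
     scale_measure (of_nat DIM('a))
       (distr (restrict_space lborel (cball 0 1 - {0})) (restrict_space borel (sphere 0 1))
          (\<lambda>x. x /\<^sub>R norm x))"

definition random_field :: "'w measure \<Rightarrow> ('a::euclidean_space \<Rightarrow> 'w \<Rightarrow> real) \<Rightarrow> bool" where
  "random_field M Y \<longleftrightarrow> (\<lambda>(u, \<omega>). Y u \<omega>) \<in> borel_measurable (borel \<Otimes>\<^sub>M M)"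

text \<open>The standard deviation \<open>0\<close> is allowed, so linearly dependent values are not excluded.\<close>

definition gaussian_law :: "real \<Rightarrow> real \<Rightarrow> real measure" where
  "gaussian_law m s = (if s = 0 then return borel m else density lborel (normal_density m s))"

definition gaussian_field :: "'w measure \<Rightarrow> ('a::euclidean_space \<Rightarrow> 'w \<Rightarrow> real) \<Rightarrow> bool" where
  "gaussian_field M Y \<longleftrightarrow>
     random_field M Y \<and>
     (\<forall>F c. finite F \<longrightarrow>
        (\<exists>m s. 0 \<le> s \<and> distr M borel (\<lambda>\<omega>. \<Sum>u\<in>F. c u * Y u \<omega>) = gaussian_law m s))"

text \<open>
  Homogeneity and isotropy in the wide sense; for Gaussian fields this is the same as
  invariance of the finite-dimensional distributions under rigid motions.
\<close>

definition homogeneous_isotropic :: "'w measure \<Rightarrow> ('a::euclidean_space \<Rightarrow> 'w \<Rightarrow> real) \<Rightarrow> bool" where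
  "homogeneous_isotropic M Y \<longleftrightarrow>
     (\<forall>u. Y u \<in> borel_measurable M \<and> integrable M (\<lambda>\<omega>. (Y u \<omega>)\<^sup>2)) \<and>
     (\<exists>m. (\<forall>u. (\<integral>\<omega>. Y u \<omega> \<partial>M) = m) \<and>
        (\<exists>\<rho>. \<forall>u v. (\<integral>\<omega>. (Y u \<omega> - m) * (Y v \<omega> - m) \<partial>M) = \<rho> (norm (u - v))))"

definition iid_fields :: "'w measure \<Rightarrow> (nat \<Rightarrow> 'a::euclidean_space \<Rightarrow> 'w \<Rightarrow> real) \<Rightarrow> bool" where
  "iid_fields M X \<longleftrightarrow>
     prob_space.indep_vars M (\<lambda>_. PiM UNIV (\<lambda>_. borel)) (\<lambda>i \<omega> u. X i u \<omega>) UNIV \<and>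
     (\<forall>i j. distr M (PiM UNIV (\<lambda>_. borel)) (\<lambda>\<omega> u. X i u \<omega>) =
            distr M (PiM UNIV (\<lambda>_. borel)) (\<lambda>\<omega> u. X j u \<omega>))"

definition exp_field ::
  "'w measure \<Rightarrow> (nat \<Rightarrow> 'a::euclidean_space \<Rightarrow> 'w \<Rightarrow> real) \<Rightarrow> real \<Rightarrow> nat \<Rightarrow> 'a \<Rightarrow> 'w \<Rightarrow> real" where
  "exp_field M X b i \<theta> \<omega> =
     exp (X i (b ^ i *\<^sub>R \<theta>) \<omega>) / (\<integral>\<omega>'. exp (X i (b ^ i *\<^sub>R \<theta>) \<omega>') \<partial>M)"

definition cumulative_measure ::
  "(nat \<Rightarrow> 'a::euclidean_space \<Rightarrow> 'w \<Rightarrow> real) \<Rightarrow> nat \<Rightarrow> 'w \<Rightarrow> 'a measure" where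
  "cumulative_measure \<Lambda> n \<omega> =
     density sphere_measure (\<lambda>\<theta>. ennreal (\<Prod>i\<le>n. \<Lambda> i \<theta> \<omega>))"

definition random_sphere_measure :: "'w measure \<Rightarrow> ('w \<Rightarrow> 'a::euclidean_space measure) \<Rightarrow> bool" where
  "random_sphere_measure M \<mu> \<longleftrightarrow>
     (\<forall>\<omega>\<in>space M. sets (\<mu> \<omega>) = sets (restrict_space borel (sphere 0 1)) \<and> finite_measure (\<mu> \<omega>)) \<and>
     (\<forall>B\<in>sets (restrict_space borel (sphere 0 1)). (\<lambda>\<omega>. emeasure (\<mu> \<omega>) B) \<in> borel_measurable M)"

definition non_degenerate :: "'w measure \<Rightarrow> ('w \<Rightarrow> 'a::euclidean_space measure) \<Rightarrow> bool" where
  "non_degenerate M \<mu> \<longleftrightarrow> \<not> (AE \<omega> in M. \<forall>B\<in>sets (\<mu> \<omega>). emeasure (\<mu> \<omega>) B = 0)"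

definition in_Lp :: "'w measure \<Rightarrow> nat \<Rightarrow> ('w \<Rightarrow> real) \<Rightarrow> bool" where
  "in_Lp M p f \<longleftrightarrow> f \<in> borel_measurable M \<and> integrable M (\<lambda>\<omega>. \<bar>f \<omega>\<bar> ^ p)"

definition converges_in_Lp :: "'w measure \<Rightarrow> nat \<Rightarrow> (nat \<Rightarrow> 'w \<Rightarrow> real) \<Rightarrow> ('w \<Rightarrow> real) \<Rightarrow> bool" where
  "converges_in_Lp M p f g \<longleftrightarrow>
     (\<forall>n. in_Lp M p (f n)) \<and> in_Lp M p g \<and>
     (\<lambda>n. \<integral>\<omega>. \<bar>f n \<omega> - g \<omega>\<bar> ^ p \<partial>M) \<longlonglongrightarrow> 0"

end

theory Submission
  imports Defs
begin

text \<open>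
  Write \<open>\<Lambda>\<^sub>i\<close> for the normalised fields, \<open>P\<^sub>n = \<Lambda>\<^sub>0 \<cdots> \<Lambda>\<^sub>n\<close>, \<open>\<sigma>\<close> for the surface measure and \<open>S\<close> for the
  sphere, so that \<open>\<mu>\<^sub>n(B)\<close> is the integral of \<open>P\<^sub>n\<close> over \<open>B\<close>.

  The fields are independent and \<open>\<Lambda>\<^sub>i\<close> has mean one at every point, hence \<open>\<mu>\<^sub>n(B)\<close> is a nonnegative
  martingale for each Borel set \<open>B\<close>. Everything rests on a bound for \<open>E \<mu>\<^sub>n(S)\<^sup>p\<close> that is uniform in
  \<open>n\<close> (\<open>moment_bound\<close>). By Tonelli and the Gaussian exponential moments this is the integral over
  \<open>S\<^sup>p\<close> of \<open>exp (\<Sum> h\<^sub>n(dist \<theta>\<^sub>j \<theta>\<^sub>k))\<close>, the sum running over the unordered pairs \<open>j \<noteq> k\<close>, where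
  \<open>h\<^sub>n(t) = r(t) + r(b t) + \<dots> + r(b\<^sup>n t)\<close>. As \<open>r\<close> decreases to \<open>0\<close>, about \<open>log\<^sub>b (1/t)\<close> of these
  terms can be as large as \<open>r(0) = s\<^sup>2\<close>, and the others add up to at most \<open>\<Sum> r(b\<^sup>i)\<close>; so
  \<open>exp (h\<^sub>n(t))\<close> is at most a constant times \<open>t\<close> to the power \<open>-s\<^sup>2 / ln b\<close>. Bounding all
  \<open>p (p - 1) / 2\<close> pairs by the worst one gives the exponent \<open>-p (p - 1) s\<^sup>2 / (2 ln b)\<close>, which
  exceeds \<open>-d\<close> exactly under the condition imposed on \<open>b\<close>, and such a power of the distance is
  integrable on a \<open>d\<close>-dimensional sphere.

  A nonnegative martingale \<open>Y\<close> that is bounded in \<open>L\<^sub>p\<close> converges almost surely and in \<open>L\<^sub>p\<close>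
  (\<open>Lp_convergence\<close>). The convexity of \<open>x\<^sup>p\<close> yields \<open>E \<bar>Y\<^sub>m - Y\<^sub>n\<bar>\<^sup>p \<le> E Y\<^sub>m\<^sup>p - E Y\<^sub>n\<^sup>p\<close> for \<open>n \<le> m\<close>, so
  the increasing bounded sequence of moments forces the Cauchy property in \<open>L\<^sub>p\<close>; a maximal
  inequality turns this into almost sure convergence.

  The exceptional null set depends on \<open>B\<close>, so the limits have to be assembled into one random
  measure (\<open>random_measure_version\<close>). The sphere is coded measurably into \<open>[0, 1]\<close>; the limits
  attached to the coded half-lines with rational end points give a distribution function for almost
  every \<open>\<omega>\<close>, and its measure, carried back to the sphere, agrees almost surely with the limit for
  every Borel set because both have mean \<open>\<sigma>(B)\<close>. Convergence in \<open>L\<^sub>p\<close> preserves means, so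
  \<open>E \<mu>(S) = \<sigma>(S) > 0\<close>, and this is why \<open>\<mu>\<close> is non-degenerate.
\<close>

section \<open>Nonnegative martingales bounded in \<open>L\<^sub>p\<close>\<close>

text \<open>
  For \<open>p = 2\<close> both sides are \<open>(x - y)\<^sup>2\<close>. The right-hand side \<open>D\<^sub>p\<close> is the gap between \<open>x\<^sup>p\<close> and the
  tangent at \<open>y\<close>, and \<open>D\<^bsub>p + 1\<^esub> = x D\<^sub>p + p y\<^bsup>p - 1\<^esup> (x - y)\<^sup>2\<close>; the first summand suffices for the
  induction if \<open>y \<le> x\<close>, the second one otherwise.
\<close>

lemma power_dist_le_Bregman:
  fixes x y :: real
  assumes "0 \<le> x" "0 \<le> y" "2 \<le> p"
  shows "\<bar>x - y\<bar> ^ p \<le> x ^ p - y ^ p - real p * y ^ (p - 1) * (x - y)"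
  using \<open>2 \<le> p\<close>
proof (induction p rule: dec_induct)
  case base
  show ?case by (simp add: power2_eq_square algebra_simps)
next
  case (step p)
  then have p: "p = Suc (p - 1)" "p \<ge> 2" by auto
  define q where "q = p - 1"
  have pq: "p = Suc q" "q \<ge> 1" using p by (auto simp: q_def)
  have split: "x ^ Suc p - y ^ Suc p - real (Suc p) * y ^ (Suc p - 1) * (x - y)
      = x * (x ^ p - y ^ p - real p * y ^ (p - 1) * (x - y)) + real p * y ^ (p - 1) * (x - y)\<^sup>2"
    unfolding pq by (simp add: algebra_simps power2_eq_square)
  show ?case
  proof (cases "y \<le> x")
    case True
    have "\<bar>x - y\<bar> ^ Suc p = \<bar>x - y\<bar> * \<bar>x - y\<bar> ^ p" by simp
    also have "\<dots> \<le> x * (x ^ p - y ^ p - real p * y ^ (p - 1) * (x - y))"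
      using step.IH True assms by (intro mult_mono) auto
    also have "\<dots> \<le> \<dots> + real p * y ^ (p - 1) * (x - y)\<^sup>2" using assms by simp
    finally show ?thesis using split by simp
  next
    case False
    have "\<bar>x - y\<bar> ^ Suc p = \<bar>x - y\<bar> ^ (p - 1) * \<bar>x - y\<bar>\<^sup>2"
      unfolding pq by (simp only: power_add[symmetric]) simp
    then have "\<bar>x - y\<bar> ^ Suc p = \<bar>x - y\<bar> ^ (p - 1) * (x - y)\<^sup>2"
      by (simp only: power2_abs)
    also have "\<dots> \<le> y ^ (p - 1) * (x - y)\<^sup>2"
      using False assms by (intro mult_right_mono power_mono) auto
    also have "\<dots> \<le> real p * (y ^ (p - 1) * (x - y)\<^sup>2)"
      using p assms mult_right_mono[of 1 "real p" "y ^ (p - 1) * (x - y)\<^sup>2"] by simp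
    also have "\<dots> \<le> x * (x ^ p - y ^ p - real p * y ^ (p - 1) * (x - y)) + \<dots>"
      using order_trans[OF _ step.IH, of 0] assms by simp
    finally show ?thesis using split by (simp add: mult.assoc)
  qed
qed

text \<open>
  Convergence in \<open>L\<^sub>p\<close> controls \<open>L\<^sub>1\<close>: the part of \<open>\<bar>f\<bar>\<close> below \<open>\<delta>\<close> contributes at most \<open>\<delta>\<close>, and
  above \<open>\<delta>\<close> one has \<open>\<bar>f\<bar> \<delta>\<^bsup>p - 1\<^esup> \<le> \<bar>f\<bar>\<^sup>p\<close>.
\<close>

lemma (in prob_space) expectation_abs_le_power:
  fixes f :: "'a \<Rightarrow> real"
  assumes p: "1 \<le> p" and \<delta>: "0 < \<delta>"
    and [measurable]: "f \<in> borel_measurable M" and int: "integrable M (\<lambda>\<omega>. \<bar>f \<omega>\<bar> ^ p)"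
  shows "integrable M f"
    and "expectation (\<lambda>\<omega>. \<bar>f \<omega>\<bar>) \<le> \<delta> + expectation (\<lambda>\<omega>. \<bar>f \<omega>\<bar> ^ p) / \<delta> ^ (p - 1)"
proof -
  have pt: "x \<le> \<delta> + x ^ p / \<delta> ^ (p - 1)" if "0 \<le> x" for x :: real
  proof (cases "x \<le> \<delta>")
    case True
    then show ?thesis using \<delta> that by (simp add: add_increasing2)
  next
    case False
    have "x * \<delta> ^ (p - 1) \<le> x * x ^ (p - 1)" using False \<delta> by (intro mult_left_mono power_mono) auto
    also have "\<dots> = x ^ p" using p by (cases p) auto
    finally have "x \<le> x ^ p / \<delta> ^ (p - 1)" using \<delta> by (simp add: pos_le_divide_eq)
    then show ?thesis using \<delta> by simp
  qed
  have int': "integrable M (\<lambda>\<omega>. \<delta> + \<bar>f \<omega>\<bar> ^ p / \<delta> ^ (p - 1))" using int by simp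
  show f: "integrable M f"
  proof (rule Bochner_Integration.integrable_bound[OF int'])
    show "AE \<omega> in M. norm (f \<omega>) \<le> norm (\<delta> + \<bar>f \<omega>\<bar> ^ p / \<delta> ^ (p - 1))"
      using pt[of "\<bar>f \<omega>\<bar>" for \<omega>] \<delta> by simp
  qed measurable
  have "expectation (\<lambda>\<omega>. \<bar>f \<omega>\<bar>) \<le> expectation (\<lambda>\<omega>. \<delta> + \<bar>f \<omega>\<bar> ^ p / \<delta> ^ (p - 1))"
    by (rule integral_mono[OF integrable_abs[OF f] int']) (rule pt, simp)
  also have "\<dots> = \<delta> + expectation (\<lambda>\<omega>. \<bar>f \<omega>\<bar> ^ p) / \<delta> ^ (p - 1)"
    using int by (simp add: prob_space)
  finally show "expectation (\<lambda>\<omega>. \<bar>f \<omega>\<bar>) \<le> \<delta> + expectation (\<lambda>\<omega>. \<bar>f \<omega>\<bar> ^ p) / \<delta> ^ (p - 1)" .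
qed

text \<open>
  The martingale property is tested against all nonnegative adapted \<open>Z\<close>, not only against
  indicators: with \<open>Z = Y\<^sub>n\<^bsup>p - 1\<^esup>\<close> it evaluates the mixed moments that occur in the tangent
  inequality for \<open>x\<^sup>p\<close>, and no integrability has to be known in advance.
\<close>

locale nonneg_martingale = prob_space M for M :: "'w measure" +
  fixes F :: "nat \<Rightarrow> 'w measure" and Y :: "nat \<Rightarrow> 'w \<Rightarrow> real"
  assumes subalg: "\<And>n. subalgebra M (F n)"
    and filtration: "\<And>m n. m \<le> n \<Longrightarrow> sets (F m) \<subseteq> sets (F n)"
    and adapted: "\<And>n. Y n \<in> borel_measurable (F n)"
    and nonneg: "\<And>n \<omega>. 0 \<le> Y n \<omega>"
    and martingale: "\<And>m n Z. n \<le> m \<Longrightarrow> Z \<in> borel_measurable (F n) \<Longrightarrow>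
      (\<integral>\<^sup>+\<omega>. Z \<omega> * ennreal (Y m \<omega>) \<partial>M) = (\<integral>\<^sup>+\<omega>. Z \<omega> * ennreal (Y n \<omega>) \<partial>M)"
    and finite_mean: "(\<integral>\<^sup>+\<omega>. ennreal (Y 0 \<omega>) \<partial>M) < \<infinity>"
begin

lemma measurable_Y[measurable]: "Y n \<in> borel_measurable M"
  using measurable_from_subalg[OF subalg adapted] .

lemma adapted_le: "k \<le> n \<Longrightarrow> Y k \<in> borel_measurable (F n)"
  using adapted[of k] filtration[of k n] subalg unfolding subalgebra_def
  by (auto simp: measurable_def)

lemma nn_mean: "(\<integral>\<^sup>+\<omega>. ennreal (Y n \<omega>) \<partial>M) = (\<integral>\<^sup>+\<omega>. ennreal (Y 0 \<omega>) \<partial>M)"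
  using martingale[of 0 n "\<lambda>_. 1"] by simp

lemma integrable_Y: "integrable M (Y n)"
  using nn_mean[of n] finite_mean nonneg by (intro integrableI_nonneg) auto

lemma integral_Y_indicator:
  assumes "n \<le> m" "A \<in> sets (F n)"
  shows "(\<integral>\<omega>. indicator A \<omega> * Y m \<omega> \<partial>M) = (\<integral>\<omega>. indicator A \<omega> * Y n \<omega> \<partial>M)"
proof -
  have [measurable]: "A \<in> sets M" using assms subalg unfolding subalgebra_def by blast
  have *: "(\<integral>\<omega>. indicator A \<omega> * Y k \<omega> \<partial>M) = enn2real (\<integral>\<^sup>+\<omega>. indicator A \<omega> * ennreal (Y k \<omega>) \<partial>M)" for k
    by (subst integral_eq_nn_integral)
      (auto simp: nonneg ennreal_mult ennreal_indicator intro!: arg_cong[where f=enn2real])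
  show ?thesis unfolding * using martingale[OF assms(1), of "indicator A"] assms(2) by simp
qed

text \<open>
  On the part of \<open>D\<close> where \<open>Y\<^sub>k - Y\<^sub>n\<close> has a given sign, this difference may be replaced by
  \<open>Y\<^sub>m - Y\<^sub>n\<close> without changing its integral, since that part belongs to the \<open>k\<close>-th
  \<open>\<sigma>\<close>-algebra.
\<close>

lemma integral_abs_increment_mono:
  assumes "n \<le> k" "k \<le> m" "D \<in> sets (F k)"
  shows "(\<integral>\<omega>. indicator D \<omega> * \<bar>Y k \<omega> - Y n \<omega>\<bar> \<partial>M) \<le> (\<integral>\<omega>. indicator D \<omega> * \<bar>Y m \<omega> - Y n \<omega>\<bar> \<partial>M)"
proof -
  define P where "P = {\<omega> \<in> space (F k). Y n \<omega> \<le> Y k \<omega>}"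
  note [measurable] = adapted_le[OF assms(1)] adapted[of k]
  have P: "P \<in> sets (F k)" unfolding P_def by measurable
  have DP: "D \<inter> P \<in> sets (F k)" "D - P \<in> sets (F k)" using P assms by auto
  have sp: "space (F k) = space M" using subalg unfolding subalgebra_def by blast
  have sM: "A \<in> sets (F k) \<Longrightarrow> A \<in> sets M" for A using subalg unfolding subalgebra_def by blast
  note [measurable] = sM[OF DP(1)] sM[OF DP(2)] sM[OF assms(3)]
  have I: "integrable M (\<lambda>\<omega>. indicator A \<omega> * Y j \<omega>)" if "A \<in> sets M" for j A
    using integrable_mult_indicator[OF that integrable_Y, of j] by simp
  note I1 = I[OF sM[OF DP(1)]] I[OF sM[OF DP(2)]]
  have e: "(\<integral>\<omega>. indicator A \<omega> * Y k \<omega> \<partial>M) = (\<integral>\<omega>. indicator A \<omega> * Y m \<omega> \<partial>M)" if "A \<in> sets (F k)" for A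
    using integral_Y_indicator[OF assms(2) that] by simp
  have "(\<integral>\<omega>. indicator D \<omega> * \<bar>Y k \<omega> - Y n \<omega>\<bar> \<partial>M)
     = (\<integral>\<omega>. (indicator (D \<inter> P) \<omega> * Y k \<omega> - indicator (D \<inter> P) \<omega> * Y n \<omega>)
          + (indicator (D - P) \<omega> * Y n \<omega> - indicator (D - P) \<omega> * Y k \<omega>) \<partial>M)"
    by (intro Bochner_Integration.integral_cong) (auto simp: P_def sp split: split_indicator)
  also have "\<dots> = (\<integral>\<omega>. (indicator (D \<inter> P) \<omega> * Y m \<omega> - indicator (D \<inter> P) \<omega> * Y n \<omega>)
          + (indicator (D - P) \<omega> * Y n \<omega> - indicator (D - P) \<omega> * Y m \<omega>) \<partial>M)"
    by (simp add: I1 e[OF DP(1)] e[OF DP(2)])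
  also have "\<dots> \<le> (\<integral>\<omega>. indicator D \<omega> * \<bar>Y m \<omega> - Y n \<omega>\<bar> \<partial>M)"
  proof (intro integral_mono)
    show "integrable M (\<lambda>\<omega>. indicator D \<omega> * \<bar>Y m \<omega> - Y n \<omega>\<bar>)"
      using integrable_mult_indicator[OF sM[OF assms(3)], of "\<lambda>\<omega>. \<bar>Y m \<omega> - Y n \<omega>\<bar>"] integrable_Y by simp
  qed (auto simp: I1 split: split_indicator)
  finally show ?thesis .
qed

text \<open>
  Decompose the event according to the first time \<open>k\<close> at which \<open>Y\<^sub>k\<close> is at distance \<open>\<epsilon>\<close> from
  \<open>Y\<^sub>n\<close>; on each piece the absolute increment can be carried forward from time \<open>k\<close> to time \<open>m\<close>.
\<close>

lemma maximal_inequality: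
  assumes "n \<le> m" "0 < \<epsilon>"
  shows "\<epsilon> * prob {\<omega>\<in>space M. \<exists>k\<in>{n..m}. \<epsilon> \<le> \<bar>Y k \<omega> - Y n \<omega>\<bar>} \<le> expectation (\<lambda>\<omega>. \<bar>Y m \<omega> - Y n \<omega>\<bar>)"
proof -
  define D where "D k = {\<omega>\<in>space M. \<epsilon> \<le> \<bar>Y k \<omega> - Y n \<omega>\<bar> \<and> (\<forall>j\<in>{n..<k}. \<bar>Y j \<omega> - Y n \<omega>\<bar> < \<epsilon>)}" for k
  have DF: "D k \<in> sets (F k)" if "n \<le> k" for k
  proof -
    have sp: "space (F k) = space M" using subalg unfolding subalgebra_def by blast
    have 1: "Y j \<in> borel_measurable (F k)" if "j \<in> {n..<k}" for j using that by (intro adapted_le) auto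
    note [measurable] = adapted_le[OF that] adapted[of k]
    have "{\<omega>\<in>space (F k). \<epsilon> \<le> \<bar>Y k \<omega> - Y n \<omega>\<bar>} \<inter> {\<omega>\<in>space (F k). \<forall>j\<in>{n..<k}. \<bar>Y j \<omega> - Y n \<omega>\<bar> < \<epsilon>} \<in> sets (F k)"
      by (intro sets.Int sets.sets_Collect_finite_All) (use 1 in \<open>measurable\<close>)
    also have "{\<omega>\<in>space (F k). \<epsilon> \<le> \<bar>Y k \<omega> - Y n \<omega>\<bar>} \<inter> {\<omega>\<in>space (F k). \<forall>j\<in>{n..<k}. \<bar>Y j \<omega> - Y n \<omega>\<bar> < \<epsilon>} = D k"
      unfolding D_def sp by auto
    finally show ?thesis .
  qed
  have DM: "D k \<in> events" if "n \<le> k" for k using DF[OF that] subalg unfolding subalgebra_def by blast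
  have disj: "disjoint_family_on D {n..m}"
  proof (unfold disjoint_family_on_def, intro ballI impI)
    fix j k assume "j \<in> {n..m}" "k \<in> {n..m}" "j \<noteq> k"
    then show "D j \<inter> D k = {}"
      by (cases "j < k") (force simp: D_def)+
  qed
  have un: "{\<omega>\<in>space M. \<exists>k\<in>{n..m}. \<epsilon> \<le> \<bar>Y k \<omega> - Y n \<omega>\<bar>} = (\<Union>k\<in>{n..m}. D k)"
  proof (intro equalityI subsetI)
    fix \<omega> assume "\<omega> \<in> {\<omega>\<in>space M. \<exists>k\<in>{n..m}. \<epsilon> \<le> \<bar>Y k \<omega> - Y n \<omega>\<bar>}"
    then obtain k where w: "\<omega> \<in> space M" and k: "k \<in> {n..m} \<and> \<epsilon> \<le> \<bar>Y k \<omega> - Y n \<omega>\<bar>" by auto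
    let ?Q = "\<lambda>k. k \<in> {n..m} \<and> \<epsilon> \<le> \<bar>Y k \<omega> - Y n \<omega>\<bar>"
    have 1: "?Q (Least ?Q)" using k by (rule LeastI[of ?Q])
    have 2: "\<bar>Y j \<omega> - Y n \<omega>\<bar> < \<epsilon>" if "j \<in> {n..<Least ?Q}" for j
      using not_less_Least[of j ?Q] that 1 by auto
    show "\<omega> \<in> (\<Union>k\<in>{n..m}. D k)" using 1 2 w unfolding D_def by blast
  qed (auto simp: D_def)
  have int: "integrable M (\<lambda>\<omega>. indicator (D k) \<omega> * \<bar>Y j \<omega> - Y n \<omega>\<bar>)" if "n \<le> k" for j k
    using integrable_mult_indicator[OF DM[OF that], of "\<lambda>\<omega>. \<bar>Y j \<omega> - Y n \<omega>\<bar>"] integrable_Y by simp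
  have "\<epsilon> * prob (\<Union>k\<in>{n..m}. D k) = (\<Sum>k\<in>{n..m}. \<epsilon> * prob (D k))"
    using disj DM by (subst finite_measure_finite_Union) (auto simp: sum_distrib_left)
  also have "\<dots> \<le> (\<Sum>k\<in>{n..m}. (\<integral>\<omega>. indicator (D k) \<omega> * \<bar>Y m \<omega> - Y n \<omega>\<bar> \<partial>M))"
  proof (rule sum_mono)
    fix k assume k: "k \<in> {n..m}"
    have "\<epsilon> * prob (D k) = (\<integral>\<omega>. indicator (D k) \<omega> * \<epsilon> \<partial>M)"
      using k DM[of k] by simp
    also have "\<dots> \<le> (\<integral>\<omega>. indicator (D k) \<omega> * \<bar>Y k \<omega> - Y n \<omega>\<bar> \<partial>M)"
      using k DM[of k]
      by (intro integral_mono int integrable_mult_left) (auto simp: D_def emeasure_eq_measure split: split_indicator)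
    also have "\<dots> \<le> (\<integral>\<omega>. indicator (D k) \<omega> * \<bar>Y m \<omega> - Y n \<omega>\<bar> \<partial>M)"
      using k by (intro integral_abs_increment_mono DF) auto
    finally show "\<epsilon> * prob (D k) \<le> (\<integral>\<omega>. indicator (D k) \<omega> * \<bar>Y m \<omega> - Y n \<omega>\<bar> \<partial>M)" .
  qed
  also have "\<dots> = (\<integral>\<omega>. (\<Sum>k\<in>{n..m}. indicator (D k) \<omega> * \<bar>Y m \<omega> - Y n \<omega>\<bar>) \<partial>M)"
    by (subst Bochner_Integration.integral_sum) (auto intro: int)
  also have "\<dots> = (\<integral>\<omega>. indicator (\<Union>k\<in>{n..m}. D k) \<omega> * \<bar>Y m \<omega> - Y n \<omega>\<bar> \<partial>M)"
    using disj by (simp add: sum_distrib_right[symmetric] indicator_UN_disjoint)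
  also have "\<dots> \<le> expectation (\<lambda>\<omega>. \<bar>Y m \<omega> - Y n \<omega>\<bar>)"
  proof (intro integral_mono)
    have "(\<Union>k\<in>{n..m}. D k) \<in> events" using DM by auto
    then show "integrable M (\<lambda>\<omega>. indicator (\<Union>k\<in>{n..m}. D k) \<omega> * \<bar>Y m \<omega> - Y n \<omega>\<bar>)"
      using integrable_mult_indicator[of "\<Union>k\<in>{n..m}. D k" M "\<lambda>\<omega>. \<bar>Y m \<omega> - Y n \<omega>\<bar>"] integrable_Y by simp
  qed (auto simp: integrable_Y split: split_indicator)
  finally show ?thesis unfolding un .
qed

text \<open>
  By the maximal inequality the probability of ever leaving the \<open>\<delta>\<close>-neighbourhood of \<open>Y\<^sub>n\<close> after
  time \<open>n\<close> is at most \<open>sup\<^sub>m E \<bar>Y\<^sub>m - Y\<^sub>n\<bar> / \<delta>\<close>, which becomes arbitrarily small for suitable \<open>n\<close>.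
\<close>

lemma AE_Cauchy:
  assumes L1: "\<And>\<epsilon>. 0 < \<epsilon> \<Longrightarrow> \<exists>n. \<forall>m\<ge>n. expectation (\<lambda>\<omega>. \<bar>Y m \<omega> - Y n \<omega>\<bar>) \<le> \<epsilon>"
  shows "AE \<omega> in M. Cauchy (\<lambda>n. Y n \<omega>)"
proof -
  have step: "AE \<omega> in M. \<exists>n. \<forall>k\<ge>n. \<bar>Y k \<omega> - Y n \<omega>\<bar> < \<delta>" if \<delta>: "0 < \<delta>" for \<delta>
  proof -
    define E where "E n = {\<omega>\<in>space M. \<exists>k\<ge>n. \<delta> \<le> \<bar>Y k \<omega> - Y n \<omega>\<bar>}" for n
    have E[measurable]: "E n \<in> events" for n unfolding E_def by measurable
    have bound: "prob (E n) \<le> c / \<delta>" if c: "\<forall>m\<ge>n. expectation (\<lambda>\<omega>. \<bar>Y m \<omega> - Y n \<omega>\<bar>) \<le> c" for n c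
    proof (rule LIMSEQ_le_const2)
      define En where "En m = {\<omega>\<in>space M. \<exists>k\<in>{n..n+m}. \<delta> \<le> \<bar>Y k \<omega> - Y n \<omega>\<bar>}" for m
      have "(\<Union>m. En m) = E n"
      proof (intro equalityI subsetI)
        fix \<omega> assume "\<omega> \<in> E n"
        then obtain k where "\<omega> \<in> space M" "n \<le> k" "\<delta> \<le> \<bar>Y k \<omega> - Y n \<omega>\<bar>" unfolding E_def by auto
        then have "\<omega> \<in> En k" unfolding En_def by auto
        then show "\<omega> \<in> (\<Union>m. En m)" by auto
      qed (auto simp: E_def En_def)
      moreover have "(\<lambda>m. prob (En m)) \<longlonglongrightarrow> prob (\<Union>m. En m)"
      proof (rule finite_Lim_measure_incseq)
        show "range En \<subseteq> events" unfolding En_def by auto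
        show "incseq En" unfolding En_def by (intro incseq_SucI) (auto intro: le_SucI)
      qed
      ultimately show "(\<lambda>m. prob (En m)) \<longlonglongrightarrow> prob (E n)" by simp
      have "prob (En m) \<le> c / \<delta>" for m
        using maximal_inequality[of n "n + m" \<delta>] c \<delta> unfolding En_def[symmetric]
        by (auto simp: pos_le_divide_eq mult.commute intro: order_trans)
      then show "\<exists>N. \<forall>m\<ge>N. prob (En m) \<le> c / \<delta>" by auto
    qed
    have "prob (\<Inter>n. E n) \<le> e" if "0 < e" for e
    proof -
      obtain n where "\<forall>m\<ge>n. expectation (\<lambda>\<omega>. \<bar>Y m \<omega> - Y n \<omega>\<bar>) \<le> e * \<delta>"
        using L1[of "e * \<delta>"] \<open>0 < e\<close> \<delta> by auto
      from bound[OF this] have "prob (E n) \<le> e" using \<delta> by simp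
      moreover have "prob (\<Inter>n. E n) \<le> prob (E n)" by (intro finite_measure_mono) auto
      ultimately show ?thesis by simp
    qed
    then have "prob (\<Inter>n. E n) \<le> 0" by (rule field_le_epsilon[of _ 0, simplified])
    then have "prob (\<Inter>n. E n) = 0" by (simp add: measure_le_0_iff)
    then have "(\<Inter>n. E n) \<in> null_sets M" by (auto simp: null_sets_def emeasure_eq_measure)
    then have "AE \<omega> in M. \<omega> \<notin> (\<Inter>n. E n)" by (rule AE_not_in)
    with AE_space show ?thesis
    proof eventually_elim
      case (elim \<omega>)
      then obtain n where "\<omega> \<notin> E n" by blast
      with elim(1) show ?case unfolding E_def by (intro exI[of _ n]) force
    qed
  qed
  have "AE \<omega> in M. \<forall>j. \<exists>n. \<forall>k\<ge>n. \<bar>Y k \<omega> - Y n \<omega>\<bar> < 1 / real (Suc j)"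
    unfolding AE_all_countable using step by simp
  then show ?thesis
  proof (rule AE_mp, intro AE_I2 impI)
    fix \<omega> assume *: "\<forall>j. \<exists>n. \<forall>k\<ge>n. \<bar>Y k \<omega> - Y n \<omega>\<bar> < 1 / real (Suc j)"
    show "Cauchy (\<lambda>n. Y n \<omega>)"
    proof (rule CauchyI')
      fix e :: real assume "0 < e"
      then obtain j where j: "1 / real (Suc j) < e / 2"
        using reals_Archimedean[of "e/2"] by (auto simp: inverse_eq_divide)
      obtain n where n: "\<And>k. k \<ge> n \<Longrightarrow> \<bar>Y k \<omega> - Y n \<omega>\<bar> < 1 / real (Suc j)" using * by blast
      have "dist (Y m \<omega>) (Y k \<omega>) < e" if "m \<ge> n" "k > m" for m k
        using n[of m] n[of k] that j unfolding dist_real_def by linarith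
      then show "\<exists>M. \<forall>m\<ge>M. \<forall>n>m. dist (Y m \<omega>) (Y n \<omega>) < e" by blast
    qed
  qed
qed

text \<open>
  Testing the martingale property with \<open>Y\<^sub>n\<^bsup>p - 1\<^esup>\<close> removes the linear term of the tangent inequality,
  which leaves \<open>E \<bar>Y\<^sub>m - Y\<^sub>n\<bar>\<^sup>p \<le> E Y\<^sub>m\<^sup>p - E Y\<^sub>n\<^sup>p\<close>. The moments increase and are bounded, hence \<open>Y\<close> is
  Cauchy in \<open>L\<^sub>p\<close> and in \<open>L\<^sub>1\<close>; the almost sure limit is the limit in \<open>L\<^sub>p\<close> by Fatou's lemma.
\<close>

theorem Lp_convergence:
  assumes p: "2 \<le> p" and bdd: "\<And>n. (\<integral>\<^sup>+\<omega>. ennreal (Y n \<omega> ^ p) \<partial>M) \<le> ennreal K"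
  obtains L where "L \<in> borel_measurable M" "\<And>\<omega>. 0 \<le> L \<omega>" "AE \<omega> in M. (\<lambda>n. Y n \<omega>) \<longlonglongrightarrow> L \<omega>"
    "\<And>n. integrable M (\<lambda>\<omega>. \<bar>Y n \<omega>\<bar> ^ p)" "integrable M (\<lambda>\<omega>. \<bar>L \<omega>\<bar> ^ p)"
    "(\<lambda>n. \<integral>\<omega>. \<bar>Y n \<omega> - L \<omega>\<bar> ^ p \<partial>M) \<longlonglongrightarrow> 0"
    "(\<integral>\<^sup>+\<omega>. ennreal (L \<omega>) \<partial>M) = (\<integral>\<^sup>+\<omega>. ennreal (Y 0 \<omega>) \<partial>M)"
proof -
  have intp: "integrable M (\<lambda>\<omega>. Y n \<omega> ^ p)" for n
    using le_less_trans[OF bdd[of n]] by (intro integrableI_nonneg) (auto simp: nonneg)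
  define a where "a n = expectation (\<lambda>\<omega>. Y n \<omega> ^ p)" for n
  have mixed_nn: "(\<integral>\<^sup>+\<omega>. ennreal (Y n \<omega> ^ (p - 1) * Y m \<omega>) \<partial>M) = (\<integral>\<^sup>+\<omega>. ennreal (Y n \<omega> ^ p) \<partial>M)" if "n \<le> m" for n m
  proof -
    have [measurable]: "Y n \<in> borel_measurable (F n)" by (rule adapted)
    have "(\<integral>\<^sup>+\<omega>. ennreal (Y n \<omega> ^ (p - 1)) * ennreal (Y m \<omega>) \<partial>M) = (\<integral>\<^sup>+\<omega>. ennreal (Y n \<omega> ^ (p - 1)) * ennreal (Y n \<omega>) \<partial>M)"
      by (rule martingale[OF that]) measurable
    moreover have "Y n \<omega> ^ (p - 1) * Y n \<omega> = Y n \<omega> ^ p" for \<omega>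
      using p by (metis One_nat_def Suc_1 Suc_leD Suc_le_lessD power_minus_mult)
    ultimately show ?thesis using nonneg by (simp add: ennreal_mult[symmetric])
  qed
  have mixed_int: "integrable M (\<lambda>\<omega>. Y n \<omega> ^ (p - 1) * Y m \<omega>)" if "n \<le> m" for n m
    using mixed_nn[OF that] le_less_trans[OF bdd[of n]]
    by (intro integrableI_nonneg) (auto simp: nonneg)
  have mixed: "expectation (\<lambda>\<omega>. Y n \<omega> ^ (p - 1) * Y m \<omega>) = a n" if "n \<le> m" for n m
    unfolding a_def using mixed_nn[OF that]
    by (subst (1 2) integral_eq_nn_integral) (auto simp: nonneg)
  have dp: "integrable M (\<lambda>\<omega>. \<bar>Y m \<omega> - Y n \<omega>\<bar> ^ p)"
       "expectation (\<lambda>\<omega>. \<bar>Y m \<omega> - Y n \<omega>\<bar> ^ p) \<le> a m - a n" if "n \<le> m" for n m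
  proof -
    let ?g = "\<lambda>\<omega>. Y m \<omega> ^ p - Y n \<omega> ^ p - real p * (Y n \<omega> ^ (p - 1) * Y m \<omega> - Y n \<omega> ^ (p - 1) * Y n \<omega>)"
    have le: "\<bar>Y m \<omega> - Y n \<omega>\<bar> ^ p \<le> ?g \<omega>" for \<omega>
      using power_dist_le_Bregman[OF nonneg nonneg p, of m \<omega> n \<omega>] by (simp add: algebra_simps)
    have gi: "integrable M ?g"
      by (intro Bochner_Integration.integrable_diff integrable_mult_right intp mixed_int that order_refl)
    show 1: "integrable M (\<lambda>\<omega>. \<bar>Y m \<omega> - Y n \<omega>\<bar> ^ p)"
      by (rule Bochner_Integration.integrable_bound[OF gi]) (auto intro!: AE_I2 order_trans[OF le])
    have "expectation (\<lambda>\<omega>. \<bar>Y m \<omega> - Y n \<omega>\<bar> ^ p) \<le> expectation ?g"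
      by (intro integral_mono 1 gi le)
    also have "\<dots> = a m - a n - real p * (a n - a n)"
      using mixed[OF that] mixed[of n n] mixed_int[OF that] mixed_int[of n n] intp
      by (simp add: a_def)
    finally show "expectation (\<lambda>\<omega>. \<bar>Y m \<omega> - Y n \<omega>\<bar> ^ p) \<le> a m - a n" by simp
  qed
  have inc: "incseq a"
    using dp(2) by (intro monoI) (smt (verit) Bochner_Integration.integral_nonneg zero_le_power abs_ge_zero)
  have "a n \<le> max K 0" for n
    using bdd[of n] unfolding a_def
    by (subst integral_eq_nn_integral) (auto simp: nonneg enn2real_leI max_def ennreal_neg split: if_splits)
  then obtain l where l: "a \<longlonglongrightarrow> l" using incseq_convergent[OF inc] by blast
  then have Ca: "Cauchy a" by (rule LIMSEQ_imp_Cauchy)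
  have Lp: "\<exists>n. \<forall>m\<ge>n. expectation (\<lambda>\<omega>. \<bar>Y m \<omega> - Y n \<omega>\<bar> ^ p) \<le> \<epsilon>" if "0 < \<epsilon>" for \<epsilon>
  proof -
    obtain N where N: "\<And>m n. m \<ge> N \<Longrightarrow> n \<ge> N \<Longrightarrow> dist (a m) (a n) < \<epsilon>" using metric_CauchyD[OF Ca \<open>0 < \<epsilon>\<close>] by blast
    have "expectation (\<lambda>\<omega>. \<bar>Y m \<omega> - Y N \<omega>\<bar> ^ p) \<le> \<epsilon>" if "m \<ge> N" for m
      using dp(2)[OF that] N[OF that order_refl] by (auto simp: dist_real_def)
    then show ?thesis by blast
  qed
  have L1: "\<exists>n. \<forall>m\<ge>n. expectation (\<lambda>\<omega>. \<bar>Y m \<omega> - Y n \<omega>\<bar>) \<le> \<epsilon>" if \<epsilon>: "0 < \<epsilon>" for \<epsilon>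
  proof -
    define \<delta> where "\<delta> = \<epsilon> / 2"
    have \<delta>: "0 < \<delta>" using \<epsilon> by (simp add: \<delta>_def)
    obtain n where n: "\<And>m. m \<ge> n \<Longrightarrow> expectation (\<lambda>\<omega>. \<bar>Y m \<omega> - Y n \<omega>\<bar> ^ p) \<le> \<delta> * \<delta> ^ (p - 1)"
      using Lp[of "\<delta> * \<delta> ^ (p - 1)"] \<delta> by auto
    have "expectation (\<lambda>\<omega>. \<bar>Y m \<omega> - Y n \<omega>\<bar>) \<le> \<epsilon>" if "m \<ge> n" for m
    proof -
      have "expectation (\<lambda>\<omega>. \<bar>Y m \<omega> - Y n \<omega>\<bar>)
          \<le> \<delta> + expectation (\<lambda>\<omega>. \<bar>Y m \<omega> - Y n \<omega>\<bar> ^ p) / \<delta> ^ (p - 1)"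
        using p \<delta> dp(1)[OF that] by (intro expectation_abs_le_power(2)) auto
      also have "\<dots> \<le> \<delta> + \<delta>" using n[OF that] \<delta> by (simp add: pos_divide_le_eq)
      finally show ?thesis by (simp add: \<delta>_def)
    qed
    then show ?thesis by blast
  qed
  have AEC: "AE \<omega> in M. Cauchy (\<lambda>n. Y n \<omega>)" by (rule AE_Cauchy[OF L1])
  define L where "L \<omega> = (if Cauchy (\<lambda>n. Y n \<omega>) then lim (\<lambda>n. Y n \<omega>) else 0)" for \<omega>
  have conv: "(\<lambda>n. Y n \<omega>) \<longlonglongrightarrow> L \<omega>" if "Cauchy (\<lambda>n. Y n \<omega>)" for \<omega>
    using that by (auto simp: L_def Cauchy_convergent_iff convergent_LIMSEQ_iff)
  have Lm[measurable]: "L \<in> borel_measurable M" unfolding L_def by measurable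
  have L0: "0 \<le> L \<omega>" for \<omega>
  proof (cases "Cauchy (\<lambda>n. Y n \<omega>)")
    case True
    show ?thesis by (rule LIMSEQ_le_const[OF conv[OF True]]) (auto simp: nonneg)
  qed (simp add: L_def)
  have AEL: "AE \<omega> in M. (\<lambda>n. Y n \<omega>) \<longlonglongrightarrow> L \<omega>" using AEC by eventually_elim (rule conv)
  have al: "a n \<le> l" for n using incseq_le[OF inc l] .
  have fat: "(\<integral>\<^sup>+\<omega>. ennreal (\<bar>Y n \<omega> - L \<omega>\<bar> ^ p) \<partial>M) \<le> ennreal (l - a n)" for n
  proof -
    have "(\<integral>\<^sup>+\<omega>. ennreal (\<bar>Y n \<omega> - L \<omega>\<bar> ^ p) \<partial>M) = (\<integral>\<^sup>+\<omega>. liminf (\<lambda>m. ennreal (\<bar>Y n \<omega> - Y m \<omega>\<bar> ^ p)) \<partial>M)"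
    proof (rule nn_integral_cong_AE)
      show "AE \<omega> in M. ennreal (\<bar>Y n \<omega> - L \<omega>\<bar> ^ p) = liminf (\<lambda>m. ennreal (\<bar>Y n \<omega> - Y m \<omega>\<bar> ^ p))"
        using AEL
      proof eventually_elim
        case (elim \<omega>)
        have "(\<lambda>m. ennreal (\<bar>Y n \<omega> - Y m \<omega>\<bar> ^ p)) \<longlonglongrightarrow> ennreal (\<bar>Y n \<omega> - L \<omega>\<bar> ^ p)"
          by (intro tendsto_intros elim)
        from lim_imp_Liminf[OF _ this] show ?case by simp
      qed
    qed
    also have "\<dots> \<le> liminf (\<lambda>m. \<integral>\<^sup>+\<omega>. ennreal (\<bar>Y n \<omega> - Y m \<omega>\<bar> ^ p) \<partial>M)"
      by (rule nn_integral_liminf) measurable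
    also have "\<dots> \<le> ennreal (l - a n)"
    proof (rule Liminf_le)
      show "\<forall>\<^sub>F m in sequentially. (\<integral>\<^sup>+\<omega>. ennreal (\<bar>Y n \<omega> - Y m \<omega>\<bar> ^ p) \<partial>M) \<le> ennreal (l - a n)"
      proof (rule eventually_sequentiallyI[of n])
        fix m assume m: "n \<le> m"
        have "(\<integral>\<^sup>+\<omega>. ennreal (\<bar>Y n \<omega> - Y m \<omega>\<bar> ^ p) \<partial>M) = ennreal (expectation (\<lambda>\<omega>. \<bar>Y m \<omega> - Y n \<omega>\<bar> ^ p))"
          using dp(1)[OF m] by (subst nn_integral_eq_integral[symmetric]) (auto simp: abs_minus_commute)
        also have "\<dots> \<le> ennreal (l - a n)" using dp(2)[OF m] al[of m] by (intro ennreal_leI) simp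
        finally show "(\<integral>\<^sup>+\<omega>. ennreal (\<bar>Y n \<omega> - Y m \<omega>\<bar> ^ p) \<partial>M) \<le> ennreal (l - a n)" .
      qed
    qed simp
    finally show ?thesis .
  qed
  have iYL: "integrable M (\<lambda>\<omega>. \<bar>Y n \<omega> - L \<omega>\<bar> ^ p)" for n
    using le_less_trans[OF fat[of n]] by (intro integrableI_nonneg) auto
  have eYL: "expectation (\<lambda>\<omega>. \<bar>Y n \<omega> - L \<omega>\<bar> ^ p) \<le> l - a n" for n
    using fat[of n] al[of n] by (subst integral_eq_nn_integral) (auto intro: enn2real_leI)
  have lim0: "(\<lambda>n. \<integral>\<omega>. \<bar>Y n \<omega> - L \<omega>\<bar> ^ p \<partial>M) \<longlonglongrightarrow> 0"
  proof (rule tendsto_sandwich[OF _ _ tendsto_const])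
    show "(\<lambda>n. l - a n) \<longlonglongrightarrow> 0" using tendsto_diff[OF tendsto_const l, of l] by simp
  qed (auto simp: eYL)
  have iL: "integrable M (\<lambda>\<omega>. \<bar>L \<omega>\<bar> ^ p)"
  proof (rule Bochner_Integration.integrable_bound)
    show "integrable M (\<lambda>\<omega>. 2 ^ p * (\<bar>Y 0 \<omega> - L \<omega>\<bar> ^ p + Y 0 \<omega> ^ p))" using iYL intp by simp
    show "AE \<omega> in M. norm (\<bar>L \<omega>\<bar> ^ p) \<le> norm (2 ^ p * (\<bar>Y 0 \<omega> - L \<omega>\<bar> ^ p + Y 0 \<omega> ^ p))"
    proof (rule AE_I2)
      fix \<omega>
      let ?u = "\<bar>Y 0 \<omega> - L \<omega>\<bar>" and ?v = "Y 0 \<omega>"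
      have "\<bar>L \<omega>\<bar> \<le> 2 * max ?u ?v" using nonneg[of 0 \<omega>] L0[of \<omega>] by (auto simp: max_def abs_if)
      then have "\<bar>L \<omega>\<bar> ^ p \<le> (2 * max ?u ?v) ^ p" by (intro power_mono) auto
      also have "\<dots> = 2 ^ p * (max ?u ?v) ^ p" by (rule power_mult_distrib)
      also have "(max ?u ?v) ^ p \<le> ?u ^ p + ?v ^ p" using nonneg[of 0 \<omega>] by (auto simp: max_def)
      finally show "norm (\<bar>L \<omega>\<bar> ^ p) \<le> norm (2 ^ p * (\<bar>Y 0 \<omega> - L \<omega>\<bar> ^ p + Y 0 \<omega> ^ p))"
        using nonneg[of 0 \<omega>] by simp
    qed
  qed measurable
  have L_int: "integrable M L" using p by (rule_tac expectation_abs_le_power(1)[of p 1, OF _ _ Lm iL]) auto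
  have meanY: "expectation (Y n) = expectation (Y 0)" for n
    using nn_mean[of n] by (subst (1 2) integral_eq_nn_integral) (auto simp: nonneg)
  have "\<bar>expectation (Y 0) - expectation L\<bar> \<le> 0"
  proof (rule field_le_epsilon)
    fix \<epsilon> :: real assume "0 < \<epsilon>"
    define \<delta> where "\<delta> = \<epsilon> / 2"
    have \<delta>: "0 < \<delta>" using \<open>0 < \<epsilon>\<close> by (simp add: \<delta>_def)
    have "\<forall>\<^sub>F n in sequentially. (\<integral>\<omega>. \<bar>Y n \<omega> - L \<omega>\<bar> ^ p \<partial>M) < \<delta> * \<delta> ^ (p - 1)"
      using \<delta> by (intro order_tendstoD(2)[OF lim0]) auto
    then obtain n where n: "(\<integral>\<omega>. \<bar>Y n \<omega> - L \<omega>\<bar> ^ p \<partial>M) < \<delta> * \<delta> ^ (p - 1)"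
      by (auto simp: eventually_sequentially)
    have "\<bar>expectation (Y 0) - expectation L\<bar> = \<bar>expectation (\<lambda>\<omega>. Y n \<omega> - L \<omega>)\<bar>"
      using L_int integrable_Y[of n] meanY[of n] by simp
    also have "\<dots> \<le> expectation (\<lambda>\<omega>. \<bar>Y n \<omega> - L \<omega>\<bar>)" by (rule integral_abs_bound)
    also have "\<dots> \<le> \<delta> + (\<integral>\<omega>. \<bar>Y n \<omega> - L \<omega>\<bar> ^ p \<partial>M) / \<delta> ^ (p - 1)"
      using p \<delta> iYL[of n] by (intro expectation_abs_le_power(2)) auto
    also have "\<dots> \<le> \<delta> + \<delta>" using n \<delta> by (simp add: pos_divide_le_eq)
    finally show "\<bar>expectation (Y 0) - expectation L\<bar> \<le> 0 + \<epsilon>" by (simp add: \<delta>_def)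
  qed
  then have mean: "(\<integral>\<^sup>+\<omega>. ennreal (L \<omega>) \<partial>M) = (\<integral>\<^sup>+\<omega>. ennreal (Y 0 \<omega>) \<partial>M)"
    using L_int integrable_Y[of 0] L0 nonneg by (simp add: nn_integral_eq_integral)
  show thesis
    by (rule that[OF Lm L0 AEL _ iL lim0 mean]) (use intp in \<open>simp add: nonneg\<close>)
qed

end

section \<open>Versions of random additive set functions that are measures\<close>

text \<open>
  The standard device below for showing that two random masses coincide: compare them pointwise
  and then in the mean.
\<close>

lemma AE_eq_if_nn_integral_le:
  fixes f g :: "'a \<Rightarrow> ennreal"
  assumes [measurable]: "f \<in> borel_measurable M" "g \<in> borel_measurable M"
    and le: "AE x in M. f x \<le> g x" and int: "(\<integral>\<^sup>+x. g x \<partial>M) \<le> (\<integral>\<^sup>+x. f x \<partial>M)" "(\<integral>\<^sup>+x. f x \<partial>M) < \<infinity>"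
  shows "AE x in M. f x = g x"
proof -
  have "(\<integral>\<^sup>+x. g x - f x \<partial>M) = (\<integral>\<^sup>+x. g x \<partial>M) - (\<integral>\<^sup>+x. f x \<partial>M)"
    using int by (intro nn_integral_diff le) auto
  also have "\<dots> = 0" using int by (intro diff_eq_0_ennreal) auto
  finally have "AE x in M. g x - f x = 0" by (subst (asm) nn_integral_0_iff_AE) auto
  moreover have "AE x in M. f x \<noteq> \<infinity>" using int by (intro nn_integral_PInf_AE) auto
  ultimately show ?thesis using le
    by eventually_elim (metis antisym diff_eq_0_iff_ennreal leI linorder_neqE less_imp_le ennreal_minus_eq_0)
qed

text \<open>
  The intended \<open>K A\<close> is the almost sure limit of \<open>\<mu>\<^sub>n(A)\<close>. Additivity holds outside a null set that
  depends on the two sets, which is all that limits taken separately for each set provide;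
  \<open>\<sigma>\<close>-additivity enters only through the mean \<open>\<tau>\<close>.
\<close>

locale random_additive_family = finite_measure \<tau> for \<tau> :: "'a measure" +
  fixes M :: "'w measure" and K :: "'a set \<Rightarrow> 'w \<Rightarrow> real"
  assumes K_measurable: "\<And>A. A \<in> sets \<tau> \<Longrightarrow> K A \<in> borel_measurable M"
    and K_nonneg: "\<And>A \<omega>. 0 \<le> K A \<omega>"
    and K_additive: "\<And>A B. A \<in> sets \<tau> \<Longrightarrow> B \<in> sets \<tau> \<Longrightarrow> A \<inter> B = {} \<Longrightarrow>
      AE \<omega> in M. K (A \<union> B) \<omega> = K A \<omega> + K B \<omega>"
    and K_mean: "\<And>A. A \<in> sets \<tau> \<Longrightarrow> (\<integral>\<^sup>+\<omega>. ennreal (K A \<omega>) \<partial>M) = emeasure \<tau> A"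
begin

lemma K_mono:
  assumes "A \<in> sets \<tau>" "B \<in> sets \<tau>" "A \<subseteq> B"
  shows "AE \<omega> in M. K A \<omega> \<le> K B \<omega>"
proof -
  have "AE \<omega> in M. K (A \<union> (B - A)) \<omega> = K A \<omega> + K (B - A) \<omega>"
    using assms by (intro K_additive) auto
  moreover have "A \<union> (B - A) = B" using assms by auto
  ultimately show ?thesis by (auto simp: K_nonneg)
qed

lemma K_null:
  assumes "A \<in> sets \<tau>" "emeasure \<tau> A = 0"
  shows "AE \<omega> in M. K A \<omega> = 0"
proof -
  note [measurable] = K_measurable[OF assms(1)]
  have "AE \<omega> in M. ennreal (K A \<omega>) = 0"
    using K_mean[OF assms(1)] assms(2) by (intro nn_integral_0_iff_AE[THEN iffD1]) auto
  then show ?thesis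
    by eventually_elim (use K_nonneg in \<open>auto simp: ennreal_eq_0_iff intro: antisym\<close>)
qed

lemma K_UN_finite:
  fixes A :: "nat \<Rightarrow> 'a set"
  assumes A: "range A \<subseteq> sets \<tau>" "disjoint_family A"
  shows "AE \<omega> in M. K (\<Union>i<n. A i) \<omega> = (\<Sum>i<n. K (A i) \<omega>)"
proof (induction n)
  case 0
  show ?case using K_null[of "{}"] by simp
next
  case (Suc n)
  have "(\<Union>i<n. A i) \<inter> A n = {}"
  proof (rule equals0I)
    fix x assume "x \<in> (\<Union>i<n. A i) \<inter> A n"
    then obtain i where "i < n" "x \<in> A i" "x \<in> A n" by blast
    then show False using disjoint_family_onD[OF A(2), of i n] by blast
  qed
  then have "AE \<omega> in M. K ((\<Union>i<n. A i) \<union> A n) \<omega> = K (\<Union>i<n. A i) \<omega> + K (A n) \<omega>"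
    using A(1) by (intro K_additive) auto
  moreover have "(\<Union>i<n. A i) \<union> A n = (\<Union>i<Suc n. A i)" by (auto simp: less_Suc_eq)
  ultimately show ?case using Suc by auto
qed

text \<open>
  A Dynkin argument. For a disjoint union, \<open>\<nu>\<close> is dominated by \<open>K\<close> because of finite additivity
  and monotonicity, and both sides have mean \<open>\<tau> (\<Union>i. A i)\<close>, so they agree almost surely.
\<close>

lemma version_on_generated_sets:
  fixes \<nu> :: "'w \<Rightarrow> 'a measure"
  assumes \<nu>: "\<And>\<omega>. sets (\<nu> \<omega>) = sets \<tau>" "\<And>\<omega>. finite_measure (\<nu> \<omega>)"
    and gen: "sets \<tau> = sigma_sets (space \<tau>) G" "G \<subseteq> Pow (space \<tau>)" "Int_stable G"
    and base: "\<And>A. A \<in> insert (space \<tau>) G \<Longrightarrow>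
      (\<lambda>\<omega>. emeasure (\<nu> \<omega>) A) \<in> borel_measurable M \<and> (AE \<omega> in M. emeasure (\<nu> \<omega>) A = ennreal (K A \<omega>))"
    and A: "A \<in> sets \<tau>"
  shows "(\<lambda>\<omega>. emeasure (\<nu> \<omega>) A) \<in> borel_measurable M \<and> (AE \<omega> in M. emeasure (\<nu> \<omega>) A = ennreal (K A \<omega>))"
proof -
  have sp: "space (\<nu> \<omega>) = space \<tau>" for \<omega> using sets_eq_imp_space_eq[OF \<nu>(1)] .
  have "A \<in> sigma_sets (space \<tau>) G" using A gen by simp
  with gen(3,2) show ?thesis
  proof (induction rule: sigma_sets_induct_disjoint)
    case (basic A)
    then show ?case using base by auto
  next
    case empty
    show ?case using K_null[of "{}"] by (auto simp: ennreal_0[symmetric] simp del: ennreal_0)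
  next
    case (compl A)
    then have A: "A \<in> sets \<tau>" using gen by simp
    have eq: "emeasure (\<nu> \<omega>) (space \<tau> - A) = emeasure (\<nu> \<omega>) (space \<tau>) - emeasure (\<nu> \<omega>) A" for \<omega>
      using emeasure_compl[of A "\<nu> \<omega>"] A \<nu> finite_measure.emeasure_finite[OF \<nu>(2)] by (simp add: sp)
    have "AE \<omega> in M. K (A \<union> (space \<tau> - A)) \<omega> = K A \<omega> + K (space \<tau> - A) \<omega>"
      using A by (intro K_additive) auto
    moreover have "A \<union> (space \<tau> - A) = space \<tau>" using sets.sets_into_space[OF A] by auto
    ultimately have *: "AE \<omega> in M. K (space \<tau>) \<omega> = K A \<omega> + K (space \<tau> - A) \<omega>" by simp
    have "AE \<omega> in M. emeasure (\<nu> \<omega>) (space \<tau>) = ennreal (K (space \<tau>) \<omega>)"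
         "AE \<omega> in M. emeasure (\<nu> \<omega>) A = ennreal (K A \<omega>)"
      using base[of "space \<tau>"] compl by auto
    with * have "AE \<omega> in M. emeasure (\<nu> \<omega>) (space \<tau> - A) = ennreal (K (space \<tau> - A) \<omega>)"
      by eventually_elim (simp add: eq ennreal_minus K_nonneg)
    moreover have "(\<lambda>\<omega>. emeasure (\<nu> \<omega>) (space \<tau> - A)) \<in> borel_measurable M"
      unfolding eq using base[of "space \<tau>"] compl by auto
    ultimately show ?case by simp
  next
    case (union A)
    then have A: "range A \<subseteq> sets \<tau>" using gen by auto
    then have UA: "(\<Union>i. A i) \<in> sets \<tau>" by auto
    have eq: "emeasure (\<nu> \<omega>) (\<Union>i. A i) = (\<Sum>i. emeasure (\<nu> \<omega>) (A i))" for \<omega>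
      using A union.hyps(1) by (intro suminf_emeasure[symmetric]) (auto simp: \<nu>)
    have m: "(\<lambda>\<omega>. emeasure (\<nu> \<omega>) (\<Union>i. A i)) \<in> borel_measurable M"
      unfolding eq using union by (intro borel_measurable_suminf_order) auto
    have AEi: "AE \<omega> in M. \<forall>i. emeasure (\<nu> \<omega>) (A i) = ennreal (K (A i) \<omega>)"
      unfolding AE_all_countable using union by auto
    have AEn: "AE \<omega> in M. \<forall>n. (\<Sum>i<n. K (A i) \<omega>) \<le> K (\<Union>i. A i) \<omega>"
      unfolding AE_all_countable
    proof
      fix n
      have "AE \<omega> in M. K (\<Union>i<n. A i) \<omega> \<le> K (\<Union>i. A i) \<omega>"
        using A by (intro K_mono) auto
      with K_UN_finite[OF A union.hyps(1), of n] show "AE \<omega> in M. (\<Sum>i<n. K (A i) \<omega>) \<le> K (\<Union>i. A i) \<omega>"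
        by eventually_elim simp
    qed
    have "AE \<omega> in M. emeasure (\<nu> \<omega>) (\<Union>i. A i) = ennreal (K (\<Union>i. A i) \<omega>)"
    proof (rule AE_eq_if_nn_integral_le)
      show "(\<lambda>\<omega>. ennreal (K (\<Union>i. A i) \<omega>)) \<in> borel_measurable M" using K_measurable[OF UA] by measurable
      show "AE \<omega> in M. emeasure (\<nu> \<omega>) (\<Union>i. A i) \<le> ennreal (K (\<Union>i. A i) \<omega>)"
        using AEi AEn
      proof eventually_elim
        case (elim \<omega>)
        have "(\<Sum>i<n. ennreal (K (A i) \<omega>)) \<le> ennreal (K (\<Union>i. A i) \<omega>)" for n
          using elim(2) by (subst sum_ennreal) (auto simp: K_nonneg intro!: ennreal_leI)
        then show ?case unfolding eq using elim(1) by (auto intro!: suminf_le_const)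
      qed
      have "(\<integral>\<^sup>+\<omega>. emeasure (\<nu> \<omega>) (\<Union>i. A i) \<partial>M) = (\<Sum>i. \<integral>\<^sup>+\<omega>. emeasure (\<nu> \<omega>) (A i) \<partial>M)"
        unfolding eq using union by (intro nn_integral_suminf) auto
      also have "\<dots> = (\<Sum>i. \<integral>\<^sup>+\<omega>. ennreal (K (A i) \<omega>) \<partial>M)"
        using union by (intro suminf_cong nn_integral_cong_AE) auto
      also have "\<dots> = (\<Sum>i. emeasure \<tau> (A i))" using A by (intro suminf_cong K_mean) auto
      also have "\<dots> = emeasure \<tau> (\<Union>i. A i)" using A union.hyps(1) by (intro suminf_emeasure) auto
      finally have e: "(\<integral>\<^sup>+\<omega>. emeasure (\<nu> \<omega>) (\<Union>i. A i) \<partial>M) = emeasure \<tau> (\<Union>i. A i)" .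
      show "(\<integral>\<^sup>+\<omega>. ennreal (K (\<Union>i. A i) \<omega>) \<partial>M) \<le> (\<integral>\<^sup>+\<omega>. emeasure (\<nu> \<omega>) (\<Union>i. A i) \<partial>M)"
        unfolding e K_mean[OF UA] ..
      show "(\<integral>\<^sup>+\<omega>. emeasure (\<nu> \<omega>) (\<Union>i. A i) \<partial>M) < \<infinity>" unfolding e by (simp add: less_top[symmetric])
    qed (rule m)
    with m show ?case by simp
  qed
qed

end

text \<open>
  Right limits along the rationals turn increasing values at rational points into a right continuous
  distribution function.
\<close>

lemma interval_measure_of_rational_values:
  fixes F :: "rat \<Rightarrow> real"
  assumes mono: "\<And>p q. p \<le> q \<Longrightarrow> F p \<le> F q" and nonneg: "\<And>q. 0 \<le> F q"
    and left: "\<And>q. q < 0 \<Longrightarrow> F q = 0" and right: "\<And>q. 1 \<le> q \<Longrightarrow> F q = T"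
  defines "H \<equiv> \<lambda>x. INF q\<in>{q. x < of_rat q}. F q"
  shows "finite_measure (interval_measure H)" "emeasure (interval_measure H) UNIV = ennreal T"
    "emeasure (interval_measure H) {..x} = ennreal (H x)"
proof -
  have bdd: "bdd_below (F ` A)" for A using nonneg by (auto intro!: bdd_belowI[of _ 0])
  have ne: "{q. x < real_of_rat q} \<noteq> {}" for x using of_rat_dense[of x "x + 1"] by auto
  have H_le: "H x \<le> F q" if "x < of_rat q" for x q
    unfolding H_def using that by (intro cINF_lower bdd) auto
  have H_ge: "c \<le> H x" if "\<And>q. x < of_rat q \<Longrightarrow> c \<le> F q" for x c
    unfolding H_def using that by (intro cINF_greatest ne) auto
  have H_mono: "H x \<le> H y" if "x \<le> y" for x y
    using that by (intro H_ge H_le) auto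
  have H_right: "continuous (at_right a) H" for a
    unfolding continuous_within
  proof (rule tendstoI)
    fix e :: real assume "0 < e"
    have "\<exists>q. a < of_rat q \<and> F q < H a + e"
    proof (rule ccontr)
      assume "\<not> ?thesis"
      then have "H a + e \<le> H a" by (intro H_ge) force
      with \<open>0 < e\<close> show False by simp
    qed
    then obtain q where q: "a < of_rat q" "F q < H a + e" by blast
    have "dist (H y) (H a) < e" if "a < y" "y < of_rat q" for y
      using H_le[OF that(2)] H_mono[of a y] that q by (auto simp: dist_real_def)
    then show "\<forall>\<^sub>F y in at_right a. dist (H y) (H a) < e"
      using q(1) by (auto simp: eventually_at_right[OF q(1)])
  qed
  have H0: "H x = 0" if "x < 0" for x
  proof (rule antisym)
    obtain q where "x < of_rat q" "real_of_rat q < 0" using of_rat_dense[OF \<open>x < 0\<close>] by blast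
    then show "H x \<le> 0" using H_le[of x q] left[of q] by simp
  qed (use nonneg in \<open>auto intro: H_ge\<close>)
  have H1: "H x = T" if "1 \<le> x" for x
  proof (rule antisym)
    obtain q where q: "x < of_rat q" using ne[of x] by auto
    then have "1 \<le> real_of_rat q" using that by linarith
    then have "1 \<le> q" by simp
    then show "H x \<le> T" using H_le[OF q] right by simp
    show "T \<le> H x"
    proof (rule H_ge)
      fix q assume "x < of_rat q"
      then have "1 \<le> real_of_rat q" using that by linarith
    then have "1 \<le> q" by simp
      then show "T \<le> F q" using right by simp
    qed
  qed
  have bot: "(H \<longlongrightarrow> 0) at_bot"
    by (rule tendsto_eventually) (use H0 in \<open>auto simp: eventually_at_bot_dense\<close>)
  have top: "(H \<longlongrightarrow> T) at_top"
    by (rule tendsto_eventually) (use H1 in \<open>auto simp: eventually_at_top_linorder\<close>)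
  have T: "0 \<le> T" using nonneg[of 1] right[of 1] by simp
  show "emeasure (interval_measure H) UNIV = ennreal T"
    by (rule interval_measure_UNIV[OF H_mono H_right bot top T])
  show "finite_measure (interval_measure H)"
    using finite_borel_measure_interval_measure[OF H_mono H_right bot top T]
    by (simp add: finite_borel_measure_def)
  show "emeasure (interval_measure H) {..x} = ennreal (H x)"
    by (rule emeasure_interval_measure_Iic[OF H_mono H_right bot])
qed

text \<open>
  For almost every \<open>\<omega>\<close> the values \<open>K {..q}\<close> at rational \<open>q\<close> increase from \<open>0\<close> to the total mass,
  and \<open>\<nu> \<omega>\<close> is the measure of their right continuous envelope \<open>H\<close>. The envelope at \<open>x\<close> dominates
  \<open>K {..x}\<close>, and its mean is at most the limit of \<open>\<tau> {..q}\<close> as \<open>q\<close> decreases to \<open>x\<close>, that is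
  \<open>\<tau> {..x}\<close>; hence it equals \<open>K {..x}\<close> almost surely. Half-lines generate the Borel sets.
\<close>

lemma random_measure_on_line:
  fixes \<tau> :: "real measure"
  assumes "random_additive_family \<tau> M K"
    and \<tau>: "sets \<tau> = sets borel" and supp: "emeasure \<tau> {..<0} = 0" "emeasure \<tau> {1<..} = 0"
  obtains \<nu> :: "'w \<Rightarrow> real measure" where "\<And>\<omega>. sets (\<nu> \<omega>) = sets borel" "\<And>\<omega>. finite_measure (\<nu> \<omega>)"
    "\<And>A. A \<in> sets borel \<Longrightarrow> (\<lambda>\<omega>. emeasure (\<nu> \<omega>) A) \<in> borel_measurable M"
    "\<And>A. A \<in> sets borel \<Longrightarrow> AE \<omega> in M. emeasure (\<nu> \<omega>) A = ennreal (K A \<omega>)"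
proof -
  interpret random_additive_family \<tau> M K by fact
  have sp: "space \<tau> = UNIV" using sets_eq_imp_space_eq[OF \<tau>] by simp
  define F where "F q = K {..real_of_rat q}" for q
  define T where "T = K UNIV"
  have [measurable]: "F q \<in> borel_measurable M" "T \<in> borel_measurable M" for q
    unfolding F_def T_def by (auto intro!: K_measurable simp: \<tau>)
  define good where "good \<omega> \<longleftrightarrow> (\<forall>p q. p \<le> q \<longrightarrow> F p \<omega> \<le> F q \<omega>) \<and>
      (\<forall>q. q < 0 \<longrightarrow> F q \<omega> = 0) \<and> (\<forall>q. 1 \<le> q \<longrightarrow> F q \<omega> = T \<omega>)" for \<omega>
  have gm: "Measurable.pred M good" unfolding good_def by measurable
  have good: "AE \<omega> in M. good \<omega>"
  proof -
    have "AE \<omega> in M. F p \<omega> \<le> F q \<omega>" if "p \<le> q" for p q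
      unfolding F_def using that by (intro K_mono) (auto simp: \<tau> of_rat_less_eq)
    moreover have "AE \<omega> in M. F q \<omega> = 0" if "q < 0" for q
    proof -
      have "{..real_of_rat q} \<subseteq> {..<0}" using of_rat_less[of q 0, where 'a=real] that by (auto simp del: of_rat_less_0_iff)
      then have "emeasure \<tau> {..real_of_rat q} \<le> emeasure \<tau> {..<0}"
        by (intro emeasure_mono) (auto simp: \<tau>)
      then show ?thesis unfolding F_def using supp by (intro K_null) (auto simp: \<tau>)
    qed
    moreover have "AE \<omega> in M. F q \<omega> = T \<omega>" if "1 \<le> q" for q
    proof -
      have r: "1 \<le> real_of_rat q" using that by simp
      have "emeasure \<tau> {real_of_rat q<..} \<le> emeasure \<tau> {1<..}"
        using r by (intro emeasure_mono) (auto simp: \<tau>)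
      then have "AE \<omega> in M. K {real_of_rat q<..} \<omega> = 0" using supp by (intro K_null) (auto simp: \<tau>)
      moreover have "AE \<omega> in M. K ({..real_of_rat q} \<union> {real_of_rat q<..}) \<omega> = F q \<omega> + K {real_of_rat q<..} \<omega>"
        unfolding F_def by (intro K_additive) (auto simp: \<tau>)
      moreover have "{..real_of_rat q} \<union> {real_of_rat q<..} = UNIV" by auto
      ultimately show ?thesis unfolding T_def by auto
    qed
    ultimately show ?thesis unfolding good_def by (simp add: AE_all_countable)
  qed
  define H where "H \<omega> x = (INF q\<in>{q. x < real_of_rat q}. F q \<omega>)" for \<omega> x
  have Hm: "(\<lambda>\<omega>. H \<omega> x) \<in> borel_measurable M" for x unfolding H_def by measurable
  define \<nu> where "\<nu> \<omega> = (if good \<omega> then interval_measure (H \<omega>) else null_measure borel)" for \<omega>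
  have good_props: "finite_measure (interval_measure (H \<omega>))"
      "emeasure (interval_measure (H \<omega>)) UNIV = ennreal (T \<omega>)"
      "emeasure (interval_measure (H \<omega>)) {..x} = ennreal (H \<omega> x)" if "good \<omega>" for \<omega> x
    unfolding H_def
    by (rule interval_measure_of_rational_values[of "\<lambda>q. F q \<omega>"];
        use that in \<open>auto simp: good_def F_def K_nonneg\<close>)+
  have sets_\<nu>: "sets (\<nu> \<omega>) = sets \<tau>" for \<omega> by (simp add: \<nu>_def \<tau>)
  have fin: "finite_measure (\<nu> \<omega>)" for \<omega> using good_props(1)[of \<omega>] by (auto simp: \<nu>_def intro: finite_measureI)
  have H_eq: "AE \<omega> in M. ennreal (K {..x} \<omega>) = ennreal (H \<omega> x)" for x
  proof (rule AE_eq_if_nn_integral_le)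
    show "(\<lambda>\<omega>. ennreal (K {..x} \<omega>)) \<in> borel_measurable M" "(\<lambda>\<omega>. ennreal (H \<omega> x)) \<in> borel_measurable M"
      using Hm K_measurable[of "{..x}"] by (auto simp: \<tau>)
    have "AE \<omega> in M. \<forall>q. x < of_rat q \<longrightarrow> K {..x} \<omega> \<le> F q \<omega>"
      unfolding AE_all_countable F_def
    proof
      fix q
      have "AE \<omega> in M. K {..x} \<omega> \<le> K {..real_of_rat q} \<omega>" if "x < of_rat q"
        using that by (intro K_mono) (auto simp: \<tau>)
      then show "AE \<omega> in M. x < real_of_rat q \<longrightarrow> K {..x} \<omega> \<le> K {..real_of_rat q} \<omega>" by auto
    qed
    then show "AE \<omega> in M. ennreal (K {..x} \<omega>) \<le> ennreal (H \<omega> x)"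
    proof eventually_elim
      case (elim \<omega>)
      have "{q. x < real_of_rat q} \<noteq> {}" using of_rat_dense[of x "x + 1"] by auto
      then show ?case unfolding H_def using elim by (intro ennreal_leI cINF_greatest) auto
    qed
    have mean: "(\<integral>\<^sup>+\<omega>. ennreal (K {..x} \<omega>) \<partial>M) = emeasure \<tau> {..x}" by (intro K_mean) (auto simp: \<tau>)
    have "\<exists>q. x < real_of_rat q \<and> real_of_rat q < x + 1 / real (Suc n)" for n
      using of_rat_dense[of x "x + 1 / real (Suc n)"] by auto
    then obtain qs where qs: "\<And>n. x < real_of_rat (qs n)" "\<And>n. real_of_rat (qs n) < x + 1 / real (Suc n)" by metis
    have "(\<integral>\<^sup>+\<omega>. ennreal (H \<omega> x) \<partial>M) \<le> emeasure \<tau> {..x + 1 / real (Suc n)}" for n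
    proof -
      have "(\<integral>\<^sup>+\<omega>. ennreal (H \<omega> x) \<partial>M) \<le> (\<integral>\<^sup>+\<omega>. ennreal (F (qs n) \<omega>) \<partial>M)"
        unfolding H_def using qs(1)
        by (intro nn_integral_mono ennreal_leI cINF_lower) (auto intro!: bdd_belowI[of _ 0] simp: F_def K_nonneg)
      also have "\<dots> = emeasure \<tau> {..real_of_rat (qs n)}" unfolding F_def by (intro K_mean) (auto simp: \<tau>)
      also have "\<dots> \<le> emeasure \<tau> {..x + 1 / real (Suc n)}"
        using less_imp_le[OF qs(2)[of n]] by (intro emeasure_mono) (auto simp: \<tau>)
      finally show ?thesis .
    qed
    moreover have "(\<lambda>n. emeasure \<tau> {..x + 1 / real (Suc n)}) \<longlonglongrightarrow> emeasure \<tau> (\<Inter>n. {..x + 1 / real (Suc n)})"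
      by (intro Lim_emeasure_decseq)
        (auto simp: \<tau> decseq_def field_simps)
    moreover have "(\<Inter>n. {..x + 1 / real (Suc n)}) = {..x}"
    proof (intro equalityI subsetI)
      fix y assume y: "y \<in> (\<Inter>n. {..x + 1 / real (Suc n)})"
      have "(\<lambda>n. x + 1 / real (Suc n)) \<longlonglongrightarrow> x + 0"
        by (intro tendsto_intros LIMSEQ_inverse_real_of_nat[unfolded inverse_eq_divide])
      then have "y \<le> x + 0" by (rule LIMSEQ_le_const) (use y in auto)
      then show "y \<in> {..x}" by simp
    qed (auto intro: add_increasing2)
    ultimately show "(\<integral>\<^sup>+\<omega>. ennreal (H \<omega> x) \<partial>M) \<le> (\<integral>\<^sup>+\<omega>. ennreal (K {..x} \<omega>) \<partial>M)"
      unfolding mean by (intro LIMSEQ_le_const) auto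
    show "(\<integral>\<^sup>+\<omega>. ennreal (K {..x} \<omega>) \<partial>M) < \<infinity>" unfolding mean by (simp add: less_top[symmetric])
  qed
  have main: "(\<lambda>\<omega>. emeasure (\<nu> \<omega>) A) \<in> borel_measurable M \<and> (AE \<omega> in M. emeasure (\<nu> \<omega>) A = ennreal (K A \<omega>))"
    if A: "A \<in> sets borel" for A
  proof (rule version_on_generated_sets[of \<nu> "range (\<lambda>a. {..a})", OF sets_\<nu> fin])
    show "sets \<tau> = sigma_sets (space \<tau>) (range (\<lambda>a. {..a}))"
      unfolding \<tau> sp by (subst borel_eq_atMost) (simp add: sets_measure_of)
    show "Int_stable (range (\<lambda>a::real. {..a}))" by (auto simp: Int_stable_def)
    show "A \<in> sets \<tau>" using A \<tau> by simp
    fix B assume "B \<in> insert (space \<tau>) (range (\<lambda>a. {..a}))"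
    then consider "B = UNIV" | x where "B = {..x}" using sp by auto
    then show "(\<lambda>\<omega>. emeasure (\<nu> \<omega>) B) \<in> borel_measurable M \<and> (AE \<omega> in M. emeasure (\<nu> \<omega>) B = ennreal (K B \<omega>))"
    proof cases
      case 1
      have "emeasure (\<nu> \<omega>) UNIV = (if good \<omega> then ennreal (T \<omega>) else 0)" for \<omega>
        using good_props(2) by (simp add: \<nu>_def)
      then show ?thesis using good gm by (auto simp: 1 T_def[symmetric])
    next
      case (2 x)
      have e: "emeasure (\<nu> \<omega>) {..x} = (if good \<omega> then ennreal (H \<omega> x) else 0)" for \<omega>
        using good_props(3) by (simp add: \<nu>_def)
      have "AE \<omega> in M. emeasure (\<nu> \<omega>) {..x} = ennreal (K {..x} \<omega>)"
        using good H_eq[of x] by eventually_elim (simp add: e)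
      then show ?thesis using gm Hm[of x] unfolding 2 e by auto
    qed
  qed (auto simp: sp)
  show thesis by (rule that[of \<nu>]) (use main fin sets_\<nu> \<tau> in auto)
qed

text \<open>
  A space with a measurable injection into \<open>[0, 1]\<close> that has a measurable left inverse inherits the
  existence of such versions from the line: push the family forward along \<open>\<phi>\<close> and carry the random
  measure back along \<open>\<psi>\<close>.
\<close>

theorem random_measure_version:
  fixes \<sigma> :: "'a measure"
  assumes "random_additive_family \<sigma> M L"
    and \<phi>[measurable]: "\<phi> \<in> borel_measurable \<sigma>" and \<psi>[measurable]: "\<psi> \<in> borel \<rightarrow>\<^sub>M \<sigma>"
    and range: "\<And>x. x \<in> space \<sigma> \<Longrightarrow> \<phi> x \<in> {0..1::real}"
    and inv: "\<And>x. x \<in> space \<sigma> \<Longrightarrow> \<psi> (\<phi> x) = x"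
  obtains \<mu> :: "'w \<Rightarrow> 'a measure" where "\<And>\<omega>. sets (\<mu> \<omega>) = sets \<sigma>" "\<And>\<omega>. finite_measure (\<mu> \<omega>)"
    "\<And>B. B \<in> sets \<sigma> \<Longrightarrow> (\<lambda>\<omega>. emeasure (\<mu> \<omega>) B) \<in> borel_measurable M"
    "\<And>B. B \<in> sets \<sigma> \<Longrightarrow> AE \<omega> in M. emeasure (\<mu> \<omega>) B = ennreal (L B \<omega>)"
proof -
  interpret random_additive_family \<sigma> M L by fact
  define K where "K A = L (\<phi> -` A \<inter> space \<sigma>)" for A
  have pre: "\<phi> -` A \<inter> space \<sigma> \<in> sets \<sigma>" if "A \<in> sets borel" for A using that by measurable
  let ?\<tau> = "distr \<sigma> borel \<phi>"
  interpret \<tau>: finite_measure ?\<tau> by (rule finite_measure_distr) measurable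
  have "random_additive_family ?\<tau> M K"
  proof
    fix A assume "A \<in> sets ?\<tau>"
    then have A: "A \<in> sets borel" by simp
    show "K A \<in> borel_measurable M" unfolding K_def by (rule K_measurable[OF pre[OF A]])
    show "(\<integral>\<^sup>+\<omega>. ennreal (K A \<omega>) \<partial>M) = emeasure ?\<tau> A"
      unfolding K_def K_mean[OF pre[OF A]] using A by (simp add: emeasure_distr)
    fix B assume "B \<in> sets ?\<tau>" and AB: "A \<inter> B = {}"
    then have B: "B \<in> sets borel" by simp
    have "\<phi> -` (A \<union> B) \<inter> space \<sigma> = (\<phi> -` A \<inter> space \<sigma>) \<union> (\<phi> -` B \<inter> space \<sigma>)" by auto
    then show "AE \<omega> in M. K (A \<union> B) \<omega> = K A \<omega> + K B \<omega>"
      unfolding K_def using AB by (auto intro!: K_additive pre A B)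
  qed (auto simp: K_def K_nonneg)
  moreover have "\<phi> -` {..<0} \<inter> space \<sigma> = {}" "\<phi> -` {1<..} \<inter> space \<sigma> = {}"
    using range by fastforce+
  then have "emeasure ?\<tau> {..<0} = 0" "emeasure ?\<tau> {1<..} = 0" by (simp_all add: emeasure_distr)
  ultimately obtain \<nu> :: "'w \<Rightarrow> real measure" where \<nu>: "\<And>\<omega>. sets (\<nu> \<omega>) = sets borel" "\<And>\<omega>. finite_measure (\<nu> \<omega>)"
    "\<And>A. A \<in> sets borel \<Longrightarrow> (\<lambda>\<omega>. emeasure (\<nu> \<omega>) A) \<in> borel_measurable M"
    "\<And>A. A \<in> sets borel \<Longrightarrow> AE \<omega> in M. emeasure (\<nu> \<omega>) A = ennreal (K A \<omega>)"
    using random_measure_on_line[of ?\<tau> M K] by auto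
  have sp: "space (\<nu> \<omega>) = UNIV" for \<omega> using sets_eq_imp_space_eq[OF \<nu>(1)] by simp
  have \<psi>': "\<psi> \<in> \<nu> \<omega> \<rightarrow>\<^sub>M \<sigma>" for \<omega> using measurable_cong_sets[OF \<nu>(1) refl, of \<omega> \<sigma>] \<psi> by simp
  have e: "emeasure (distr (\<nu> \<omega>) \<sigma> \<psi>) B = emeasure (\<nu> \<omega>) (\<psi> -` B)" if "B \<in> sets \<sigma>" for B \<omega>
    using emeasure_distr[OF \<psi>' that] by (simp add: sp)
  have pb: "\<psi> -` B \<in> sets borel" if "B \<in> sets \<sigma>" for B using measurable_sets[OF \<psi> that] by simp
  have k: "K (\<psi> -` B) = L B" if "B \<in> sets \<sigma>" for B
  proof -
    have "\<phi> -` (\<psi> -` B) \<inter> space \<sigma> = B" using inv sets.sets_into_space[OF that] by auto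
    then show ?thesis by (simp add: K_def)
  qed
  show thesis
  proof (rule that[of "\<lambda>\<omega>. distr (\<nu> \<omega>) \<sigma> \<psi>"])
    show "finite_measure (distr (\<nu> \<omega>) \<sigma> \<psi>)" for \<omega>
      by (rule finite_measure.finite_measure_distr[OF \<nu>(2) \<psi>'])
    fix B assume B: "B \<in> sets \<sigma>"
    show "(\<lambda>\<omega>. emeasure (distr (\<nu> \<omega>) \<sigma> \<psi>) B) \<in> borel_measurable M" unfolding e[OF B] by (rule \<nu>(3)[OF pb[OF B]])
    show "AE \<omega> in M. emeasure (distr (\<nu> \<omega>) \<sigma> \<psi>) B = ennreal (L B \<omega>)"
      using \<nu>(4)[OF pb[OF B]] unfolding e[OF B] k[OF B] .
  qed simp
qed

section \<open>Coding the sphere by real numbers\<close>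

definition binary_digit :: "nat \<Rightarrow> real \<Rightarrow> real" where
  "binary_digit k z = of_int (\<lfloor>2 ^ Suc k * z\<rfloor> - 2 * \<lfloor>2 ^ k * z\<rfloor>)"

definition base4_digit :: "nat \<Rightarrow> real \<Rightarrow> real" where
  "base4_digit k y = of_int (\<lfloor>4 ^ Suc k * y\<rfloor> - 4 * \<lfloor>4 ^ k * y\<rfloor>)"

text \<open>
  Only the digits \<open>0\<close> and \<open>1\<close> are used in base \<open>4\<close>, so that the tail of the expansion stays below
  one unit of the current digit and no two digit sequences share a value.
\<close>

definition base4_value :: "(nat \<Rightarrow> real) \<Rightarrow> real" where
  "base4_value e = (\<Sum>l. e l / 4 ^ Suc l)"

lemma measurable_binary_digit[measurable]: "binary_digit k \<in> borel_measurable borel"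
  unfolding binary_digit_def by measurable

lemma measurable_base4_digit[measurable]: "base4_digit k \<in> borel_measurable borel"
  unfolding base4_digit_def by measurable

lemma binary_digit_cases: "binary_digit k z \<in> {0, 1}"
proof -
  have "\<lfloor>2 ^ Suc k * z\<rfloor> - 2 * \<lfloor>2 ^ k * z\<rfloor> \<in> {0, 1}"
    using floor_correct[of "2 ^ k * z"] floor_correct[of "2 * (2 ^ k * z)"] by (simp add: mult.assoc) linarith
  then show ?thesis unfolding binary_digit_def by auto
qed

lemma sums_binary_digits:
  assumes "0 \<le> z" "z < 1"
  shows "(\<lambda>k. binary_digit k z / 2 ^ Suc k) sums z"
  unfolding sums_def
proof (rule Lim_transform_bound[OF _ LIMSEQ_power_zero, THEN LIM_zero_cancel])
  have partial: "(\<Sum>k<n. binary_digit k z / 2 ^ Suc k) = of_int \<lfloor>2 ^ n * z\<rfloor> / 2 ^ n" for n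
  proof (induction n)
    case 0
    have "\<lfloor>z\<rfloor> = 0" using assms by (simp add: floor_eq_iff)
    then show ?case by simp
  qed (simp add: binary_digit_def field_simps)
  show "\<forall>\<^sub>F n in sequentially. norm ((\<Sum>k<n. binary_digit k z / 2 ^ Suc k) - z) \<le> norm ((1/2::real) ^ n)"
  proof (rule always_eventually, rule allI)
    fix n
    have f: "of_int \<lfloor>2 ^ n * z\<rfloor> \<le> 2 ^ n * z" "2 ^ n * z \<le> of_int \<lfloor>2 ^ n * z\<rfloor> + 1" by linarith+
    have "(\<Sum>k<n. binary_digit k z / 2 ^ Suc k) - z = (of_int \<lfloor>2 ^ n * z\<rfloor> - 2 ^ n * z) / 2 ^ n"
      unfolding partial by (simp add: field_simps)
    moreover have "\<bar>of_int \<lfloor>2 ^ n * z\<rfloor> - 2 ^ n * z\<bar> \<le> 1" using f by linarith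
    then have "\<bar>(of_int \<lfloor>2 ^ n * z\<rfloor> - 2 ^ n * z) / 2 ^ n\<bar> \<le> 1 / 2 ^ n"
      unfolding abs_divide by (intro frac_le) auto
    ultimately show "norm ((\<Sum>k<n. binary_digit k z / 2 ^ Suc k) - z) \<le> norm ((1/2::real) ^ n)"
      by (simp add: power_one_over)
  qed
qed simp

lemma base4_value:
  assumes e: "\<And>l. e l \<in> {0, 1}"
  shows summable_base4_value: "summable (\<lambda>l. e l / 4 ^ Suc l)"
    and base4_value_nonneg: "0 \<le> base4_value e" and base4_value_le: "base4_value e \<le> 1 / 3"
proof -
  have g: "(\<lambda>l. (1/4) * (1 / 4 ^ l)) sums ((1/4) * (4/3::real))"
    using geometric_sums[of "1/4::real"] by (intro sums_mult) (simp add: power_one_over)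
  have le: "0 \<le> e l / 4 ^ Suc l" "e l / 4 ^ Suc l \<le> (1/4) * (1 / 4 ^ l)" for l
    using e[of l] by auto
  show s: "summable (\<lambda>l. e l / 4 ^ Suc l)"
  proof (rule summable_comparison_test'[OF sums_summable[OF g], of 0])
    show "norm (e n / 4 ^ Suc n) \<le> (1/4) * (1 / 4 ^ n)" for n
      using le[of n] by (simp only: real_norm_def abs_of_nonneg)
  qed
  show "0 \<le> base4_value e" unfolding base4_value_def by (rule suminf_nonneg[OF s le(1)])
  have "base4_value e \<le> (\<Sum>l. (1/4) * (1 / 4 ^ l :: real))"
    unfolding base4_value_def by (rule suminf_le[OF le(2) s sums_summable[OF g]])
  then show "base4_value e \<le> 1 / 3" using sums_unique[OF g] by simp
qed

lemma base4_value_shift: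
  assumes e: "\<And>l. e l \<in> {0, 1}"
  shows "4 * base4_value e = e 0 + base4_value (\<lambda>l. e (Suc l))"
proof -
  have s: "summable (\<lambda>l. e l / 4 ^ Suc l)" by (rule summable_base4_value[OF e])
  have "base4_value e = (\<Sum>l. e (Suc l) / 4 ^ Suc (Suc l)) + e 0 / 4"
    unfolding base4_value_def using suminf_split_head[OF s] by simp
  also have "(\<Sum>l. e (Suc l) / 4 ^ Suc (Suc l)) = (\<Sum>l. (1/4) * (e (Suc l) / 4 ^ Suc l))"
    by simp
  also have "\<dots> = (1/4) * base4_value (\<lambda>l. e (Suc l))"
    unfolding base4_value_def by (intro suminf_mult summable_base4_value e)
  finally show ?thesis by simp
qed

text \<open>
  After multiplication by \<open>4\<^sup>k\<close> the first \<open>k\<close> digits form an integer and the rest is at most \<open>1/3\<close>;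
  taking integer parts therefore isolates each digit.
\<close>

lemma base4_digit_value:
  assumes e: "\<And>l. e l \<in> {0, 1}"
  shows "base4_digit k (base4_value e) = e k"
proof -
  have "\<exists>N::int. 4 ^ L * base4_value e = of_int N + base4_value (\<lambda>l. e (l + L))" for L
  proof (induction L)
    case 0
    show ?case by (intro exI[of _ 0]) simp
  next
    case (Suc L)
    then obtain N :: int where N: "4 ^ L * base4_value e = of_int N + base4_value (\<lambda>l. e (l + L))" by blast
    have "4 ^ Suc L * base4_value e = 4 * of_int N + e L + base4_value (\<lambda>l. e (l + Suc L))"
      using N base4_value_shift[of "\<lambda>l. e (l + L)"] e by simp
    moreover have "e L = of_int \<lfloor>e L\<rfloor>" using e[of L] by auto
    ultimately show ?case by (intro exI[of _ "4 * N + \<lfloor>e L\<rfloor>"]) simp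
  qed
  then obtain N :: int where N: "4 ^ k * base4_value e = of_int N + base4_value (\<lambda>l. e (l + k))" by blast
  have N': "4 ^ Suc k * base4_value e = of_int (4 * N + \<lfloor>e k\<rfloor>) + base4_value (\<lambda>l. e (l + Suc k))"
  proof -
    have ek: "real_of_int \<lfloor>e k\<rfloor> = e k" using e[of k] by auto
    show ?thesis unfolding of_int_add ek using N base4_value_shift[of "\<lambda>l. e (l + k)"] e by simp
  qed
  have b: "0 \<le> base4_value (\<lambda>l. e (l + j))" "base4_value (\<lambda>l. e (l + j)) < 1" for j
    using base4_value_nonneg[of "\<lambda>l. e (l + j)"] base4_value_le[of "\<lambda>l. e (l + j)"] e by force+
  have "\<lfloor>4 ^ k * base4_value e\<rfloor> = N" unfolding N using b by (intro floor_unique) auto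
  moreover have "\<lfloor>4 ^ Suc k * base4_value e\<rfloor> = 4 * N + \<lfloor>e k\<rfloor>"
    unfolding N' using b[of "Suc k"] by (intro floor_unique) auto
  ultimately show ?thesis unfolding base4_digit_def using e[of k] by auto
qed

text \<open>
  All binary digits of all coordinates are interleaved into one base \<open>4\<close> expansion. Coordinates in
  \<open>[-1, 1]\<close> are first moved into \<open>[0, 1/2]\<close>, where binary expansions sum to the point itself.
\<close>

lemma ball_coded_in_unit_interval:
  obtains \<phi> :: "'a::euclidean_space \<Rightarrow> real" and \<psi> :: "real \<Rightarrow> 'a"
  where "\<phi> \<in> borel_measurable borel" "\<psi> \<in> borel_measurable borel" "\<And>x. \<phi> x \<in> {0..1}"
    "\<And>x. norm x \<le> 1 \<Longrightarrow> \<psi> (\<phi> x) = x"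
proof -
  let ?A = "(Basis :: 'a set) \<times> (UNIV :: nat set)"
  have cA: "countable ?A" by (intro countable_SIGMA) (auto simp: countable_finite)
  define e where "e x l = (case from_nat_into ?A l of (i, k) \<Rightarrow> binary_digit k ((x \<bullet> i + 1) / 4))" for x :: 'a and l
  define \<phi> where "\<phi> x = base4_value (e x)" for x
  define \<psi> where "\<psi> y = (\<Sum>i\<in>Basis. (4 * (\<Sum>k. base4_digit (to_nat_on ?A (i, k)) y / 2 ^ Suc k) - 1) *\<^sub>R i)" for y
  have e01: "e x l \<in> {0, 1}" for x l unfolding e_def using binary_digit_cases by (simp split: prod.split)
  have "(\<lambda>x. e x l) \<in> borel_measurable borel" for l
    unfolding e_def by (cases "from_nat_into ?A l") simp
  then have "\<phi> \<in> borel_measurable borel" unfolding \<phi>_def base4_value_def by measurable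
  moreover have "\<psi> \<in> borel_measurable borel" unfolding \<psi>_def by measurable
  moreover have "\<phi> x \<in> {0..1}" for x
    unfolding \<phi>_def using base4_value_nonneg[of "e x"] base4_value_le[of "e x"] e01 by force
  moreover have "\<psi> (\<phi> x) = x" if x: "norm x \<le> 1" for x
  proof -
    have digit: "base4_digit (to_nat_on ?A (i, k)) (\<phi> x) = binary_digit k ((x \<bullet> i + 1) / 4)" if "i \<in> Basis" for i k
      unfolding \<phi>_def base4_digit_value[OF e01] using cA that by (simp add: e_def)
    have coord: "(\<Sum>k. base4_digit (to_nat_on ?A (i, k)) (\<phi> x) / 2 ^ Suc k) = (x \<bullet> i + 1) / 4" if i: "i \<in> Basis" for i
    proof -
      have "\<bar>x \<bullet> i\<bar> \<le> 1" using Basis_le_norm[OF i, of x] x by simp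
      then have "(\<lambda>k. binary_digit k ((x \<bullet> i + 1) / 4) / 2 ^ Suc k) sums ((x \<bullet> i + 1) / 4)"
        by (intro sums_binary_digits) auto
      then show ?thesis unfolding digit[OF i] by (rule sums_unique[symmetric])
    qed
    have "\<psi> (\<phi> x) = (\<Sum>i\<in>Basis. (x \<bullet> i) *\<^sub>R i)"
      unfolding \<psi>_def by (intro sum.cong refl) (simp only: coord, simp add: field_simps)
    then show ?thesis by (simp add: euclidean_representation)
  qed
  ultimately show thesis by (rule that)
qed

lemma sphere_coded_in_unit_interval:
  obtains \<phi> :: "'a::euclidean_space \<Rightarrow> real" and \<psi> :: "real \<Rightarrow> 'a"
  where "\<phi> \<in> borel_measurable (restrict_space borel (sphere 0 1))"
    "\<psi> \<in> borel \<rightarrow>\<^sub>M restrict_space borel (sphere 0 1)"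
    "\<And>x. \<phi> x \<in> {0..1}" "\<And>x. x \<in> sphere 0 1 \<Longrightarrow> \<psi> (\<phi> x) = x"
proof -
  obtain \<phi> :: "'a \<Rightarrow> real" and \<psi> :: "real \<Rightarrow> 'a" where
    c: "\<phi> \<in> borel_measurable borel" "\<psi> \<in> borel_measurable borel" "\<And>x. \<phi> x \<in> {0..1}"
      "\<And>x. norm x \<le> 1 \<Longrightarrow> \<psi> (\<phi> x) = x"
    using ball_coded_in_unit_interval by blast
  obtain z :: 'a where z: "z \<in> Basis" using nonempty_Basis by blast
  note [measurable] = c(1,2)
  show thesis
  proof (rule that[of \<phi> "\<lambda>y. if \<psi> y \<in> sphere 0 1 then \<psi> y else z"])
    show "\<phi> \<in> borel_measurable (restrict_space borel (sphere 0 1))"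
      by (rule measurable_restrict_space1) measurable
    have [measurable]: "sphere (0::'a) 1 \<in> sets borel" by simp
    show "(\<lambda>y. if \<psi> y \<in> sphere 0 1 then \<psi> y else z) \<in> borel \<rightarrow>\<^sub>M restrict_space borel (sphere 0 1)"
    proof (rule measurable_restrict_space2)
      show "(\<lambda>y. if \<psi> y \<in> sphere 0 1 then \<psi> y else z) \<in> borel_measurable borel" by measurable
    qed (use z in auto)
  qed (use c(3,4) in auto)
qed

section \<open>Surface measure and spherical caps\<close>

lemma sets_sphere_measure[simp, measurable_cong]:
  "sets (sphere_measure :: 'a::euclidean_space measure) = sets (restrict_space borel (sphere 0 1))"
  by (simp add: sphere_measure_def)

lemma space_sphere_measure[simp]: "space (sphere_measure :: 'a::euclidean_space measure) = sphere 0 1"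
  using sets_eq_imp_space_eq[OF sets_sphere_measure] by (simp add: space_restrict_space)

lemma emeasure_sphere_measure:
  fixes B :: "'a::euclidean_space set"
  assumes B: "B \<in> sets (restrict_space borel (sphere 0 1))"
  shows "emeasure sphere_measure B = of_nat DIM('a) * emeasure lborel {x \<in> cball 0 1 - {0}. x /\<^sub>R norm x \<in> B}"
proof -
  let ?D = "cball 0 1 - {0} :: 'a set"
  have D: "?D \<in> sets lborel" by auto
  have m: "(\<lambda>x. x /\<^sub>R norm x) \<in> restrict_space lborel ?D \<rightarrow>\<^sub>M restrict_space borel (sphere 0 1)"
  proof (rule measurable_restrict_space3)
    show "(\<lambda>x::'a. x /\<^sub>R norm x) \<in> lborel \<rightarrow>\<^sub>M borel" by measurable
  qed (auto simp: divide_simps)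
  have eq: "(\<lambda>x. x /\<^sub>R norm x) -` B \<inter> space (restrict_space lborel ?D) = {x \<in> ?D. x /\<^sub>R norm x \<in> B}"
    by (auto simp: space_restrict_space)
  have "emeasure (restrict_space lborel ?D) {x \<in> ?D. x /\<^sub>R norm x \<in> B} = emeasure lborel {x \<in> ?D. x /\<^sub>R norm x \<in> B}"
    using D by (intro emeasure_restrict_space) auto
  then show ?thesis
    unfolding sphere_measure_def using emeasure_distr[OF m B] eq by simp
qed

lemma finite_sphere_measure: "finite_measure (sphere_measure :: 'a::euclidean_space measure)"
proof (rule finite_measureI)
  have "emeasure (sphere_measure :: 'a measure) (sphere 0 1)
      \<le> of_nat DIM('a) * emeasure lborel (cball (0::'a) 1)"
    by (subst emeasure_sphere_measure) (auto simp: sets_restrict_space intro!: mult_left_mono emeasure_mono)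
  also have "\<dots> < \<infinity>"
    using emeasure_lborel_cball_finite[of "0::'a" 1] by (auto simp: ennreal_mult_less_top less_top ennreal_of_nat_eq_real_of_nat)
  finally show "emeasure (sphere_measure :: 'a measure) (space sphere_measure) \<noteq> \<infinity>" by simp
qed

lemma emeasure_sphere_pos: "emeasure (sphere_measure :: 'a::euclidean_space measure) (sphere 0 1) > 0"
proof -
  have "{x \<in> cball 0 1 - {0::'a}. x /\<^sub>R norm x \<in> sphere 0 1} = cball 0 1 - {0}"
    by (auto simp: divide_simps)
  moreover have "emeasure lborel (cball 0 1 - {0::'a}) = emeasure lborel (cball 0 1 :: 'a set)"
    by (subst emeasure_Diff) auto
  moreover have "emeasure lborel (cball 0 1 :: 'a set) > 0"
    using emeasure_lborel_cball_finite
    by (subst emeasure_cball) (auto intro!: unit_ball_vol_pos)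
  ultimately show ?thesis
    by (subst emeasure_sphere_measure) (auto simp: sets_restrict_space ennreal_zero_less_mult_iff)
qed

text \<open>
  By definition the area of the cap is a multiple of the volume of the cone over it. The cone lies
  in the \<open>\<rho>\<close>-neighbourhood of the segment from \<open>0\<close> to \<open>\<theta>\<close>, which is covered by about
  \<open>1/\<rho>\<close> balls of radius \<open>2\<rho>\<close> centred at the points \<open>k\<rho>\<theta>\<close>; this loses one power of \<open>\<rho>\<close> compared
  with the volume of a ball.
\<close>

lemma sphere_cap_measure_le:
  obtains C where "0 \<le> C"
    "\<And>(\<theta>::'a::euclidean_space) \<rho>. \<theta> \<in> sphere 0 1 \<Longrightarrow> 0 < \<rho> \<Longrightarrow>
      emeasure sphere_measure {\<eta>\<in>sphere 0 1. dist \<theta> \<eta> \<le> \<rho>} \<le> ennreal (C * \<rho> ^ (DIM('a) - 1))"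
proof -
  let ?n = "DIM('a)"
  define V where "V = unit_ball_vol (real ?n)"
  have V: "0 < V" unfolding V_def by (intro unit_ball_vol_pos) simp
  define S where "S = measure (sphere_measure :: 'a measure) (sphere 0 1)"
  interpret fm: finite_measure "sphere_measure :: 'a measure" by (rule finite_sphere_measure)
  have capset: "{\<eta>\<in>sphere 0 1. dist \<theta> \<eta> \<le> \<rho>} \<in> sets (restrict_space borel (sphere (0::'a) 1))" for \<theta> \<rho>
  proof -
    have "{\<eta>\<in>sphere 0 1. dist \<theta> \<eta> \<le> \<rho>} = sphere 0 1 \<inter> cball \<theta> \<rho>" by auto
    then show ?thesis by (auto simp: sets_restrict_space)
  qed
  \<comment> \<open>The first entry takes care of radii above \<open>1\<close>, where the whole sphere serves as the bound;
    for smaller radii at most \<open>1/\<rho> + 1 \<le> 2/\<rho>\<close> balls of volume \<open>V (2\<rho>)\<^sup>n\<close> are used.\<close>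
  define C where "C = max S (real ?n * (2 * V * 2 ^ ?n))"
  have small: "emeasure sphere_measure {\<eta>\<in>sphere 0 1. dist \<theta> \<eta> \<le> \<rho>} \<le> ennreal (C * \<rho> ^ (?n - 1))"
    if th: "\<theta> \<in> sphere 0 1" and \<rho>: "0 < \<rho>" "\<rho> \<le> 1" for \<theta> :: 'a and \<rho>
  proof -
    define m where "m = nat \<lfloor>1 / \<rho>\<rfloor>"
    have m: "real m \<le> 1 / \<rho>" unfolding m_def using \<rho> by simp
    have sub: "{x \<in> cball 0 1 - {0}. x /\<^sub>R norm x \<in> {\<eta>\<in>sphere 0 1. dist \<theta> \<eta> \<le> \<rho>}}
       \<subseteq> (\<Union>k\<in>{..m}. cball ((real k * \<rho>) *\<^sub>R \<theta>) (2 * \<rho>))"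
    proof
      fix x assume "x \<in> {x \<in> cball 0 1 - {0}. x /\<^sub>R norm x \<in> {\<eta>\<in>sphere 0 1. dist \<theta> \<eta> \<le> \<rho>}}"
      then have x: "norm x \<le> 1" "x \<noteq> 0" "dist \<theta> (x /\<^sub>R norm x) \<le> \<rho>" by auto
      define k where "k = nat \<lfloor>norm x / \<rho>\<rfloor>"
      have kf: "real k = of_int \<lfloor>norm x / \<rho>\<rfloor>" unfolding k_def using \<rho> by simp
      have k1: "real k * \<rho> \<le> norm x" using \<rho> kf by (simp add: pos_le_divide_eq[symmetric])
      have "norm x / \<rho> \<le> real k + 1" unfolding kf by linarith
      then have k2: "norm x \<le> real k * \<rho> + \<rho>" using \<rho> by (simp add: pos_divide_le_eq algebra_simps)
      have "k \<le> m" unfolding k_def m_def using \<rho> x(1) by (intro nat_mono floor_mono divide_right_mono) auto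
      have "dist ((real k * \<rho>) *\<^sub>R \<theta>) x \<le> dist ((real k * \<rho>) *\<^sub>R \<theta>) (norm x *\<^sub>R \<theta>) + dist (norm x *\<^sub>R \<theta>) x"
        by (rule dist_triangle)
      also have "dist ((real k * \<rho>) *\<^sub>R \<theta>) (norm x *\<^sub>R \<theta>) = \<bar>real k * \<rho> - norm x\<bar>"
        using th by (simp add: dist_norm scaleR_diff_left[symmetric])
      also have "\<bar>real k * \<rho> - norm x\<bar> \<le> \<rho>" using k1 k2 by linarith
      also have "dist (norm x *\<^sub>R \<theta>) x = norm x * dist \<theta> (x /\<^sub>R norm x)"
      proof -
        have "norm x *\<^sub>R \<theta> - x = norm x *\<^sub>R (\<theta> - x /\<^sub>R norm x)" using x(2) by (simp add: scaleR_diff_right)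
        then show ?thesis by (simp add: dist_norm)
      qed
      also have "\<dots> \<le> 1 * \<rho>" using x by (intro mult_mono) auto
      finally have "x \<in> cball ((real k * \<rho>) *\<^sub>R \<theta>) (2 * \<rho>)" by simp
      with \<open>k \<le> m\<close> show "x \<in> (\<Union>k\<in>{..m}. cball ((real k * \<rho>) *\<^sub>R \<theta>) (2 * \<rho>))" by blast
    qed
    have "emeasure lborel {x \<in> cball 0 1 - {0}. x /\<^sub>R norm x \<in> {\<eta>\<in>sphere 0 1. dist \<theta> \<eta> \<le> \<rho>}}
       \<le> emeasure lborel (\<Union>k\<in>{..m}. cball ((real k * \<rho>) *\<^sub>R \<theta>) (2 * \<rho>))"
      by (rule emeasure_mono[OF sub]) auto
    also have "\<dots> \<le> (\<Sum>k\<in>{..m}. emeasure lborel (cball ((real k * \<rho>) *\<^sub>R \<theta>) (2 * \<rho>)))"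
      by (intro emeasure_subadditive_finite) auto
    also have "\<dots> = ennreal (real (Suc m) * (V * (2 * \<rho>) ^ ?n))"
      using \<rho> V by (simp add: emeasure_cball V_def ennreal_mult ennreal_of_nat_eq_real_of_nat)
    finally have "emeasure sphere_measure {\<eta>\<in>sphere 0 1. dist \<theta> \<eta> \<le> \<rho>}
        \<le> of_nat ?n * ennreal (real (Suc m) * (V * (2 * \<rho>) ^ ?n))"
      unfolding emeasure_sphere_measure[OF capset] by (rule mult_left_mono) simp
    also have "\<dots> = ennreal (real ?n * (real (Suc m) * (V * (2 * \<rho>) ^ ?n)))"
      using V \<rho> by (simp add: ennreal_mult ennreal_of_nat_eq_real_of_nat)
    also have "\<dots> \<le> ennreal (C * \<rho> ^ (?n - 1))"
    proof (rule ennreal_leI)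
      have "real (Suc m) \<le> 2 / \<rho>" using m \<rho> by (simp add: field_simps)
      then have "real ?n * (real (Suc m) * (V * (2 * \<rho>) ^ ?n)) \<le> real ?n * ((2 / \<rho>) * (V * (2 * \<rho>) ^ ?n))"
        using V \<rho> by (intro mult_left_mono mult_right_mono) auto
      also have "(2 / \<rho>) * (V * (2 * \<rho>) ^ ?n) = (2 / \<rho>) * (V * (2 ^ ?n * (\<rho> * \<rho> ^ (?n - 1))))"
        by (simp add: power_mult_distrib power_eq_if[of \<rho> ?n])
      also have "real ?n * \<dots> = real ?n * (2 * V * 2 ^ ?n) * \<rho> ^ (?n - 1)"
        using \<rho> by simp
      also have "\<dots> \<le> C * \<rho> ^ (?n - 1)" unfolding C_def using \<rho> by (intro mult_right_mono) auto
      finally show "real ?n * (real (Suc m) * (V * (2 * \<rho>) ^ ?n)) \<le> C * \<rho> ^ (?n - 1)" .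
    qed
    finally show ?thesis .
  qed
  have large: "emeasure sphere_measure {\<eta>\<in>sphere 0 1. dist \<theta> \<eta> \<le> \<rho>} \<le> ennreal (C * \<rho> ^ (?n - 1))"
    if "1 < \<rho>" for \<theta> :: 'a and \<rho>
  proof -
    have "emeasure sphere_measure {\<eta>\<in>sphere 0 1. dist \<theta> \<eta> \<le> \<rho>} \<le> emeasure sphere_measure (sphere (0::'a) 1)"
      by (intro emeasure_mono) (auto simp: sets_restrict_space)
    also have "\<dots> = ennreal S" unfolding S_def by (simp add: fm.emeasure_eq_measure)
    also have "\<dots> \<le> ennreal (C * \<rho> ^ (?n - 1))"
    proof (rule ennreal_leI)
      have "S * 1 \<le> C * \<rho> ^ (?n - 1)" using that
        by (intro mult_mono) (auto simp: C_def S_def one_le_power le_max_iff_disj)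
      then show "S \<le> C * \<rho> ^ (?n - 1)" by simp
    qed
    finally show ?thesis .
  qed
  show thesis
  proof (rule that)
    show "0 \<le> C" by (simp add: C_def S_def le_max_iff_disj)
    show "emeasure sphere_measure {\<eta>\<in>sphere 0 1. dist \<theta> \<eta> \<le> \<rho>} \<le> ennreal (C * \<rho> ^ (?n - 1))"
      if "\<theta> \<in> sphere 0 1" "0 < \<rho>" for \<theta> :: 'a and \<rho>
      using small[OF that] large[of \<rho> \<theta>] by (cases "\<rho> \<le> 1") auto
  qed
qed

section \<open>Multiplicative cascades\<close>

text \<open>
  Independence is required of the whole fields \<open>\<theta> \<mapsto> \<Lambda> i \<theta> \<omega>\<close>, seen as elements of the product
  space over all points, because moments of the masses involve several points at a time.
\<close>

locale multiplicative_cascade = prob_space M + directing: finite_measure \<sigma>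
  for M :: "'w measure" and \<sigma> :: "'a measure" +
  fixes \<Lambda> :: "nat \<Rightarrow> 'a \<Rightarrow> 'w \<Rightarrow> real"
  assumes \<Lambda>_nonneg: "\<And>i \<theta> \<omega>. 0 \<le> \<Lambda> i \<theta> \<omega>"
    and \<Lambda>_joint: "\<And>i. (\<lambda>(\<theta>, \<omega>). \<Lambda> i \<theta> \<omega>) \<in> borel_measurable (\<sigma> \<Otimes>\<^sub>M M)"
    and \<Lambda>_indep: "indep_vars (\<lambda>_. PiM UNIV (\<lambda>_. borel)) (\<lambda>i \<omega> \<theta>. \<Lambda> i \<theta> \<omega>) UNIV"
    and \<Lambda>_mean: "\<And>i \<theta>. \<theta> \<in> space \<sigma> \<Longrightarrow> (\<integral>\<^sup>+\<omega>. ennreal (\<Lambda> i \<theta> \<omega>) \<partial>M) = 1"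
begin

definition partial_product :: "nat \<Rightarrow> 'a \<Rightarrow> 'w \<Rightarrow> real" where
  "partial_product n \<theta> \<omega> = (\<Prod>i\<le>n. \<Lambda> i \<theta> \<omega>)"

definition mass :: "nat \<Rightarrow> 'a set \<Rightarrow> 'w \<Rightarrow> ennreal" where
  "mass n B \<omega> = (\<integral>\<^sup>+\<theta>. ennreal (partial_product n \<theta> \<omega>) * indicator B \<theta> \<partial>\<sigma>)"

text \<open>
  The \<open>\<sigma>\<close>-algebra generated by the point values of the first \<open>n + 1\<close> fields. Integrals of the fields
  over \<open>\<theta>\<close> are measurable with respect to it only up to null sets (see \<open>mass_eq_cond_exp\<close>),
  because joint measurability refers to all of \<open>M\<close>.
\<close>

definition past :: "nat \<Rightarrow> 'w measure" where
  "past n = vimage_algebra (space M) (\<lambda>\<omega>. \<lambda>i\<in>{..n}. \<lambda>\<theta>. \<Lambda> i \<theta> \<omega>) (PiM {..n} (\<lambda>_. PiM UNIV (\<lambda>_. borel)))"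

lemma measurable_\<Lambda>_pair[measurable]:
  assumes [measurable]: "f \<in> N \<rightarrow>\<^sub>M \<sigma>" "g \<in> N \<rightarrow>\<^sub>M M"
  shows "(\<lambda>x. \<Lambda> i (f x) (g x)) \<in> borel_measurable N"
  using measurable_compose[OF measurable_Pair[OF assms] \<Lambda>_joint[of i]] by simp

lemma measurable_\<Lambda>_field: "(\<lambda>\<omega> \<theta>. \<Lambda> i \<theta> \<omega>) \<in> M \<rightarrow>\<^sub>M PiM UNIV (\<lambda>_. borel)"
  using \<Lambda>_indep unfolding indep_vars_def by auto

lemma measurable_\<Lambda>[measurable]: "\<Lambda> i \<theta> \<in> borel_measurable M"
  using measurable_compose[OF measurable_\<Lambda>_field measurable_component_singleton[of \<theta>]] by simp

lemma partial_product_nonneg: "0 \<le> partial_product n \<theta> \<omega>"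
  unfolding partial_product_def by (intro prod_nonneg) (simp add: \<Lambda>_nonneg)

lemma measurable_partial_product[measurable]:
  assumes [measurable]: "f \<in> N \<rightarrow>\<^sub>M \<sigma>" "g \<in> N \<rightarrow>\<^sub>M M"
  shows "(\<lambda>x. partial_product n (f x) (g x)) \<in> borel_measurable N"
  unfolding partial_product_def by measurable

lemma measurable_mass[measurable]:
  assumes [measurable]: "B \<in> sets \<sigma>"
  shows "mass n B \<in> borel_measurable M"
  unfolding mass_def by measurable

lemma space_past[simp]: "space (past n) = space M"
  unfolding past_def by simp

lemma past_map_measurable:
  "(\<lambda>\<omega>. \<lambda>i\<in>{..n}. \<lambda>\<theta>. \<Lambda> i \<theta> \<omega>) \<in> M \<rightarrow>\<^sub>M PiM {..n} (\<lambda>_. PiM UNIV (\<lambda>_. borel))"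
  by (intro measurable_restrict measurable_\<Lambda>_field)

lemma sets_past: "sets (past n) =
  {(\<lambda>\<omega>. \<lambda>i\<in>{..n}. \<lambda>\<theta>. \<Lambda> i \<theta> \<omega>) -` A \<inter> space M | A. A \<in> sets (PiM {..n} (\<lambda>_. PiM UNIV (\<lambda>_. borel)))}"
  unfolding past_def by (rule sets_vimage_algebra2) (use measurable_space[OF past_map_measurable] in auto)

lemma subalgebra_past: "subalgebra M (past n)"
  unfolding subalgebra_def sets_past using measurable_sets[OF past_map_measurable] by auto

lemma \<Lambda>_past:
  assumes "i \<le> n"
  shows "(\<lambda>\<omega> \<theta>. \<Lambda> i \<theta> \<omega>) \<in> past n \<rightarrow>\<^sub>M PiM UNIV (\<lambda>_. borel)"
proof -
  have "(\<lambda>\<omega>. \<lambda>i\<in>{..n}. \<lambda>\<theta>. \<Lambda> i \<theta> \<omega>) \<in> past n \<rightarrow>\<^sub>M PiM {..n} (\<lambda>_. PiM UNIV (\<lambda>_. borel))"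
    unfolding past_def by (rule measurable_vimage_algebra1) (use measurable_space[OF past_map_measurable] in auto)
  from measurable_compose[OF this measurable_component_singleton[of i]] assms show ?thesis by simp
qed

lemma sets_past_mono:
  assumes "m \<le> n"
  shows "sets (past m) \<subseteq> sets (past n)"
proof
  fix A assume "A \<in> sets (past m)"
  then obtain B where B: "B \<in> sets (PiM {..m} (\<lambda>_. PiM UNIV (\<lambda>_. borel)))"
    "A = (\<lambda>\<omega>. \<lambda>i\<in>{..m}. \<lambda>\<theta>. \<Lambda> i \<theta> \<omega>) -` B \<inter> space M" unfolding sets_past by blast
  have "(\<lambda>\<omega>. \<lambda>i\<in>{..m}. \<lambda>\<theta>. \<Lambda> i \<theta> \<omega>) \<in> past n \<rightarrow>\<^sub>M PiM {..m} (\<lambda>_. PiM UNIV (\<lambda>_. borel))"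
    using assms by (intro measurable_restrict \<Lambda>_past) auto
  from measurable_sets[OF this B(1)] show "A \<in> sets (past n)" unfolding B(2) by simp
qed

lemma partial_product_past: "partial_product n \<theta> \<in> borel_measurable (past n)"
proof -
  have "(\<lambda>\<omega>. \<Lambda> i \<theta> \<omega>) \<in> borel_measurable (past n)" if "i \<in> {..n}" for i
    using measurable_compose[OF \<Lambda>_past[of i n] measurable_component_singleton[of \<theta>]] that by simp
  then show ?thesis unfolding partial_product_def by (intro borel_measurable_prod) auto
qed

lemma partial_product_Suc: "partial_product (Suc n) \<theta> \<omega> = partial_product n \<theta> \<omega> * \<Lambda> (Suc n) \<theta> \<omega>"
  unfolding partial_product_def by (simp add: atMost_Suc mult.commute)

text \<open>
  Both factors are functions of independent groups of fields, so the integral factorises, and the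
  second factor has mean one.
\<close>

lemma nn_integral_past_times_next:
  fixes Z :: "'w \<Rightarrow> ennreal"
  assumes Z: "Z \<in> borel_measurable (past n)" and \<theta>: "\<theta> \<in> space \<sigma>"
  shows "(\<integral>\<^sup>+\<omega>. Z \<omega> * ennreal (\<Lambda> (Suc n) \<theta> \<omega>) \<partial>M) = (\<integral>\<^sup>+\<omega>. Z \<omega> \<partial>M)"
proof -
  let ?B = "\<lambda>_::nat. PiM UNIV (\<lambda>_. borel) :: ('a \<Rightarrow> real) measure"
  let ?V = "\<lambda>\<omega>. \<lambda>i\<in>{..n}. \<lambda>\<theta>. \<Lambda> i \<theta> \<omega>" and ?V' = "\<lambda>\<omega>. \<lambda>i\<in>{Suc n}. \<lambda>\<theta>. \<Lambda> i \<theta> \<omega>"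
  let ?g = "\<lambda>x::nat \<Rightarrow> 'a \<Rightarrow> real. ennreal (x (Suc n) \<theta>)"
  let ?W = "\<lambda>\<omega>. ennreal (\<Lambda> (Suc n) \<theta> \<omega>)"
  have g: "?g \<in> borel_measurable (PiM {Suc n} ?B)"
    using measurable_compose[OF measurable_component_singleton[of "Suc n" "{Suc n}" ?B] measurable_component_singleton[of \<theta>]]
    by simp
  have "indep_var (PiM {..n} ?B) ?V (PiM {Suc n} ?B) ?V'"
    by (rule indep_var_restrict[OF \<Lambda>_indep]) auto
  then have I: "indep_set (sigma_sets (space M) {?V -` A \<inter> space M |A. A \<in> sets (PiM {..n} ?B)})
      (sigma_sets (space M) {?V' -` A \<inter> space M |A. A \<in> sets (PiM {Suc n} ?B)})"
    unfolding indep_var_eq by blast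
  have Z': "sigma_sets (space M) {Z -` A \<inter> space M |A. A \<in> sets borel}
      \<subseteq> sigma_sets (space M) {?V -` A \<inter> space M |A. A \<in> sets (PiM {..n} ?B)}"
  proof (rule sigma_sets_mono', rule subsetI)
    fix C assume "C \<in> {Z -` A \<inter> space M |A. A \<in> sets borel}"
    then have "C \<in> sets (past n)" using measurable_sets[OF Z] by auto
    then show "C \<in> {?V -` A \<inter> space M |A. A \<in> sets (PiM {..n} ?B)}" unfolding sets_past .
  qed
  have W': "sigma_sets (space M) {?W -` A \<inter> space M |A. A \<in> sets borel}
      \<subseteq> sigma_sets (space M) {?V' -` A \<inter> space M |A. A \<in> sets (PiM {Suc n} ?B)}"
  proof (rule sigma_sets_mono', rule subsetI)
    fix C assume "C \<in> {?W -` A \<inter> space M |A. A \<in> sets borel}"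
    then obtain A where A: "A \<in> sets borel" "C = ?W -` A \<inter> space M" by blast
    have "?V' \<omega> \<in> space (PiM {Suc n} ?B)" for \<omega> by (auto simp: space_PiM)
    then have "C = ?V' -` (?g -` A \<inter> space (PiM {Suc n} ?B)) \<inter> space M" unfolding A(2) by auto
    then show "C \<in> {?V' -` A \<inter> space M |A. A \<in> sets (PiM {Suc n} ?B)}"
      using measurable_sets[OF g A(1)] by blast
  qed
  have "indep_set (sigma_sets (space M) {Z -` A \<inter> space M |A. A \<in> sets borel})
      (sigma_sets (space M) {?W -` A \<inter> space M |A. A \<in> sets borel})"
    using I Z' W' unfolding indep_sets2_eq by blast
  then have iv2: "indep_var borel Z borel ?W"
    unfolding indep_var_eq using measurable_from_subalg[OF subalgebra_past Z] by auto
  let ?X = "case_bool Z ?W"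
  have cb: "case_bool borel borel = (\<lambda>_. borel :: ennreal measure)" by (auto split: bool.split)
  have "(\<integral>\<^sup>+\<omega>. (\<Prod>b\<in>UNIV. ?X b \<omega>) \<partial>M) = (\<Prod>b\<in>UNIV. \<integral>\<^sup>+\<omega>. ?X b \<omega> \<partial>M)"
    using iv2 unfolding indep_var_def cb by (intro indep_vars_nn_integral) auto
  then show ?thesis using \<Lambda>_mean[OF \<theta>] by (simp add: UNIV_bool mult.commute)
qed

lemma nn_integral_mass_eq:
  assumes [measurable]: "Z \<in> borel_measurable M" "B \<in> sets \<sigma>"
  shows "(\<integral>\<^sup>+\<omega>. Z \<omega> * mass n B \<omega> \<partial>M)
    = (\<integral>\<^sup>+\<theta>. (\<integral>\<^sup>+\<omega>. Z \<omega> * ennreal (partial_product n \<theta> \<omega>) \<partial>M) * indicator B \<theta> \<partial>\<sigma>)"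
proof -
  interpret P: pair_sigma_finite \<sigma> M ..
  have "(\<integral>\<^sup>+\<omega>. Z \<omega> * mass n B \<omega> \<partial>M)
      = (\<integral>\<^sup>+\<omega>. (\<integral>\<^sup>+\<theta>. Z \<omega> * (ennreal (partial_product n \<theta> \<omega>) * indicator B \<theta>) \<partial>\<sigma>) \<partial>M)"
    unfolding mass_def by (intro nn_integral_cong nn_integral_cmult[symmetric]) measurable
  also have "\<dots> = (\<integral>\<^sup>+\<theta>. (\<integral>\<^sup>+\<omega>. Z \<omega> * (ennreal (partial_product n \<theta> \<omega>) * indicator B \<theta>) \<partial>M) \<partial>\<sigma>)"
    by (rule P.Fubini') measurable
  also have "\<dots> = (\<integral>\<^sup>+\<theta>. (\<integral>\<^sup>+\<omega>. Z \<omega> * ennreal (partial_product n \<theta> \<omega>) \<partial>M) * indicator B \<theta> \<partial>\<sigma>)"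
    by (intro nn_integral_cong) (simp split: split_indicator)
  finally show ?thesis .
qed

lemma mass_martingale:
  fixes Z :: "'w \<Rightarrow> ennreal"
  assumes "n \<le> m" and B[measurable]: "B \<in> sets \<sigma>" and Z: "Z \<in> borel_measurable (past n)"
  shows "(\<integral>\<^sup>+\<omega>. Z \<omega> * mass m B \<omega> \<partial>M) = (\<integral>\<^sup>+\<omega>. Z \<omega> * mass n B \<omega> \<partial>M)"
  using assms(1)
proof (induction m rule: dec_induct)
  case (step m)
  have Zm: "Z \<in> borel_measurable (past m)"
    using Z sets_past_mono[OF step.hyps(1)] by (auto simp: measurable_def)
  have [measurable]: "Z \<in> borel_measurable M" by (rule measurable_from_subalg[OF subalgebra_past Z])
  have "(\<integral>\<^sup>+\<omega>. Z \<omega> * mass (Suc m) B \<omega> \<partial>M) = (\<integral>\<^sup>+\<omega>. Z \<omega> * mass m B \<omega> \<partial>M)"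
    unfolding nn_integral_mass_eq[OF \<open>Z \<in> borel_measurable M\<close> B]
  proof (rule nn_integral_cong, rule arg_cong2[where f="(*)", OF _ refl])
    fix \<theta> assume \<theta>: "\<theta> \<in> space \<sigma>"
    have "(\<lambda>\<omega>. Z \<omega> * ennreal (partial_product m \<theta> \<omega>)) \<in> borel_measurable (past m)"
      using Zm partial_product_past[of m \<theta>] by measurable
    from nn_integral_past_times_next[OF this \<theta>]
    show "(\<integral>\<^sup>+\<omega>. Z \<omega> * ennreal (partial_product (Suc m) \<theta> \<omega>) \<partial>M) = (\<integral>\<^sup>+\<omega>. Z \<omega> * ennreal (partial_product m \<theta> \<omega>) \<partial>M)"
      by (simp add: partial_product_Suc ennreal_mult partial_product_nonneg \<Lambda>_nonneg mult.assoc)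
  qed
  with step.IH show ?case by simp
qed simp

lemma mass_mean:
  assumes B[measurable]: "B \<in> sets \<sigma>"
  shows "(\<integral>\<^sup>+\<omega>. mass n B \<omega> \<partial>M) = emeasure \<sigma> B"
proof -
  have "(\<integral>\<^sup>+\<omega>. mass n B \<omega> \<partial>M) = (\<integral>\<^sup>+\<omega>. mass 0 B \<omega> \<partial>M)"
    using mass_martingale[of 0 n B "\<lambda>_. 1"] by simp
  also have "\<dots> = (\<integral>\<^sup>+\<theta>. (\<integral>\<^sup>+\<omega>. ennreal (partial_product 0 \<theta> \<omega>) \<partial>M) * indicator B \<theta> \<partial>\<sigma>)"
    using nn_integral_mass_eq[of "\<lambda>_. 1" B 0] by simp
  also have "\<dots> = (\<integral>\<^sup>+\<theta>. indicator B \<theta> \<partial>\<sigma>)"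
    by (intro nn_integral_cong) (simp add: partial_product_def \<Lambda>_mean)
  finally show ?thesis by simp
qed

lemma AE_mass_finite:
  assumes [measurable]: "B \<in> sets \<sigma>"
  shows "AE \<omega> in M. \<forall>n. mass n B \<omega> < \<infinity>"
  unfolding AE_all_countable
proof
  fix n
  have "AE \<omega> in M. mass n B \<omega> \<noteq> \<infinity>"
    using mass_mean[OF assms, of n] by (intro nn_integral_PInf_AE) auto
  then show "AE \<omega> in M. mass n B \<omega> < \<infinity>" by (simp add: less_top)
qed

text \<open>
  For any nonnegative \<open>Z\<close>, Tonelli allows \<open>Z\<close> to be replaced by its conditional expectation under
  the integral over \<open>\<theta>\<close>, since \<open>P\<^sub>n(\<theta>)\<close> belongs to the past for each \<open>\<theta>\<close>. Hence the mass and its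
  conditional expectation have the same integral against every \<open>Z\<close>. This makes \<open>mass n B\<close> almost
  surely equal to an adapted variable, as the martingale theory requires.
\<close>

lemma mass_eq_cond_exp:
  assumes B[measurable]: "B \<in> sets \<sigma>"
  shows "AE \<omega> in M. mass n B \<omega> = nn_cond_exp M (past n) (mass n B) \<omega>"
proof -
  interpret S: sigma_finite_subalgebra M "past n"
    by (intro finite_measure_subalgebra_is_sigma_finite)
      (simp add: finite_measure_subalgebra_def finite_measure_subalgebra_axioms_def subalgebra_past finite_measure_axioms)
  let ?E = "nn_cond_exp M (past n)"
  have "(\<integral>\<^sup>+\<omega>. Z \<omega> * mass n B \<omega> \<partial>M) = (\<integral>\<^sup>+\<omega>. Z \<omega> * ?E (mass n B) \<omega> \<partial>M)"
    if [measurable]: "Z \<in> borel_measurable M" for Z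
  proof -
    have "(\<integral>\<^sup>+\<omega>. Z \<omega> * mass n B \<omega> \<partial>M)
      = (\<integral>\<^sup>+\<theta>. (\<integral>\<^sup>+\<omega>. Z \<omega> * ennreal (partial_product n \<theta> \<omega>) \<partial>M) * indicator B \<theta> \<partial>\<sigma>)"
      by (rule nn_integral_mass_eq) measurable
    also have "\<dots> = (\<integral>\<^sup>+\<theta>. (\<integral>\<^sup>+\<omega>. ?E Z \<omega> * ennreal (partial_product n \<theta> \<omega>) \<partial>M) * indicator B \<theta> \<partial>\<sigma>)"
    proof (rule nn_integral_cong, rule arg_cong2[where f="(*)", OF _ refl])
      fix \<theta>
      have [measurable]: "partial_product n \<theta> \<in> borel_measurable (past n)" by (rule partial_product_past)
      show "(\<integral>\<^sup>+\<omega>. Z \<omega> * ennreal (partial_product n \<theta> \<omega>) \<partial>M) = (\<integral>\<^sup>+\<omega>. ?E Z \<omega> * ennreal (partial_product n \<theta> \<omega>) \<partial>M)"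
        using S.nn_cond_exp_intg[of "\<lambda>\<omega>. ennreal (partial_product n \<theta> \<omega>)" Z] by (simp add: mult.commute)
    qed
    also have "\<dots> = (\<integral>\<^sup>+\<omega>. ?E Z \<omega> * mass n B \<omega> \<partial>M)"
      by (rule nn_integral_mass_eq[symmetric]) measurable
    also have "\<dots> = (\<integral>\<^sup>+\<omega>. ?E Z \<omega> * ?E (mass n B) \<omega> \<partial>M)"
      by (rule S.nn_cond_exp_intg[symmetric]) measurable
    also have "\<dots> = (\<integral>\<^sup>+\<omega>. ?E (mass n B) \<omega> * ?E Z \<omega> \<partial>M)" by (simp add: mult.commute)
    also have "\<dots> = (\<integral>\<^sup>+\<omega>. ?E (mass n B) \<omega> * Z \<omega> \<partial>M)"
      by (rule S.nn_cond_exp_intg) measurable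
    finally show ?thesis by (simp add: mult.commute)
  qed
  then show ?thesis
    by (intro density_unique_finite_measure) (auto simp: mult.commute)
qed

text \<open>
  The \<open>p\<close>-th power of an integral is an integral over \<open>p\<close> points; after exchanging the
  integrals, the independence of the fields separates the factors.
\<close>

lemma mass_moment_eq:
  "(\<integral>\<^sup>+\<omega>. mass n (space \<sigma>) \<omega> ^ p \<partial>M)
    = (\<integral>\<^sup>+x. (\<Prod>i\<le>n. \<integral>\<^sup>+\<omega>. (\<Prod>j<p. ennreal (\<Lambda> i (x j) \<omega>)) \<partial>M) \<partial>PiM {..<p} (\<lambda>_. \<sigma>))"
proof -
  interpret PS: product_sigma_finite "\<lambda>_::nat. \<sigma>" ..
  interpret FP: finite_product_sigma_finite "\<lambda>_::nat. \<sigma>" "{..<p}" by standard simp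
  interpret P: pair_sigma_finite "PiM {..<p} (\<lambda>_. \<sigma>)" M ..
  have "(\<integral>\<^sup>+\<omega>. mass n (space \<sigma>) \<omega> ^ p \<partial>M)
     = (\<integral>\<^sup>+\<omega>. (\<integral>\<^sup>+x. (\<Prod>j<p. ennreal (partial_product n (x j) \<omega>)) \<partial>PiM {..<p} (\<lambda>_. \<sigma>)) \<partial>M)"
  proof (intro nn_integral_cong)
    fix \<omega> assume [simp]: "\<omega> \<in> space M"
    have "mass n (space \<sigma>) \<omega> = (\<integral>\<^sup>+\<theta>. ennreal (partial_product n \<theta> \<omega>) \<partial>\<sigma>)"
      unfolding mass_def by (intro nn_integral_cong) simp
    moreover have "(\<integral>\<^sup>+x. (\<Prod>j<p. ennreal (partial_product n (x j) \<omega>)) \<partial>PiM {..<p} (\<lambda>_. \<sigma>))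
       = (\<Prod>j<p. \<integral>\<^sup>+\<theta>. ennreal (partial_product n \<theta> \<omega>) \<partial>\<sigma>)"
      by (rule PS.product_nn_integral_prod) simp_all
    ultimately show "mass n (space \<sigma>) \<omega> ^ p
       = (\<integral>\<^sup>+x. (\<Prod>j<p. ennreal (partial_product n (x j) \<omega>)) \<partial>PiM {..<p} (\<lambda>_. \<sigma>))" by simp
  qed
  also have "\<dots> = (\<integral>\<^sup>+x. (\<integral>\<^sup>+\<omega>. (\<Prod>j<p. ennreal (partial_product n (x j) \<omega>)) \<partial>M) \<partial>PiM {..<p} (\<lambda>_. \<sigma>))"
    by (rule P.Fubini') measurable
  also have "\<dots> = (\<integral>\<^sup>+x. (\<Prod>i\<le>n. \<integral>\<^sup>+\<omega>. (\<Prod>j<p. ennreal (\<Lambda> i (x j) \<omega>)) \<partial>M) \<partial>PiM {..<p} (\<lambda>_. \<sigma>))"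
  proof (intro nn_integral_cong)
    fix x assume "x \<in> space (PiM {..<p} (\<lambda>_. \<sigma>))"
    have "(\<integral>\<^sup>+\<omega>. (\<Prod>j<p. ennreal (partial_product n (x j) \<omega>)) \<partial>M)
       = (\<integral>\<^sup>+\<omega>. (\<Prod>i\<le>n. \<Prod>j<p. ennreal (\<Lambda> i (x j) \<omega>)) \<partial>M)"
      unfolding partial_product_def
      by (subst prod.swap) (simp add: prod_ennreal[symmetric] \<Lambda>_nonneg)
    also have "\<dots> = (\<Prod>i\<le>n. \<integral>\<^sup>+\<omega>. (\<Prod>j<p. ennreal (\<Lambda> i (x j) \<omega>)) \<partial>M)"
    proof (rule indep_vars_nn_integral)
      have "indep_vars (\<lambda>_. PiM UNIV (\<lambda>_. borel)) (\<lambda>i \<omega> \<theta>. \<Lambda> i \<theta> \<omega>) {..n}"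
        by (rule indep_vars_subset[OF \<Lambda>_indep]) auto
      from indep_vars_compose2[OF this, of "\<lambda>i f. \<Prod>j<p. ennreal (f (x j))" "\<lambda>_. borel"]
      show "indep_vars (\<lambda>_. borel) (\<lambda>i \<omega>. \<Prod>j<p. ennreal (\<Lambda> i (x j) \<omega>)) {..n}" by simp
    qed auto
    finally show "(\<integral>\<^sup>+\<omega>. (\<Prod>j<p. ennreal (partial_product n (x j) \<omega>)) \<partial>M)
       = (\<Prod>i\<le>n. \<integral>\<^sup>+\<omega>. (\<Prod>j<p. ennreal (\<Lambda> i (x j) \<omega>)) \<partial>M)" .
  qed
  finally show ?thesis .
qed

text \<open>
  The martingale theorem is applied to the adapted version of the masses, and its conclusions
  are transferred back along almost sure equality.
\<close>

lemma mass_limit: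
  assumes p: "2 \<le> p" and bdd: "\<And>n. (\<integral>\<^sup>+\<omega>. mass n (space \<sigma>) \<omega> ^ p \<partial>M) \<le> ennreal K"
    and B[measurable]: "B \<in> sets \<sigma>"
  obtains L where "L \<in> borel_measurable M" "\<And>\<omega>. 0 \<le> L \<omega>" "AE \<omega> in M. (\<lambda>n. mass n B \<omega>) \<longlonglongrightarrow> ennreal (L \<omega>)"
    "\<And>n. integrable M (\<lambda>\<omega>. \<bar>enn2real (mass n B \<omega>)\<bar> ^ p)" "integrable M (\<lambda>\<omega>. \<bar>L \<omega>\<bar> ^ p)"
    "(\<lambda>n. \<integral>\<omega>. \<bar>enn2real (mass n B \<omega>) - L \<omega>\<bar> ^ p \<partial>M) \<longlonglongrightarrow> 0"
    "(\<integral>\<^sup>+\<omega>. ennreal (L \<omega>) \<partial>M) = emeasure \<sigma> B"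
proof -
  define Y where "Y n \<omega> = enn2real (nn_cond_exp M (past n) (mass n B) \<omega>)" for n \<omega>
  have [measurable]: "Y n \<in> borel_measurable (past n)" for n unfolding Y_def by measurable
  have YM[measurable]: "Y n \<in> borel_measurable M" for n unfolding Y_def by measurable
  have "AE \<omega> in M. \<forall>n. mass n B \<omega> = nn_cond_exp M (past n) (mass n B) \<omega>"
    unfolding AE_all_countable using mass_eq_cond_exp[OF B] by simp
  with AE_mass_finite[OF B] have YAE: "AE \<omega> in M. \<forall>n. mass n B \<omega> = ennreal (Y n \<omega>)"
    by eventually_elim (metis Y_def ennreal_enn2real infinity_ennreal_def)
  have Yn: "AE \<omega> in M. ennreal (Y n \<omega>) = mass n B \<omega>" for n using YAE by eventually_elim simp
  interpret Y: nonneg_martingale M past Y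
  proof
    fix m n and Z :: "'w \<Rightarrow> ennreal" assume mn: "n \<le> m" and Z: "Z \<in> borel_measurable (past n)"
    have "(\<integral>\<^sup>+\<omega>. Z \<omega> * ennreal (Y k \<omega>) \<partial>M) = (\<integral>\<^sup>+\<omega>. Z \<omega> * mass k B \<omega> \<partial>M)" for k
    proof (rule nn_integral_cong_AE)
      show "AE \<omega> in M. Z \<omega> * ennreal (Y k \<omega>) = Z \<omega> * mass k B \<omega>" using Yn[of k] by eventually_elim simp
    qed
    then show "(\<integral>\<^sup>+\<omega>. Z \<omega> * ennreal (Y m \<omega>) \<partial>M) = (\<integral>\<^sup>+\<omega>. Z \<omega> * ennreal (Y n \<omega>) \<partial>M)"
      using mass_martingale[OF mn B Z] by simp
  next
    have "(\<integral>\<^sup>+\<omega>. ennreal (Y 0 \<omega>) \<partial>M) = emeasure \<sigma> B"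
      unfolding mass_mean[OF B, of 0, symmetric] by (intro nn_integral_cong_AE Yn)
    then show "(\<integral>\<^sup>+\<omega>. ennreal (Y 0 \<omega>) \<partial>M) < \<infinity>" by (simp add: less_top[symmetric])
  qed (auto simp: subalgebra_past sets_past_mono[THEN subsetD] Y_def)
  have "(\<integral>\<^sup>+\<omega>. ennreal (Y n \<omega> ^ p) \<partial>M) \<le> ennreal K" for n
  proof -
    have "(\<integral>\<^sup>+\<omega>. ennreal (Y n \<omega> ^ p) \<partial>M) = (\<integral>\<^sup>+\<omega>. mass n B \<omega> ^ p \<partial>M)"
    proof (rule nn_integral_cong_AE)
      show "AE \<omega> in M. ennreal (Y n \<omega> ^ p) = mass n B \<omega> ^ p"
        using Yn[of n] by eventually_elim (simp add: ennreal_power[symmetric] Y.nonneg)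
    qed
    also have "\<dots> \<le> (\<integral>\<^sup>+\<omega>. mass n (space \<sigma>) \<omega> ^ p \<partial>M)"
      unfolding mass_def using sets.sets_into_space[OF B]
      by (intro nn_integral_mono power_mono mult_left_mono) (auto split: split_indicator)
    finally show ?thesis using bdd[of n] by (rule order_trans)
  qed
  from Y.Lp_convergence[OF p this] obtain L where L: "L \<in> borel_measurable M" "\<And>\<omega>. 0 \<le> L \<omega>"
    "AE \<omega> in M. (\<lambda>n. Y n \<omega>) \<longlonglongrightarrow> L \<omega>"
    "\<And>n. integrable M (\<lambda>\<omega>. \<bar>Y n \<omega>\<bar> ^ p)" "integrable M (\<lambda>\<omega>. \<bar>L \<omega>\<bar> ^ p)"
    "(\<lambda>n. \<integral>\<omega>. \<bar>Y n \<omega> - L \<omega>\<bar> ^ p \<partial>M) \<longlonglongrightarrow> 0"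
    "(\<integral>\<^sup>+\<omega>. ennreal (L \<omega>) \<partial>M) = (\<integral>\<^sup>+\<omega>. ennreal (Y 0 \<omega>) \<partial>M)"
    by blast
  note [measurable] = L(1)
  have Yr: "AE \<omega> in M. enn2real (mass n B \<omega>) = Y n \<omega>" for n
    using Yn[of n] by eventually_elim (metis Y.nonneg enn2real_ennreal)
  show thesis
  proof (rule that[OF L(1,2) _ _ L(5)])
    show "AE \<omega> in M. (\<lambda>n. mass n B \<omega>) \<longlonglongrightarrow> ennreal (L \<omega>)"
      using YAE L(3) by eventually_elim (simp add: tendsto_ennrealI)
    show "integrable M (\<lambda>\<omega>. \<bar>enn2real (mass n B \<omega>)\<bar> ^ p)" for n
    proof (rule integrable_cong_AE_imp[OF L(4)[of n]])
      show "AE \<omega> in M. \<bar>Y n \<omega>\<bar> ^ p = \<bar>enn2real (mass n B \<omega>)\<bar> ^ p" using Yr[of n] by eventually_elim simp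
    qed measurable
    have "(\<integral>\<omega>. \<bar>enn2real (mass n B \<omega>) - L \<omega>\<bar> ^ p \<partial>M) = (\<integral>\<omega>. \<bar>Y n \<omega> - L \<omega>\<bar> ^ p \<partial>M)" for n
    proof (rule integral_cong_AE)
      show "AE \<omega> in M. \<bar>enn2real (mass n B \<omega>) - L \<omega>\<bar> ^ p = \<bar>Y n \<omega> - L \<omega>\<bar> ^ p"
        using Yr[of n] by eventually_elim simp
    qed measurable
    then show "(\<lambda>n. \<integral>\<omega>. \<bar>enn2real (mass n B \<omega>) - L \<omega>\<bar> ^ p \<partial>M) \<longlonglongrightarrow> 0" using L(6) by simp
    show "(\<integral>\<^sup>+\<omega>. ennreal (L \<omega>) \<partial>M) = emeasure \<sigma> B"
      unfolding L(7) mass_mean[OF B, of 0, symmetric] by (intro nn_integral_cong_AE Yn)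
  qed
qed

lemma mass_Un:
  assumes [measurable]: "A \<in> sets \<sigma>" "B \<in> sets \<sigma>" and "A \<inter> B = {}" "\<omega> \<in> space M"
  shows "mass n (A \<union> B) \<omega> = mass n A \<omega> + mass n B \<omega>"
proof -
  have "(\<lambda>\<theta>. partial_product n \<theta> \<omega>) \<in> borel_measurable \<sigma>" using assms(4) by simp
  then show ?thesis
    unfolding mass_def using assms(3)
    by (subst nn_integral_add[symmetric])
      (auto intro!: nn_integral_cong split: split_indicator)
qed

text \<open>
  Limits of additive set functions are additive and keep their means, so the limits taken set by
  set form a random additive family with mean measure \<open>\<sigma>\<close>.
\<close>

theorem limit_measure:
  assumes p: "2 \<le> p" and bdd: "\<And>n. (\<integral>\<^sup>+\<omega>. mass n (space \<sigma>) \<omega> ^ p \<partial>M) \<le> ennreal K"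
    and coding: "\<phi> \<in> borel_measurable \<sigma>" "\<psi> \<in> borel \<rightarrow>\<^sub>M \<sigma>"
      "\<And>x. x \<in> space \<sigma> \<Longrightarrow> \<phi> x \<in> {0..1::real}" "\<And>x. x \<in> space \<sigma> \<Longrightarrow> \<psi> (\<phi> x) = x"
  obtains \<mu> where "\<And>\<omega>. sets (\<mu> \<omega>) = sets \<sigma>" "\<And>\<omega>. finite_measure (\<mu> \<omega>)"
    "\<And>B. B \<in> sets \<sigma> \<Longrightarrow> (\<lambda>\<omega>. emeasure (\<mu> \<omega>) B) \<in> borel_measurable M"
    "\<And>B. B \<in> sets \<sigma> \<Longrightarrow> AE \<omega> in M. (\<lambda>n. mass n B \<omega>) \<longlonglongrightarrow> emeasure (\<mu> \<omega>) B"
    "\<And>B n. B \<in> sets \<sigma> \<Longrightarrow> integrable M (\<lambda>\<omega>. \<bar>enn2real (mass n B \<omega>)\<bar> ^ p)"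
    "\<And>B. B \<in> sets \<sigma> \<Longrightarrow> integrable M (\<lambda>\<omega>. \<bar>measure (\<mu> \<omega>) B\<bar> ^ p)"
    "\<And>B. B \<in> sets \<sigma> \<Longrightarrow> (\<lambda>n. \<integral>\<omega>. \<bar>enn2real (mass n B \<omega>) - measure (\<mu> \<omega>) B\<bar> ^ p \<partial>M) \<longlonglongrightarrow> 0"
    "\<And>B. B \<in> sets \<sigma> \<Longrightarrow> (\<integral>\<^sup>+\<omega>. emeasure (\<mu> \<omega>) B \<partial>M) = emeasure \<sigma> B"
proof -
  let ?Q = "\<lambda>B L. L \<in> borel_measurable M \<and> (AE \<omega> in M. (\<lambda>n. mass n B \<omega>) \<longlonglongrightarrow> ennreal (L \<omega>)) \<and>
    (\<forall>n. integrable M (\<lambda>\<omega>. \<bar>enn2real (mass n B \<omega>)\<bar> ^ p)) \<and> integrable M (\<lambda>\<omega>. \<bar>L \<omega>\<bar> ^ p) \<and>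
    (\<lambda>n. \<integral>\<omega>. \<bar>enn2real (mass n B \<omega>) - L \<omega>\<bar> ^ p \<partial>M) \<longlonglongrightarrow> 0 \<and>
    (\<integral>\<^sup>+\<omega>. ennreal (L \<omega>) \<partial>M) = emeasure \<sigma> B"
  have "\<exists>L. (\<forall>\<omega>. 0 \<le> L \<omega>) \<and> (B \<in> sets \<sigma> \<longrightarrow> ?Q B L)" for B
  proof (cases "B \<in> sets \<sigma>")
    case True
    from mass_limit[OF p bdd True] obtain L where "L \<in> borel_measurable M" "\<And>\<omega>. 0 \<le> L \<omega>"
      "AE \<omega> in M. (\<lambda>n. mass n B \<omega>) \<longlonglongrightarrow> ennreal (L \<omega>)"
      "\<And>n. integrable M (\<lambda>\<omega>. \<bar>enn2real (mass n B \<omega>)\<bar> ^ p)" "integrable M (\<lambda>\<omega>. \<bar>L \<omega>\<bar> ^ p)"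
      "(\<lambda>n. \<integral>\<omega>. \<bar>enn2real (mass n B \<omega>) - L \<omega>\<bar> ^ p \<partial>M) \<longlonglongrightarrow> 0"
      "(\<integral>\<^sup>+\<omega>. ennreal (L \<omega>) \<partial>M) = emeasure \<sigma> B" by blast
    then show ?thesis by blast
  qed (auto intro: exI[of _ "\<lambda>_. 0"])
  from choice[OF allI[OF this]] obtain L where "\<forall>B. (\<forall>\<omega>. 0 \<le> L B \<omega>) \<and> (B \<in> sets \<sigma> \<longrightarrow> ?Q B (L B))" ..
  then have L0: "\<And>B \<omega>. 0 \<le> L B \<omega>" and L: "\<And>B. B \<in> sets \<sigma> \<Longrightarrow> ?Q B (L B)" by auto
  have "random_additive_family \<sigma> M L"
  proof
    fix A B assume [measurable]: "A \<in> sets \<sigma>" "B \<in> sets \<sigma>" and AB: "A \<inter> B = {}"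
    have "AE \<omega> in M. (\<lambda>n. mass n A \<omega>) \<longlonglongrightarrow> ennreal (L A \<omega>)"
      "AE \<omega> in M. (\<lambda>n. mass n B \<omega>) \<longlonglongrightarrow> ennreal (L B \<omega>)"
      "AE \<omega> in M. (\<lambda>n. mass n (A \<union> B) \<omega>) \<longlonglongrightarrow> ennreal (L (A \<union> B) \<omega>)"
      using L[of A] L[of B] L[of "A \<union> B"] by auto
    with AE_space show "AE \<omega> in M. L (A \<union> B) \<omega> = L A \<omega> + L B \<omega>"
    proof eventually_elim
      case (elim \<omega>)
      have "(\<lambda>n. mass n (A \<union> B) \<omega>) \<longlonglongrightarrow> ennreal (L A \<omega>) + ennreal (L B \<omega>)"
        using tendsto_add[OF elim(2,3)] elim(1) AB by (simp add: mass_Un)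
      from LIMSEQ_unique[OF elim(4) this] show ?case
        using L0 by (simp add: ennreal_plus[symmetric] del: ennreal_plus)
    qed
  qed (use L L0 in auto)
  from random_measure_version[OF this coding] obtain \<mu> where \<mu>: "\<And>\<omega>. sets (\<mu> \<omega>) = sets \<sigma>" "\<And>\<omega>. finite_measure (\<mu> \<omega>)"
    "\<And>B. B \<in> sets \<sigma> \<Longrightarrow> (\<lambda>\<omega>. emeasure (\<mu> \<omega>) B) \<in> borel_measurable M"
    "\<And>B. B \<in> sets \<sigma> \<Longrightarrow> AE \<omega> in M. emeasure (\<mu> \<omega>) B = ennreal (L B \<omega>)" by blast
  show thesis
  proof (rule that[OF \<mu>(1-3)])
    fix B assume B[measurable]: "B \<in> sets \<sigma>"
    note [measurable] = \<mu>(3)[OF B]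
    have mm[measurable]: "(\<lambda>\<omega>. measure (\<mu> \<omega>) B) \<in> borel_measurable M" unfolding measure_def by measurable
    have [measurable]: "L B \<in> borel_measurable M" using L[OF B] by blast
    have ae: "AE \<omega> in M. measure (\<mu> \<omega>) B = L B \<omega>"
      using \<mu>(4)[OF B] by eventually_elim (simp add: measure_def L0)
    show "AE \<omega> in M. (\<lambda>n. mass n B \<omega>) \<longlonglongrightarrow> emeasure (\<mu> \<omega>) B"
    proof -
      have "AE \<omega> in M. (\<lambda>n. mass n B \<omega>) \<longlonglongrightarrow> ennreal (L B \<omega>)" using L[OF B] by blast
      with \<mu>(4)[OF B] show ?thesis by eventually_elim simp
    qed
    show "integrable M (\<lambda>\<omega>. \<bar>enn2real (mass n B \<omega>)\<bar> ^ p)" for n using L[OF B] by blast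
    show "integrable M (\<lambda>\<omega>. \<bar>measure (\<mu> \<omega>) B\<bar> ^ p)"
    proof (rule integrable_cong_AE_imp)
      show "integrable M (\<lambda>\<omega>. \<bar>L B \<omega>\<bar> ^ p)" using L[OF B] by blast
      show "AE \<omega> in M. \<bar>L B \<omega>\<bar> ^ p = \<bar>measure (\<mu> \<omega>) B\<bar> ^ p" using ae by eventually_elim simp
    qed measurable
    have "(\<integral>\<omega>. \<bar>enn2real (mass n B \<omega>) - measure (\<mu> \<omega>) B\<bar> ^ p \<partial>M) = (\<integral>\<omega>. \<bar>enn2real (mass n B \<omega>) - L B \<omega>\<bar> ^ p \<partial>M)" for n
    proof (rule integral_cong_AE)
      show "AE \<omega> in M. \<bar>enn2real (mass n B \<omega>) - measure (\<mu> \<omega>) B\<bar> ^ p = \<bar>enn2real (mass n B \<omega>) - L B \<omega>\<bar> ^ p"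
        using ae by eventually_elim simp
    qed measurable
    then show "(\<lambda>n. \<integral>\<omega>. \<bar>enn2real (mass n B \<omega>) - measure (\<mu> \<omega>) B\<bar> ^ p \<partial>M) \<longlonglongrightarrow> 0"
      using L[OF B] by simp
    show "(\<integral>\<^sup>+\<omega>. emeasure (\<mu> \<omega>) B \<partial>M) = emeasure \<sigma> B"
      using nn_integral_cong_AE[OF \<mu>(4)[OF B]] L[OF B] by simp
  qed
qed

end

section \<open>Exponential moments of Gaussian fields\<close>

text \<open>
  Completing the square: \<open>exp x\<close> times the centred density is \<open>exp (s\<^sup>2 / 2)\<close> times the density
  with mean \<open>s\<^sup>2\<close>.
\<close>

lemma nn_integral_exp_gaussian_law:
  assumes s: "0 \<le> s"
  shows "(\<integral>\<^sup>+x. ennreal (exp x) \<partial>gaussian_law 0 s) = ennreal (exp (s\<^sup>2 / 2))"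
proof (cases "s = 0")
  case True
  then show ?thesis by (simp add: gaussian_law_def nn_integral_return)
next
  case False
  with s have s: "0 < s" by simp
  have shift: "normal_density 0 s x * exp x = exp (s\<^sup>2 / 2) * normal_density (s\<^sup>2) s x" for x
  proof -
    have "- (x\<^sup>2) / (2 * s\<^sup>2) + x = s\<^sup>2 / 2 + - ((x - s\<^sup>2)\<^sup>2) / (2 * s\<^sup>2)"
      using s by (simp add: field_simps power2_eq_square)
    then have "exp (- (x\<^sup>2) / (2 * s\<^sup>2)) * exp x = exp (s\<^sup>2 / 2) * exp (- ((x - s\<^sup>2)\<^sup>2) / (2 * s\<^sup>2))"
      by (metis exp_add)
    then show ?thesis by (simp add: normal_density_def)
  qed
  have "(\<integral>\<^sup>+x. ennreal (exp x) \<partial>gaussian_law 0 s) = (\<integral>\<^sup>+x. ennreal (normal_density 0 s x) * ennreal (exp x) \<partial>lborel)"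
    using False by (simp add: gaussian_law_def nn_integral_density)
  also have "\<dots> = (\<integral>\<^sup>+x. ennreal (exp (s\<^sup>2 / 2)) * ennreal (normal_density (s\<^sup>2) s x) \<partial>lborel)"
    by (simp add: ennreal_mult[symmetric] shift)
  also have "\<dots> = ennreal (exp (s\<^sup>2 / 2)) * (\<integral>\<^sup>+x. ennreal (normal_density (s\<^sup>2) s x) \<partial>lborel)"
    by (rule nn_integral_cmult) simp
  also have "(\<integral>\<^sup>+x. ennreal (normal_density (s\<^sup>2) s x) \<partial>lborel) = 1"
    using prob_space.emeasure_space_1[OF prob_space_normal_density[OF s, of "s\<^sup>2"]]
    by (simp add: emeasure_density)
  finally show ?thesis by simp
qed

lemma (in prob_space) gaussian_law_parameters:
  assumes S[measurable]: "S \<in> borel_measurable M" and law: "distr M borel S = gaussian_law m s" and s: "0 \<le> s"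
  shows "expectation S = m" "variance S = s\<^sup>2"
proof -
  have "expectation S = m \<and> variance S = s\<^sup>2"
  proof (cases "s = 0")
    case True
    have dirac: "gaussian_law m s = return borel m" using True by (simp add: gaussian_law_def)
    have "AE x in distr M borel S. x = m"
      unfolding law dirac by (subst AE_return) auto
    then have ae: "AE \<omega> in M. S \<omega> = m" by (simp add: AE_distr_iff)
    have "expectation S = expectation (\<lambda>_. m)" using ae by (intro integral_cong_AE) auto
    then have m: "expectation S = m" by (simp add: prob_space)
    have "variance S = expectation (\<lambda>_. 0)"
      unfolding m by (rule integral_cong_AE) (use ae in auto)
    with m show ?thesis using True by simp
  next
    case False
    with s have s: "0 < s" by simp
    have "distr M lborel S = distr M borel S" by (intro distr_cong) auto
    then have "distributed M lborel S (normal_density m s)"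
      unfolding distributed_def using law False by (auto simp: gaussian_law_def)
    from normal_distributed_expectation[OF s this] normal_distributed_variance[OF s this]
    show ?thesis by simp
  qed
  then show "expectation S = m" "variance S = s\<^sup>2" by auto
qed

text \<open>
  The sum is a centred Gaussian variable whose variance is the double sum of the covariances.
\<close>

lemma (in prob_space) nn_integral_exp_gaussian_field_sum:
  fixes Y :: "'u::euclidean_space \<Rightarrow> 'a \<Rightarrow> real" and u :: "nat \<Rightarrow> 'u"
  assumes gauss: "gaussian_field M Y" and [measurable]: "\<And>v. Y v \<in> borel_measurable M"
    and sq: "\<And>v. integrable M (\<lambda>\<omega>. (Y v \<omega>)\<^sup>2)"
    and mean: "\<And>v. expectation (Y v) = 0"
    and cov: "\<And>v w. expectation (\<lambda>\<omega>. Y v \<omega> * Y w \<omega>) = c v w"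
  shows "(\<integral>\<^sup>+\<omega>. ennreal (exp (\<Sum>j<p. Y (u j) \<omega>)) \<partial>M) = ennreal (exp ((\<Sum>j<p. \<Sum>k<p. c (u j) (u k)) / 2))"
proof -
  define S where "S \<omega> = (\<Sum>j<p. Y (u j) \<omega>)" for \<omega>
  have Sm[measurable]: "S \<in> borel_measurable M" unfolding S_def by measurable
  have prod_int: "integrable M (\<lambda>\<omega>. Y v \<omega> * Y w \<omega>)" for v w
  proof (rule Bochner_Integration.integrable_bound)
    show "integrable M (\<lambda>\<omega>. (Y v \<omega>)\<^sup>2 + (Y w \<omega>)\<^sup>2)" using sq by simp
    have "\<bar>x * y\<bar> \<le> x\<^sup>2 + y\<^sup>2" for x y :: real
    proof -
      have "0 \<le> \<bar>x\<bar> * \<bar>y\<bar>" by simp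
      moreover have "2 * (\<bar>x\<bar> * \<bar>y\<bar>) \<le> x\<^sup>2 + y\<^sup>2"
        using sum_squares_bound[of "\<bar>x\<bar>" "\<bar>y\<bar>"] by (simp add: mult.assoc)
      ultimately show ?thesis unfolding abs_mult by linarith
    qed
    then show "AE \<omega> in M. norm (Y v \<omega> * Y w \<omega>) \<le> norm ((Y v \<omega>)\<^sup>2 + (Y w \<omega>)\<^sup>2)" by simp
  qed measurable
  have int: "integrable M (Y v)" for v by (rule square_integrable_imp_integrable[OF _ sq]) measurable
  \<comment> \<open>The points \<open>u j\<close> may coincide, so the sum is rewritten over the set of distinct points, with
    multiplicities as coefficients.\<close>
  have S_eq: "S = (\<lambda>\<omega>. \<Sum>v\<in>u ` {..<p}. real (card {j \<in> {..<p}. u j = v}) * Y v \<omega>)"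
    unfolding S_def by (intro ext sum_fun_comp) auto
  have "\<exists>m s. 0 \<le> s \<and> distr M borel S = gaussian_law m s"
    unfolding S_eq using gauss unfolding gaussian_field_def by auto
  then obtain m s where s: "0 \<le> s" and law: "distr M borel S = gaussian_law m s" by blast
  have "expectation S = 0" unfolding S_def using int mean by (simp add: Bochner_Integration.integral_sum)
  then have m: "m = 0" and var: "variance S = s\<^sup>2" using gaussian_law_parameters[OF Sm law s] by auto
  have "s\<^sup>2 = expectation (\<lambda>\<omega>. (S \<omega>)\<^sup>2)" using var \<open>expectation S = 0\<close> by simp
  also have "\<dots> = expectation (\<lambda>\<omega>. \<Sum>j<p. \<Sum>k<p. Y (u j) \<omega> * Y (u k) \<omega>)"
    by (simp add: S_def power2_eq_square sum_product)
  also have "\<dots> = (\<Sum>j<p. \<Sum>k<p. c (u j) (u k))"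
    using prod_int by (simp add: Bochner_Integration.integral_sum cov)
  finally have s2: "s\<^sup>2 = (\<Sum>j<p. \<Sum>k<p. c (u j) (u k))" .
  have "(\<integral>\<^sup>+\<omega>. ennreal (exp (S \<omega>)) \<partial>M) = (\<integral>\<^sup>+x. ennreal (exp x) \<partial>distr M borel S)"
    by (simp add: nn_integral_distr)
  also have "\<dots> = ennreal (exp (s\<^sup>2 / 2))" unfolding law m by (rule nn_integral_exp_gaussian_law[OF s])
  finally show ?thesis unfolding S_def s2 .
qed

section \<open>Pairwise bounds on product spaces\<close>

text \<open>
  The sum is at most its number of terms times the largest term.
\<close>

lemma exp_sum_le_sum_exp:
  fixes a :: "'i \<Rightarrow> real"
  assumes D: "finite D" "D \<noteq> {}"
  shows "exp (\<Sum>d\<in>D. a d) \<le> (\<Sum>d\<in>D. exp (real (card D) * a d))"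
proof -
  obtain d0 where d0: "d0 \<in> D" "\<And>d. d \<in> D \<Longrightarrow> a d \<le> a d0"
  proof -
    have "Max (a ` D) \<in> a ` D" using D by (intro Max_in) auto
    then obtain d0 where "d0 \<in> D" "Max (a ` D) = a d0" by auto
    then show thesis using that[of d0] Max_ge[of "a ` D"] D by auto
  qed
  have "(\<Sum>d\<in>D. a d) \<le> real (card D) * a d0" using d0(2) by (intro sum_bounded_above) auto
  then have "exp (\<Sum>d\<in>D. a d) \<le> exp (real (card D) * a d0)" by simp
  also have "\<dots> \<le> (\<Sum>d\<in>D. exp (real (card D) * a d))"
    using D d0(1) by (intro member_le_sum) auto
  finally show ?thesis .
qed

text \<open>
  Integrate over the coordinate \<open>k\<close> first; the remaining coordinates contribute only total
  masses.
\<close>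

lemma (in finite_measure) nn_integral_PiM_pair_le:
  fixes g :: "'a \<Rightarrow> 'a \<Rightarrow> ennreal"
  assumes I: "finite I" "j \<in> I" "k \<in> I" "j \<noteq> k"
    and g[measurable]: "case_prod g \<in> borel_measurable (M \<Otimes>\<^sub>M M)"
    and K: "\<And>\<theta>. \<theta> \<in> space M \<Longrightarrow> (\<integral>\<^sup>+\<eta>. g \<theta> \<eta> \<partial>M) \<le> K"
  shows "(\<integral>\<^sup>+x. g (x j) (x k) \<partial>PiM I (\<lambda>_. M)) \<le> K * emeasure M (space M) ^ (card I - 1)"
proof -
  interpret PS: product_sigma_finite "\<lambda>_. M" ..
  let ?J = "I - {k}"
  have J: "finite ?J" "k \<notin> ?J" "insert k ?J = I" "j \<in> ?J" using I by auto
  have [measurable]: "(\<lambda>x. x j) \<in> PiM I (\<lambda>_. M) \<rightarrow>\<^sub>M M" "(\<lambda>x. x k) \<in> PiM I (\<lambda>_. M) \<rightarrow>\<^sub>M M"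
    using I by (auto intro!: measurable_component_singleton)
  have gm: "(\<lambda>x. g (x j) (x k)) \<in> borel_measurable (PiM (insert k ?J) (\<lambda>_. M))"
    unfolding J(3) by measurable
  have "(\<integral>\<^sup>+x. g (x j) (x k) \<partial>PiM I (\<lambda>_. M)) = (\<integral>\<^sup>+x. (\<integral>\<^sup>+y. g ((x(k := y)) j) ((x(k := y)) k) \<partial>M) \<partial>PiM ?J (\<lambda>_. M))"
    using PS.product_nn_integral_insert[OF J(1,2) gm] unfolding J(3) .
  also have "\<dots> \<le> (\<integral>\<^sup>+x. K \<partial>PiM ?J (\<lambda>_. M))"
  proof (rule nn_integral_mono)
    fix x assume "x \<in> space (PiM ?J (\<lambda>_. M))"
    then have "x j \<in> space M" using J(4) by (auto simp: space_PiM)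
    then show "(\<integral>\<^sup>+y. g ((x(k := y)) j) ((x(k := y)) k) \<partial>M) \<le> K" using I(4) K by simp
  qed
  also have "\<dots> = K * emeasure M (space M) ^ card ?J"
    using PS.emeasure_PiM[OF J(1), of "\<lambda>_. space M"] by (simp add: space_PiM)
  also have "card ?J = card I - 1" using I by simp
  finally show ?thesis .
qed

text \<open>
  Ordered pairs are used, so every unordered pair counts twice and comes with a factor \<open>1/2\<close>.
\<close>

definition distinct_pairs :: "nat \<Rightarrow> (nat \<times> nat) set" where
  "distinct_pairs p = {(j, k). j < p \<and> k < p \<and> j \<noteq> k}"

lemma distinct_pairs_Sigma: "distinct_pairs p = (SIGMA j:{..<p}. {..<p} - {j})"
  by (auto simp: distinct_pairs_def)

lemma finite_distinct_pairs[simp]: "finite (distinct_pairs p)"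
  unfolding distinct_pairs_Sigma by auto

lemma card_distinct_pairs: "card (distinct_pairs p) = p * (p - 1)"
  unfolding distinct_pairs_Sigma by (subst card_SigmaI) auto

section \<open>Moments of the Gaussian cascade\<close>

locale gaussian_cascade = prob_space M for M :: "'w measure" +
  fixes X :: "nat \<Rightarrow> 'a::euclidean_space \<Rightarrow> 'w \<Rightarrow> real" and r :: "real \<Rightarrow> real" and s b :: real
  assumes indep: "indep_vars (\<lambda>_. PiM UNIV (\<lambda>_. borel)) (\<lambda>i \<omega> u. X i u \<omega>) UNIV"
    and gaussian: "\<And>i. gaussian_field M (X i)"
    and square_int: "\<And>i u. integrable M (\<lambda>\<omega>. (X i u \<omega>)\<^sup>2)"
    and centred: "\<And>i u. expectation (X i u) = 0"
    and cov: "\<And>i u v. expectation (\<lambda>\<omega>. X i u \<omega> * X i v \<omega>) = r (norm (u - v))"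
    and r0: "r 0 = s\<^sup>2"
    and b: "1 < b"
    and antimono: "antimono_on {0..} r"
    and summable: "summable (\<lambda>i. r (b ^ i))"
begin

definition factor :: "nat \<Rightarrow> 'a \<Rightarrow> 'w \<Rightarrow> real" where
  "factor i \<theta> \<omega> = exp (X i (b ^ i *\<^sub>R \<theta>) \<omega> - s\<^sup>2 / 2)"

lemma field_measurable: "(\<lambda>\<omega> u. X i u \<omega>) \<in> M \<rightarrow>\<^sub>M PiM UNIV (\<lambda>_. borel)"
  using indep unfolding indep_vars_def by auto

lemma X_measurable[measurable]: "X i u \<in> borel_measurable M"
  using measurable_compose[OF field_measurable measurable_component_singleton[of u]] by simp

lemma nn_integral_exp_X: "(\<integral>\<^sup>+\<omega>. ennreal (exp (X i u \<omega>)) \<partial>M) = ennreal (exp (s\<^sup>2 / 2))"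
  using nn_integral_exp_gaussian_field_sum[where Y = "X i" and u = "\<lambda>_. u" and p = 1,
      OF gaussian X_measurable square_int centred cov] r0
  by simp

lemma exp_field_eq_factor: "exp_field M X b = factor"
proof (intro ext)
  fix i \<theta> \<omega>
  have "(\<integral>\<omega>'. exp (X i (b ^ i *\<^sub>R \<theta>) \<omega>') \<partial>M) = exp (s\<^sup>2 / 2)"
    by (subst integral_eq_nn_integral) (auto simp: nn_integral_exp_X)
  then show "exp_field M X b i \<theta> \<omega> = factor i \<theta> \<omega>" by (simp add: exp_field_def factor_def exp_diff)
qed

lemma id_sphere_measurable[measurable]: "(\<lambda>\<theta>. \<theta>) \<in> (sphere_measure :: 'a measure) \<rightarrow>\<^sub>M borel"
proof -
  have "(\<lambda>\<theta>::'a. \<theta>) \<in> restrict_space borel (sphere 0 1) \<rightarrow>\<^sub>M borel" by (rule measurable_restrict_space1) simp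
  then show ?thesis by (simp cong: measurable_cong_sets)
qed

lemma r_antimono: "0 \<le> x \<Longrightarrow> x \<le> y \<Longrightarrow> r y \<le> r x"
  using antimono by (auto simp: monotone_on_def)

text \<open>
  The values \<open>r (b ^ i)\<close> tend to \<open>0\<close> and eventually lie below \<open>r x\<close>.
\<close>

lemma r_nonneg:
  assumes "0 \<le> x"
  shows "0 \<le> r x"
proof (rule tendsto_upperbound[OF summable_LIMSEQ_zero[OF summable]])
  obtain N where N: "x < b ^ N" using real_arch_pow[OF b] by blast
  show "\<forall>\<^sub>F i in sequentially. r (b ^ i) \<le> r x"
  proof (rule eventually_sequentiallyI[of N])
    fix i assume "N \<le> i"
    then have "b ^ N \<le> b ^ i" using b by (intro power_increasing) auto
    then show "r (b ^ i) \<le> r x" using N assms by (intro r_antimono) auto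
  qed
qed simp

sublocale cascade: multiplicative_cascade M sphere_measure factor
proof (intro multiplicative_cascade.intro multiplicative_cascade_axioms.intro)
  show "prob_space M" by (rule prob_space_axioms)
  show "finite_measure (sphere_measure :: 'a measure)" by (rule finite_sphere_measure)
  show "0 \<le> factor i \<theta> \<omega>" for i \<theta> \<omega> by (simp add: factor_def)
  show "(\<lambda>(\<theta>, \<omega>). factor i \<theta> \<omega>) \<in> borel_measurable (sphere_measure \<Otimes>\<^sub>M M)" for i
  proof -
    have 1: "(\<lambda>(u, \<omega>). X i u \<omega>) \<in> borel_measurable (borel \<Otimes>\<^sub>M M)"
      using gaussian[of i] by (simp add: gaussian_field_def random_field_def)
    have 2: "(\<lambda>x. (b ^ i *\<^sub>R fst x, snd x)) \<in> sphere_measure \<Otimes>\<^sub>M M \<rightarrow>\<^sub>M (borel :: 'a measure) \<Otimes>\<^sub>M M" by measurable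
    have [measurable]: "(\<lambda>x. X i (b ^ i *\<^sub>R fst x) (snd x)) \<in> borel_measurable (sphere_measure \<Otimes>\<^sub>M M)"
      using measurable_compose[OF 2 1] by simp
    show ?thesis unfolding factor_def split_beta by measurable
  qed
  have m: "(\<lambda>f \<theta>. exp (f (b ^ i *\<^sub>R \<theta>) - s\<^sup>2 / 2)) \<in> PiM UNIV (\<lambda>_. borel) \<rightarrow>\<^sub>M PiM (UNIV :: 'a set) (\<lambda>_. borel)" for i :: nat
  proof (rule measurable_abs_UNIV)
    fix \<theta> :: 'a
    have [measurable]: "(\<lambda>f. f (b ^ i *\<^sub>R \<theta>)) \<in> PiM UNIV (\<lambda>_. borel :: real measure) \<rightarrow>\<^sub>M borel"
      by (rule measurable_component_singleton) simp
    show "(\<lambda>f. exp (f (b ^ i *\<^sub>R \<theta>) - s\<^sup>2 / 2)) \<in> PiM UNIV (\<lambda>_. borel) \<rightarrow>\<^sub>M borel" by measurable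
  qed
  show "indep_vars (\<lambda>_. PiM UNIV (\<lambda>_. borel)) (\<lambda>i \<omega> \<theta>. factor i \<theta> \<omega>) UNIV"
    unfolding factor_def by (rule indep_vars_compose2[OF indep m])
  show "(\<integral>\<^sup>+\<omega>. ennreal (factor i \<theta> \<omega>) \<partial>M) = 1" for i \<theta>
  proof -
    have scale: "ennreal (factor i \<theta> \<omega>) = ennreal (exp (- s\<^sup>2 / 2)) * ennreal (exp (X i (b ^ i *\<^sub>R \<theta>) \<omega>))" for \<omega>
      by (simp add: factor_def ennreal_mult[symmetric] exp_add[symmetric])
    have "(\<integral>\<^sup>+\<omega>. ennreal (factor i \<theta> \<omega>) \<partial>M)
        = ennreal (exp (- s\<^sup>2 / 2)) * (\<integral>\<^sup>+\<omega>. ennreal (exp (X i (b ^ i *\<^sub>R \<theta>) \<omega>)) \<partial>M)"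
      unfolding scale by (rule nn_integral_cmult) measurable
    then show ?thesis
      by (simp add: nn_integral_exp_X ennreal_mult[symmetric] exp_add[symmetric])
  qed
qed

definition log_corr :: "nat \<Rightarrow> real \<Rightarrow> real" where
  "log_corr n t = (\<Sum>i\<le>n. r (b ^ i * t))"

text \<open>
  In the variance of \<open>\<Sum>\<^sub>j X(u\<^sub>j)\<close> the diagonal terms give \<open>p s\<^sup>2\<close>, which cancels against the
  normalisation of the \<open>p\<close> factors and leaves the pairs of distinct indices.
\<close>

lemma factor_moment:
  "(\<Prod>i\<le>n. \<integral>\<^sup>+\<omega>. (\<Prod>j<p. ennreal (factor i (x j) \<omega>)) \<partial>M)
     = ennreal (exp (\<Sum>(j, k)\<in>distinct_pairs p. log_corr n (dist (x j) (x k)) / 2))"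
proof -
  have one: "(\<integral>\<^sup>+\<omega>. (\<Prod>j<p. ennreal (factor i (x j) \<omega>)) \<partial>M)
     = ennreal (exp (\<Sum>(j, k)\<in>distinct_pairs p. r (b ^ i * dist (x j) (x k)) / 2))" for i
  proof -
    let ?u = "\<lambda>j. b ^ i *\<^sub>R x j"
    have nrm: "norm (?u j - ?u k) = b ^ i * dist (x j) (x k)" for j k
      using b by (simp add: scaleR_diff_right[symmetric] dist_norm)
    have "(\<Prod>j<p. ennreal (factor i (x j) \<omega>)) = ennreal (exp (- (real p * (s\<^sup>2 / 2)))) * ennreal (exp (\<Sum>j<p. X i (?u j) \<omega>))" for \<omega>
      by (simp add: factor_def prod_ennreal exp_sum[symmetric] ennreal_mult[symmetric] exp_add[symmetric] sum_subtractf)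
    then have "(\<integral>\<^sup>+\<omega>. (\<Prod>j<p. ennreal (factor i (x j) \<omega>)) \<partial>M)
      = ennreal (exp (- (real p * (s\<^sup>2 / 2)))) * (\<integral>\<^sup>+\<omega>. ennreal (exp (\<Sum>j<p. X i (?u j) \<omega>)) \<partial>M)"
      by (simp add: nn_integral_cmult)
    also have "\<dots> = ennreal (exp (- (real p * (s\<^sup>2 / 2)))) *
        ennreal (exp ((\<Sum>j<p. \<Sum>k<p. r (b ^ i * dist (x j) (x k))) / 2))"
      by (subst nn_integral_exp_gaussian_field_sum[OF gaussian X_measurable square_int centred cov]) (simp add: nrm)
    also have "(\<Sum>j<p. \<Sum>k<p. r (b ^ i * dist (x j) (x k)))
        = (\<Sum>j<p. s\<^sup>2 + (\<Sum>k\<in>{..<p} - {j}. r (b ^ i * dist (x j) (x k))))"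
    proof (intro sum.cong refl)
      fix j assume "j \<in> {..<p}"
      then show "(\<Sum>k<p. r (b ^ i * dist (x j) (x k))) = s\<^sup>2 + (\<Sum>k\<in>{..<p} - {j}. r (b ^ i * dist (x j) (x k)))"
        by (subst sum.remove[of _ j]) (auto simp: r0)
    qed
    also have "\<dots> = real p * s\<^sup>2 + (\<Sum>(j, k)\<in>distinct_pairs p. r (b ^ i * dist (x j) (x k)))"
      unfolding distinct_pairs_Sigma by (subst sum.Sigma[symmetric]) (auto simp: sum.distrib)
    finally show ?thesis
      by (simp add: ennreal_mult[symmetric] exp_add[symmetric] add_divide_distrib sum_divide_distrib split_beta)
  qed
  have "(\<Prod>i\<le>n. \<integral>\<^sup>+\<omega>. (\<Prod>j<p. ennreal (factor i (x j) \<omega>)) \<partial>M)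
     = ennreal (exp (\<Sum>i\<le>n. \<Sum>(j, k)\<in>distinct_pairs p. r (b ^ i * dist (x j) (x k)) / 2))"
    unfolding one by (simp add: prod_ennreal exp_sum[symmetric])
  also have "(\<Sum>i\<le>n. \<Sum>(j, k)\<in>distinct_pairs p. r (b ^ i * dist (x j) (x k)) / 2)
     = (\<Sum>(j, k)\<in>distinct_pairs p. log_corr n (dist (x j) (x k)) / 2)"
    unfolding log_corr_def by (subst sum.swap) (simp add: split_beta sum_divide_distrib)
  finally show ?thesis .
qed

definition total_corr :: real where
  "total_corr = (\<Sum>i. r (b ^ i))"

text \<open>
  If \<open>t \<ge> b\<^bsup>-m\<^esup>\<close>, the first \<open>m\<close> terms are at most \<open>r 0 = s\<^sup>2\<close>, and the term with index \<open>i \<ge> m\<close> is at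
  most \<open>r (b\<^bsup>i - m\<^esup>)\<close>. At \<open>t = 0\<close> all \<open>n + 1\<close> terms equal \<open>s\<^sup>2\<close>.
\<close>

lemma log_corr_le:
  assumes t: "0 \<le> t" and m: "t = 0 \<and> n < m \<or> 1 \<le> t * b ^ m"
  shows "log_corr n t \<le> real m * s\<^sup>2 + total_corr"
proof -
  have bpos: "0 < b" using b by simp
  have s0: "r x \<le> s\<^sup>2" if "0 \<le> x" for x using r_antimono[of 0 x] that r0 by simp
  have "log_corr n t \<le> (\<Sum>i\<le>n. (if i < m then s\<^sup>2 else 0) + (if i < m then 0 else r (b ^ (i - m))))"
    unfolding log_corr_def
  proof (rule sum_mono)
    fix i assume i: "i \<in> {..n}"
    show "r (b ^ i * t) \<le> (if i < m then s\<^sup>2 else 0) + (if i < m then 0 else r (b ^ (i - m)))"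
    proof (cases "i < m")
      case True
      then show ?thesis using s0[of "b ^ i * t"] t bpos by simp
    next
      case False
      then have "1 \<le> t * b ^ m" using m i by auto
      then have "b ^ (i - m) * 1 \<le> b ^ (i - m) * (t * b ^ m)" using bpos by (intro mult_left_mono) auto
      also have "\<dots> = b ^ i * t" using False by (simp add: power_add[symmetric])
      finally show ?thesis using False bpos by (auto intro: r_antimono)
    qed
  qed
  also have "\<dots> = (\<Sum>i\<le>n. if i < m then s\<^sup>2 else 0) + (\<Sum>i\<le>n. if i < m then 0 else r (b ^ (i - m)))"
    by (rule sum.distrib)
  also have "(\<Sum>i\<le>n. if i < m then s\<^sup>2 else 0) = real (card {i \<in> {..n}. i < m}) * s\<^sup>2"
    by (simp add: sum.inter_filter[symmetric])
  also have "\<dots> \<le> real m * s\<^sup>2"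
  proof -
    have "card {i \<in> {..n}. i < m} \<le> card {..<m}" by (intro card_mono) auto
    then show ?thesis by (intro mult_right_mono) auto
  qed
  also have "(\<Sum>i\<le>n. if i < m then 0 else r (b ^ (i - m))) = (\<Sum>i\<in>{m..n}. r (b ^ (i - m)))"
    by (rule sum.mono_neutral_cong_right) auto
  also have "\<dots> = (\<Sum>k\<in>(\<lambda>i. i - m) ` {m..n}. r (b ^ k))"
    by (subst sum.reindex) (auto simp: inj_on_def)
  also have "\<dots> \<le> total_corr"
    unfolding total_corr_def using b by (intro sum_le_suminf summable) (auto intro: r_nonneg)
  finally show ?thesis by simp
qed

text \<open>
  A discretised form of the singularity \<open>t\<close> to the power \<open>-N s\<^sup>2 / ln b\<close>: the \<open>m\<close>-th term dominates the
  range where \<open>t\<close> is of order \<open>b\<^bsup>-m\<^esup>\<close>. At \<open>t = 0\<close> all terms are present, so the bound there is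
  at least as large as needed for every \<open>n\<close> at once.
\<close>

definition singular_bound :: "real \<Rightarrow> real \<Rightarrow> ennreal" where
  "singular_bound N t = (\<Sum>m. ennreal (exp (N * (real m * s\<^sup>2 + total_corr))) * indicator {..2 * b / b ^ m} t)"

text \<open>
  For \<open>t > 0\<close> take the least \<open>m\<close> with \<open>b\<^bsup>-m\<^esup> \<le> t\<close>. Then \<open>t < b b\<^bsup>-m\<^esup>\<close> if \<open>m > 0\<close>; for \<open>m = 0\<close> the range up
  to \<open>2 b\<close> covers all distances on the sphere.
\<close>

lemma exp_log_corr_le:
  assumes N: "0 \<le> N" and t: "0 \<le> t" "t \<le> 2"
  shows "ennreal (exp (N * log_corr n t)) \<le> singular_bound N t"
proof -
  have bpos: "0 < b" using b by simp
  obtain m where m: "t = 0 \<and> n < m \<or> 1 \<le> t * b ^ m" "t \<le> 2 * b / b ^ m"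
  proof (cases "t = 0")
    case True
    then show thesis using that[of "Suc n"] bpos by simp
  next
    case False
    with t have tpos: "0 < t" by simp
    obtain k where "1 / t < b ^ k" using real_arch_pow[OF b] by blast
    then have k: "1 \<le> t * b ^ k" using tpos by (simp add: pos_divide_less_eq mult.commute)
    define m where "m = (LEAST k. 1 \<le> t * b ^ k)"
    have m1: "1 \<le> t * b ^ m" unfolding m_def by (rule LeastI[of "\<lambda>k. 1 \<le> t * b ^ k" k, OF k])
    have "t \<le> 2 * b / b ^ m"
    proof (cases m)
      case 0
      then show ?thesis using t b by simp
    next
      case (Suc l)
      have "\<not> 1 \<le> t * b ^ l" using not_less_Least[of l "\<lambda>k. 1 \<le> t * b ^ k"] Suc unfolding m_def by auto
      then have "t * b ^ l \<le> 2" by simp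
      then show ?thesis using Suc bpos by (simp add: pos_le_divide_eq)
    qed
    with m1 show thesis using that by blast
  qed
  have "exp (N * log_corr n t) \<le> exp (N * (real m * s\<^sup>2 + total_corr))"
    using log_corr_le[OF t(1) m(1)] N by (simp add: mult_left_mono)
  then have "ennreal (exp (N * log_corr n t))
     \<le> ennreal (exp (N * (real m * s\<^sup>2 + total_corr))) * indicator {..2 * b / b ^ m} t"
    using m(2) by (simp add: ennreal_leI)
  also have "\<dots> \<le> (\<Sum>k\<in>{m}. ennreal (exp (N * (real k * s\<^sup>2 + total_corr))) * indicator {..2 * b / b ^ k} t)"
    by (simp only: sum.insert finite.emptyI empty_iff not_False_eq_True sum.empty add_0_right order_refl)
  also have "\<dots> \<le> singular_bound N t"
    unfolding singular_bound_def by (rule sum_le_suminf) auto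
  finally show ?thesis .
qed

lemma measurable_singular_bound[measurable]: "singular_bound N \<in> borel_measurable borel"
  unfolding singular_bound_def by measurable

text \<open>
  A cap of radius of order \<open>b\<^bsup>-m\<^esup>\<close> has measure of order \<open>b\<^bsup>-m d\<^esup>\<close>, where \<open>d + 1\<close> is the dimension
  of the ambient space, so the integral is dominated by a geometric series with ratio
  \<open>exp (N s\<^sup>2) / b\<^sup>d < 1\<close>.
\<close>

lemma singular_bound_integral:
  assumes N: "exp (N * s\<^sup>2) < b ^ (DIM('a) - 1)"
  obtains K where "0 \<le> K"
    "\<And>\<theta>::'a. \<theta> \<in> sphere 0 1 \<Longrightarrow> (\<integral>\<^sup>+\<eta>. singular_bound N (dist \<theta> \<eta>) \<partial>sphere_measure) \<le> ennreal K"
proof -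
  let ?d = "DIM('a) - 1"
  have bpos: "0 < b" using b by simp
  obtain C where C: "0 \<le> C"
    "\<And>(\<theta>::'a) \<rho>. \<theta> \<in> sphere 0 1 \<Longrightarrow> 0 < \<rho> \<Longrightarrow>
      emeasure sphere_measure {\<eta>\<in>sphere 0 1. dist \<theta> \<eta> \<le> \<rho>} \<le> ennreal (C * \<rho> ^ ?d)"
    by (rule sphere_cap_measure_le) blast
  define q where "q = exp (N * s\<^sup>2) / b ^ ?d"
  have q: "0 \<le> q" "q < 1" unfolding q_def using N bpos by auto
  define A where "A = exp (N * total_corr) * C * (2 * b) ^ ?d"
  have A: "0 \<le> A" unfolding A_def using C bpos by simp
  have term_eq: "exp (N * (real m * s\<^sup>2 + total_corr)) * (C * (2 * b / b ^ m) ^ ?d) = A * q ^ m" for m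
  proof -
    have "exp (N * (real m * s\<^sup>2 + total_corr)) = exp (N * total_corr) * exp (N * s\<^sup>2) ^ m"
      by (simp add: exp_add[symmetric] exp_of_nat_mult[symmetric] algebra_simps)
    moreover have "(b ^ m) ^ ?d = (b ^ ?d) ^ m" by (simp only: power_mult[symmetric] mult.commute)
    then have "(2 * b / b ^ m) ^ ?d = (2 * b) ^ ?d / (b ^ ?d) ^ m" by (simp only: power_divide)
    moreover have "q ^ m = exp (N * s\<^sup>2) ^ m / (b ^ ?d) ^ m" unfolding q_def by (rule power_divide)
    ultimately show ?thesis unfolding A_def
      by (simp only: times_divide_eq_right times_divide_eq_left mult_ac)
  qed
  have sumq: "(\<lambda>m. A * q ^ m) sums (A * (1 / (1 - q)))"
    using q by (intro sums_mult geometric_sums) simp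
  show thesis
  proof (rule that)
    show "0 \<le> A * (1 / (1 - q))" using A q by simp
    fix \<theta> :: 'a assume \<theta>: "\<theta> \<in> sphere 0 1"
    have "(\<integral>\<^sup>+\<eta>. singular_bound N (dist \<theta> \<eta>) \<partial>sphere_measure)
      = (\<Sum>m. \<integral>\<^sup>+\<eta>. ennreal (exp (N * (real m * s\<^sup>2 + total_corr))) * indicator {..2 * b / b ^ m} (dist \<theta> \<eta>) \<partial>sphere_measure)"
      unfolding singular_bound_def by (rule nn_integral_suminf) measurable
    also have "\<dots> \<le> (\<Sum>m. ennreal (A * q ^ m))"
    proof (rule suminf_le)
      fix m
      have capset: "{\<eta>\<in>sphere 0 1. dist \<theta> \<eta> \<le> 2 * b / b ^ m} \<in> sets (sphere_measure :: 'a measure)"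
      proof -
        have "{\<eta>\<in>sphere 0 1. dist \<theta> \<eta> \<le> 2 * b / b ^ m} = sphere 0 1 \<inter> cball \<theta> (2 * b / b ^ m)" by auto
        then show ?thesis by (auto simp: sets_restrict_space)
      qed
      have "(\<integral>\<^sup>+\<eta>. ennreal (exp (N * (real m * s\<^sup>2 + total_corr))) * indicator {..2 * b / b ^ m} (dist \<theta> \<eta>) \<partial>sphere_measure)
        = (\<integral>\<^sup>+\<eta>. ennreal (exp (N * (real m * s\<^sup>2 + total_corr))) * indicator {\<eta>\<in>sphere 0 1. dist \<theta> \<eta> \<le> 2 * b / b ^ m} \<eta> \<partial>sphere_measure)"
        by (intro nn_integral_cong) (auto split: split_indicator)
      also have "\<dots> = ennreal (exp (N * (real m * s\<^sup>2 + total_corr))) * emeasure sphere_measure {\<eta>\<in>sphere 0 1. dist \<theta> \<eta> \<le> 2 * b / b ^ m}"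
        using capset by (rule nn_integral_cmult_indicator)
      also have "\<dots> \<le> ennreal (exp (N * (real m * s\<^sup>2 + total_corr))) * ennreal (C * (2 * b / b ^ m) ^ ?d)"
        using bpos by (intro mult_left_mono C(2)[OF \<theta>]) auto
      also have "\<dots> = ennreal (A * q ^ m)"
        unfolding term_eq[symmetric] using C(1) bpos by (intro ennreal_mult[symmetric]) auto
      finally show "(\<integral>\<^sup>+\<eta>. ennreal (exp (N * (real m * s\<^sup>2 + total_corr))) * indicator {..2 * b / b ^ m} (dist \<theta> \<eta>) \<partial>sphere_measure)
        \<le> ennreal (A * q ^ m)" .
    qed auto
    also have "\<dots> = ennreal (A * (1 / (1 - q)))"
      by (rule suminf_ennreal_eq[OF _ sumq]) (use A q in simp)
    finally show "(\<integral>\<^sup>+\<eta>. singular_bound N (dist \<theta> \<eta>) \<partial>sphere_measure) \<le> ennreal (A * (1 / (1 - q)))" .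
  qed
qed

text \<open>
  There are \<open>p (p - 1)\<close> ordered pairs, each with weight \<open>1/2\<close>, so bounding by the worst pair
  multiplies the exponent by \<open>N = p (p - 1) / 2\<close>; then the singularity of a single pair is
  integrable by the threshold condition.
\<close>

lemma moment_bound:
  assumes p: "2 \<le> p" and threshold: "exp (real (p * (p - 1)) / 2 * s\<^sup>2) < b ^ (DIM('a) - 1)"
  obtains K where "\<And>n. (\<integral>\<^sup>+\<omega>. cascade.mass n (space sphere_measure) \<omega> ^ p \<partial>M) \<le> ennreal K"
proof -
  let ?\<sigma> = "sphere_measure :: 'a measure"
  let ?P = "PiM {..<p} (\<lambda>_. ?\<sigma>)"
  define N where "N = real (p * (p - 1)) / 2"
  have N_nonneg: "0 \<le> N" by (simp add: N_def)
  obtain K where K: "0 \<le> K"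
    "\<And>\<theta>::'a. \<theta> \<in> sphere 0 1 \<Longrightarrow> (\<integral>\<^sup>+\<eta>. singular_bound N (dist \<theta> \<eta>) \<partial>?\<sigma>) \<le> ennreal K"
    using singular_bound_integral[of N] threshold unfolding N_def by blast
  have ne: "distinct_pairs p \<noteq> {}"
  proof -
    have "(0, 1) \<in> distinct_pairs p" using p by (auto simp: distinct_pairs_def)
    then show ?thesis by blast
  qed
  define S where "S = measure ?\<sigma> (sphere 0 1)"
  define T where "T = real (p * (p - 1)) * (K * S ^ (p - 1))"
  have gm: "(\<lambda>(\<theta>, \<eta>). singular_bound N (dist \<theta> \<eta>)) \<in> borel_measurable (?\<sigma> \<Otimes>\<^sub>M ?\<sigma>)"
  proof -
    have [measurable]: "fst \<in> ?\<sigma> \<Otimes>\<^sub>M ?\<sigma> \<rightarrow>\<^sub>M borel" "snd \<in> ?\<sigma> \<Otimes>\<^sub>M ?\<sigma> \<rightarrow>\<^sub>M borel"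
      using measurable_compose[OF measurable_fst id_sphere_measurable] measurable_compose[OF measurable_snd id_sphere_measurable] by simp_all
    show ?thesis unfolding split_beta by measurable
  qed
  have "(\<integral>\<^sup>+\<omega>. cascade.mass n (space ?\<sigma>) \<omega> ^ p \<partial>M) \<le> ennreal T" for n
  proof -
    have "(\<integral>\<^sup>+\<omega>. cascade.mass n (space ?\<sigma>) \<omega> ^ p \<partial>M)
       = (\<integral>\<^sup>+x. ennreal (exp (\<Sum>(j, k)\<in>distinct_pairs p. log_corr n (dist (x j) (x k)) / 2)) \<partial>?P)"
      unfolding cascade.mass_moment_eq factor_moment ..
    also have "\<dots> \<le> (\<integral>\<^sup>+x. (\<Sum>(j, k)\<in>distinct_pairs p. singular_bound N (dist (x j) (x k))) \<partial>?P)"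
    proof (rule nn_integral_mono)
      fix x assume x: "x \<in> space ?P"
      let ?a = "\<lambda>(j, k). log_corr n (dist (x j) (x k)) / 2"
      have "exp (\<Sum>d\<in>distinct_pairs p. ?a d) \<le> (\<Sum>d\<in>distinct_pairs p. exp (real (card (distinct_pairs p)) * ?a d))"
        using ne by (intro exp_sum_le_sum_exp) auto
      also have "\<dots> = (\<Sum>(j, k)\<in>distinct_pairs p. exp (N * log_corr n (dist (x j) (x k))))"
        by (simp add: card_distinct_pairs N_def split_beta)
      finally have "ennreal (exp (\<Sum>d\<in>distinct_pairs p. ?a d))
          \<le> ennreal (\<Sum>(j, k)\<in>distinct_pairs p. exp (N * log_corr n (dist (x j) (x k))))"
        by (rule ennreal_leI)
      also have "\<dots> = (\<Sum>(j, k)\<in>distinct_pairs p. ennreal (exp (N * log_corr n (dist (x j) (x k)))))"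
        by (simp add: split_beta sum_ennreal)
      also have "\<dots> \<le> (\<Sum>(j, k)\<in>distinct_pairs p. singular_bound N (dist (x j) (x k)))"
      proof (rule sum_mono)
        fix d assume "d \<in> distinct_pairs p"
        then obtain j k where d: "d = (j, k)" "j < p" "k < p" by (auto simp: distinct_pairs_def)
        have xs: "x \<in> {..<p} \<rightarrow>\<^sub>E sphere 0 1" using x by (simp only: space_PiM space_sphere_measure)
        have "x j \<in> sphere 0 1" "x k \<in> sphere 0 1"
          using PiE_mem[OF xs, of j] PiE_mem[OF xs, of k] d(2,3) by simp_all
        then have "norm (x j) = 1" "norm (x k) = 1" by simp_all
        then have "dist (x j) (x k) \<le> 2" using norm_triangle_ineq4[of "x j" "x k"] by (simp add: dist_norm)
        then show "(case d of (j, k) \<Rightarrow> ennreal (exp (N * log_corr n (dist (x j) (x k)))))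
            \<le> (case d of (j, k) \<Rightarrow> singular_bound N (dist (x j) (x k)))"
          unfolding d(1) using exp_log_corr_le[OF N_nonneg zero_le_dist] by simp
      qed
      finally show "ennreal (exp (\<Sum>(j, k)\<in>distinct_pairs p. log_corr n (dist (x j) (x k)) / 2))
          \<le> (\<Sum>(j, k)\<in>distinct_pairs p. singular_bound N (dist (x j) (x k)))" .
    qed
    also have "\<dots> = (\<Sum>d\<in>distinct_pairs p. \<integral>\<^sup>+x. (case d of (j, k) \<Rightarrow> singular_bound N (dist (x j) (x k))) \<partial>?P)"
    proof (rule nn_integral_sum)
      fix d assume "d \<in> distinct_pairs p"
      then obtain j k where d: "d = (j, k)" "j < p" "k < p" by (auto simp: distinct_pairs_def)
      have "(\<lambda>x. (x j, x k)) \<in> ?P \<rightarrow>\<^sub>M ?\<sigma> \<Otimes>\<^sub>M ?\<sigma>"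
        using d by (intro measurable_Pair measurable_component_singleton) auto
      from measurable_compose[OF this gm]
      show "(\<lambda>x. case d of (j, k) \<Rightarrow> singular_bound N (dist (x j) (x k))) \<in> borel_measurable ?P" by (simp add: d(1))
    qed
    also have "\<dots> \<le> (\<Sum>d\<in>distinct_pairs p. ennreal (K * S ^ (p - 1)))"
    proof (rule sum_mono)
      fix d assume "d \<in> distinct_pairs p"
      then obtain j k where d: "d = (j, k)" "j < p" "k < p" "j \<noteq> k" by (auto simp: distinct_pairs_def)
      have "(\<integral>\<^sup>+x. singular_bound N (dist (x j) (x k)) \<partial>?P) \<le> ennreal K * emeasure ?\<sigma> (space ?\<sigma>) ^ (card {..<p} - 1)"
        using d K(2) by (intro finite_measure.nn_integral_PiM_pair_le[OF finite_sphere_measure _ _ _ _ gm]) auto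
      also have "\<dots> = ennreal (K * S ^ (p - 1))"
        using K(1) by (simp add: S_def cascade.directing.emeasure_eq_measure ennreal_mult ennreal_power[symmetric])
      finally show "(\<integral>\<^sup>+x. (case d of (j, k) \<Rightarrow> singular_bound N (dist (x j) (x k))) \<partial>?P) \<le> ennreal (K * S ^ (p - 1))"
        by (simp add: d(1))
    qed
    also have "\<dots> = ennreal T"
      using K(1) unfolding T_def
      by (simp add: card_distinct_pairs ennreal_of_nat_eq_real_of_nat ennreal_mult[symmetric] S_def)
    finally show ?thesis .
  qed
  then show thesis by (rule that)
qed

end

section \<open>The limit of the spherical cascade\<close>

theorem corollary2:
  fixes M :: "'w measure"
    and X :: "nat \<Rightarrow> real ^ 'n \<Rightarrow> 'w \<Rightarrow> real"
    and r :: "real \<Rightarrow> real"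
    and s b :: real
    and d p :: nat
    and \<BB> :: "(real ^ 'n) set set"
  assumes "prob_space M"
    and "d \<ge> 1" and "CARD('n) = d + 1"
    and "iid_fields M X"
    and "\<And>i. gaussian_field M (X i)"
    and "\<And>i. homogeneous_isotropic M (X i)"
    and "\<And>i u. (\<integral>\<omega>. X i u \<omega> \<partial>M) = 0"
    and "\<And>i u. prob_space.variance M (X i u) = s\<^sup>2" and "s\<^sup>2 > 0"
    and "\<And>i u v. r (norm (u - v)) = (\<integral>\<omega>. X i u \<omega> * X i v \<omega> \<partial>M)"
    and "b > 1"
    and "antimono_on {0..} r"
    and "p \<ge> 2"
    and "b > exp (real p * (real p - 1) * s\<^sup>2 / (2 * real d))"
    and "summable (\<lambda>i. r (b ^ i))"
    and "countable \<BB>"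
    and "\<BB> \<subseteq> sets (restrict_space borel (sphere 0 1))"
  shows "\<exists>\<mu>. random_sphere_measure M \<mu> \<and>
    (\<forall>B\<in>\<BB>.
      (AE \<omega> in M. (\<lambda>n. emeasure (cumulative_measure (exp_field M X b) n \<omega>) B)
                     \<longlonglongrightarrow> emeasure (\<mu> \<omega>) B) \<and>
      converges_in_Lp M p
        (\<lambda>n \<omega>. measure (cumulative_measure (exp_field M X b) n \<omega>) B)
        (\<lambda>\<omega>. measure (\<mu> \<omega>) B)) \<and>
    (summable (\<lambda>i. s\<^sup>2 - r (b powi (- int i))) \<longrightarrow> non_degenerate M \<mu>)"
proof -
  let ?\<sigma> = "sphere_measure :: (real ^ 'n) measure"
  interpret prob_space M by fact
  have r0: "r 0 = s\<^sup>2"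
    using assms(8)[of 0 0] assms(10)[of 0 0 0] assms(7)[of 0 0] by (simp add: power2_eq_square)
  interpret gaussian_cascade M X r s b
  proof
    show "indep_vars (\<lambda>_. PiM UNIV (\<lambda>_. borel)) (\<lambda>i \<omega> u. X i u \<omega>) UNIV"
      using assms(4) by (simp add: iid_fields_def)
    show "integrable M (\<lambda>\<omega>. (X i u \<omega>)\<^sup>2)" for i u
      using assms(6)[of i] by (simp add: homogeneous_isotropic_def)
  qed (use assms r0 in auto)
  \<comment> \<open>The condition on \<open>b\<close>, raised to the power \<open>d\<close>.\<close>
  have threshold: "exp (real (p * (p - 1)) / 2 * s\<^sup>2) < b ^ (DIM(real ^ 'n) - 1)"
  proof -
    have d: "DIM(real ^ 'n) - 1 = d" "0 < d" using assms(2,3) by auto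
    let ?y = "real p * (real p - 1) * s\<^sup>2 / (2 * real d)"
    have "real (p * (p - 1)) = real p * (real p - 1)" using assms(13) by (simp add: of_nat_diff)
    then have "exp (real (p * (p - 1)) / 2 * s\<^sup>2) = exp (real d * ?y)" using d(2) by simp
    also have "\<dots> = exp ?y ^ d" by (rule exp_of_nat_mult)
    also have "\<dots> < b ^ d" using assms(14) d(2) by (intro power_strict_mono) auto
    finally show ?thesis unfolding d(1) .
  qed
  obtain K where K: "\<And>n. (\<integral>\<^sup>+\<omega>. cascade.mass n (space ?\<sigma>) \<omega> ^ p \<partial>M) \<le> ennreal K"
    using moment_bound[OF assms(13) threshold] by blast
  obtain \<phi> :: "real ^ 'n \<Rightarrow> real" and \<psi> where coding: "\<phi> \<in> borel_measurable (restrict_space borel (sphere 0 1))"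
    "\<psi> \<in> borel \<rightarrow>\<^sub>M restrict_space borel (sphere 0 1)"
    "\<And>x. \<phi> x \<in> {0..1}" "\<And>x. x \<in> sphere 0 1 \<Longrightarrow> \<psi> (\<phi> x) = x"
    using sphere_coded_in_unit_interval by blast
  have \<phi>: "\<phi> \<in> borel_measurable ?\<sigma>" and \<psi>: "\<psi> \<in> borel \<rightarrow>\<^sub>M ?\<sigma>"
    using coding(1,2) by (simp_all cong: measurable_cong_sets)
  obtain \<mu> where \<mu>: "\<And>\<omega>. sets (\<mu> \<omega>) = sets ?\<sigma>" "\<And>\<omega>. finite_measure (\<mu> \<omega>)"
    "\<And>B. B \<in> sets ?\<sigma> \<Longrightarrow> (\<lambda>\<omega>. emeasure (\<mu> \<omega>) B) \<in> borel_measurable M"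
    "\<And>B. B \<in> sets ?\<sigma> \<Longrightarrow> AE \<omega> in M. (\<lambda>n. cascade.mass n B \<omega>) \<longlonglongrightarrow> emeasure (\<mu> \<omega>) B"
    "\<And>B n. B \<in> sets ?\<sigma> \<Longrightarrow> integrable M (\<lambda>\<omega>. \<bar>enn2real (cascade.mass n B \<omega>)\<bar> ^ p)"
    "\<And>B. B \<in> sets ?\<sigma> \<Longrightarrow> integrable M (\<lambda>\<omega>. \<bar>measure (\<mu> \<omega>) B\<bar> ^ p)"
    "\<And>B. B \<in> sets ?\<sigma> \<Longrightarrow> (\<lambda>n. \<integral>\<omega>. \<bar>enn2real (cascade.mass n B \<omega>) - measure (\<mu> \<omega>) B\<bar> ^ p \<partial>M) \<longlonglongrightarrow> 0"
    "\<And>B. B \<in> sets ?\<sigma> \<Longrightarrow> (\<integral>\<^sup>+\<omega>. emeasure (\<mu> \<omega>) B \<partial>M) = emeasure ?\<sigma> B"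
    by (rule cascade.limit_measure[OF assms(13) K \<phi> \<psi>]) (use coding(3,4) in auto)
  have mass: "emeasure (cumulative_measure (exp_field M X b) n \<omega>) B = cascade.mass n B \<omega>"
    if B: "B \<in> sets ?\<sigma>" and \<omega>: "\<omega> \<in> space M" for n \<omega> B
  proof -
    have "(\<lambda>\<theta>. cascade.partial_product n \<theta> \<omega>) \<in> borel_measurable ?\<sigma>" using \<omega> by simp
    then show ?thesis
      using B unfolding cumulative_measure_def exp_field_eq_factor cascade.mass_def cascade.partial_product_def
      by (subst emeasure_density) auto
  qed
  have measure_mass: "measure (cumulative_measure (exp_field M X b) n \<omega>) B = enn2real (cascade.mass n B \<omega>)"
    if "B \<in> sets ?\<sigma>" "\<omega> \<in> space M" for n \<omega> B
    unfolding measure_def mass[OF that] ..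
  have "random_sphere_measure M \<mu>"
    unfolding random_sphere_measure_def using \<mu>(1-3) by simp
  moreover have "AE \<omega> in M. (\<lambda>n. emeasure (cumulative_measure (exp_field M X b) n \<omega>) B) \<longlonglongrightarrow> emeasure (\<mu> \<omega>) B"
    if B: "B \<in> sets ?\<sigma>" for B
    using \<mu>(4)[OF B] AE_space by eventually_elim (simp add: mass[OF B])
  moreover have "converges_in_Lp M p (\<lambda>n \<omega>. measure (cumulative_measure (exp_field M X b) n \<omega>) B) (\<lambda>\<omega>. measure (\<mu> \<omega>) B)"
    if B: "B \<in> sets ?\<sigma>" for B
  proof -
    note [measurable] = \<mu>(3)[OF B] B
    have "in_Lp M p (\<lambda>\<omega>. measure (cumulative_measure (exp_field M X b) n \<omega>) B)" for n
    proof -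
      have "(\<lambda>\<omega>. enn2real (cascade.mass n B \<omega>)) \<in> borel_measurable M" by measurable
      then have "(\<lambda>\<omega>. measure (cumulative_measure (exp_field M X b) n \<omega>) B) \<in> borel_measurable M"
        by (rule measurable_cong[THEN iffD1, rotated]) (simp add: measure_mass[OF B])
      moreover have "integrable M (\<lambda>\<omega>. \<bar>measure (cumulative_measure (exp_field M X b) n \<omega>) B\<bar> ^ p)"
        using \<mu>(5)[OF B, of n] by (rule Bochner_Integration.integrable_cong[THEN iffD1, OF refl, rotated]) (simp add: measure_mass[OF B])
      ultimately show ?thesis unfolding in_Lp_def by simp
    qed
    moreover have "in_Lp M p (\<lambda>\<omega>. measure (\<mu> \<omega>) B)"
      unfolding in_Lp_def using \<mu>(6)[OF B] by (simp add: measure_def)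
    moreover have "(\<integral>\<omega>. \<bar>measure (cumulative_measure (exp_field M X b) n \<omega>) B - measure (\<mu> \<omega>) B\<bar> ^ p \<partial>M)
        = (\<integral>\<omega>. \<bar>enn2real (cascade.mass n B \<omega>) - measure (\<mu> \<omega>) B\<bar> ^ p \<partial>M)" for n
      by (intro Bochner_Integration.integral_cong refl) (simp add: measure_mass[OF B])
    ultimately show ?thesis unfolding converges_in_Lp_def using \<mu>(7)[OF B] by simp
  qed
  moreover have "non_degenerate M \<mu>"
    unfolding non_degenerate_def
  proof
    have S: "sphere 0 1 \<in> sets ?\<sigma>" using sets.top[of ?\<sigma>] by simp
    assume "AE \<omega> in M. \<forall>B\<in>sets (\<mu> \<omega>). emeasure (\<mu> \<omega>) B = 0"
    then have "AE \<omega> in M. emeasure (\<mu> \<omega>) (sphere 0 1) = 0"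
      by eventually_elim (use S \<mu>(1) in simp)
    then have "(\<integral>\<^sup>+\<omega>. emeasure (\<mu> \<omega>) (sphere 0 1) \<partial>M) = (\<integral>\<^sup>+\<omega>. 0 \<partial>M)" by (rule nn_integral_cong_AE)
    then show False using \<mu>(8)[OF S] emeasure_sphere_pos[where 'a="real ^ 'n"] by simp
  qed
  ultimately show ?thesis using assms(17) by (intro exI[of _ \<mu>]) (auto simp: subset_iff)
qed

end
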